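(* Let $p$ be a prime, let $k \in \mathbb{Z}_{\geq 1}$, and let $P(t) \in (\mathbb{Z}/p^{k}\mathbb{Z})[t]$ be a monic polynomial whose image in $\mathbb{F}_{p}[t]$ modulo $p$ is irreducible. Let $R := (\mathbb{Z}/p^{k}\mathbb{Z})[t]/(P(t))$, let $G$ be a finite size $R$-module, let $q := p^{\deg(P)}$, $\mathbb{F}_{q} := \mathbb{F}_{p}[t]/(P(t))$, $r_{q}(G) := \dim_{\mathbb{F}_{q}}(G/pG)$, and $u_{q}(G) := \dim_{\mathbb{F}_{q}}(p^{k-1}G)$. Fix $n \in \mathbb{Z}_{\geq 1}$. For any $\bar{X} \in \mathrm{M}_{n}(\mathbb{F}_{p})$ such that $\mathrm{cok}(P(\bar{X})) \simeq G/pG$, if $X$ is chosen uniformly at random from $\mathrm{M}_{n}(\mathbb{Z}/p^{k}\mathbb{Z})$, then $$\mathrm{Prob}\left(\mathrm{cok}(P(X)) \simeq G \ \text{ and } \ X \equiv \bar{X} \pmod{p}\right) = \frac{p^{\deg(P)r_{q}(G)^{2} - n^{2}}}{|\mathrm{Aut}_{R}(G)|\prod_{i=1}^{u_{q}(G)}(1 - p^{-i\deg(P)})}\prod_{i=1}^{r_{q}(G)}(1 - p^{-i\deg(P)})^{2}.$$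
   Context: $\mathrm{M}_{n}(A)$ denotes the ring of $n \times n$ matrices over a commutative ring $A$ with unity, and $\mathbb{F}_{p} = \mathbb{Z}/p\mathbb{Z}$. In forming $P(\bar X)$ and $\mathbb{F}_p[t]/(P(t))$, $P$ is reduced modulo $p$. $\mathrm{cok}(P(X)) = (\mathbb{Z}/p^{k}\mathbb{Z})^{n}/P(X)(\mathbb{Z}/p^{k}\mathbb{Z})^{n}$ is an $R$-module, where the image $\bar{t} \in R$ of $t$ acts as left multiplication by $X$; similarly $\mathrm{cok}(P(\bar{X})) = \mathbb{F}_{p}^{n}/P(\bar{X})\mathbb{F}_{p}^{n}$ is a module over $R/pR = \mathbb{F}_{q}$ (a field with $q$ elements) with $\bar t$ acting by $\bar{X}$. The isomorphisms are isomorphisms of $R$-modules. Since $p^{k}G=0$, both $G/pG$ and $p^{k-1}G$ are $\mathbb{F}_{q}$-vector spaces. $\mathrm{Aut}_{R}(G)$ is the group of $R$-linear automorphisms of $G$. Empty products are equal to $1$. *)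

theory Defs
  imports
    "HOL-Probability.Probability_Mass_Function"
    "HOL-Algebra.Bij"
    "HOL-Algebra.QuotRing"
    "Jordan_Normal_Form.VS_Connect"
    "Berlekamp_Zassenhaus.Finite_Field"
begin

text \<open>
  The ring \<open>\<int>/m\<int>\<close> is the type \<open>'a mod_ring\<close> with \<open>CARD('a) = m\<close>.  Modules are
  records in the sense of \<open>HOL-Algebra\<close>; their fields \<open>mult\<close> and \<open>one\<close> are never used.
\<close>

text \<open>The canonical map \<open>\<int>/m\<int> \<rightarrow> \<int>/l\<int>\<close>; it is a ring homomorphism when \<open>l\<close> divides \<open>m\<close>.\<close>

definition reduce_mod :: "'a::nontriv mod_ring \<Rightarrow> 'b::nontriv mod_ring" where
  "reduce_mod a = of_int (to_int_mod_ring a)"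

text \<open>The quotient ring \<open>A[t]/(P(t))\<close>, whose elements are cosets of polynomials.\<close>

definition poly_quot :: "'a::comm_ring_1 poly \<Rightarrow> 'a poly set ring" where
  "poly_quot P = class_ring Quot (PIdl\<^bsub>class_ring\<^esub> P)"

text \<open>
  The map \<open>A[t]/(P) \<rightarrow> B[t]/(Q)\<close> induced by coefficientwise reduction, \<open>Q\<close> being the
  reduction of \<open>P\<close>.  As reduction is surjective when \<open>l\<close> divides \<open>m\<close>, the image of the coset
  \<open>f + (P)\<close> as a set of polynomials is exactly the coset of the reduction of \<open>f\<close>.
\<close>

definition reduce_quot :: "'a::nontriv mod_ring poly set \<Rightarrow> 'b::nontriv mod_ring poly set" where
  "reduce_quot C = map_poly reduce_mod ` C"

definition poly_mat :: "'a::comm_ring_1 poly \<Rightarrow> 'a mat \<Rightarrow> 'a mat" where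
  "poly_mat f A = mat (dim_row A) (dim_row A)
     (\<lambda>(i, j). \<Sum>l\<le>degree f. Polynomial.coeff f l * (A ^\<^sub>m l) $$ (i, j))"

definition quot_module :: "('r, 'm) module \<Rightarrow> 'm set \<Rightarrow> ('r, 'm set) module" where
  "quot_module M N = \<lparr>carrier = a_rcosets\<^bsub>M\<^esub> N, mult = undefined, one = undefined,
     zero = N, add = set_add M, smult = (\<lambda>r A. \<Union>a\<in>A. N +>\<^bsub>M\<^esub> (r \<odot>\<^bsub>M\<^esub> a))\<rparr>"

text \<open>
  \<open>M\<close> as an \<open>S\<close>-module, for a map \<open>\<phi>\<close> from \<open>S\<close> to the scalars of \<open>M\<close>.
\<close>

definition restrict_scalars :: "('s \<Rightarrow> 'r) \<Rightarrow> ('r, 'm) module \<Rightarrow> ('s, 'm) module" where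
  "restrict_scalars \<phi> M = \<lparr>carrier = carrier M, mult = undefined, one = undefined,
     zero = \<zero>\<^bsub>M\<^esub>, add = add M, smult = (\<lambda>s x. \<phi> s \<odot>\<^bsub>M\<^esub> x)\<rparr>"

text \<open>
  \<open>M\<close>, a module over \<open>R\<close>, as a module over the image of a homomorphism \<open>\<pi>\<close> whose kernel
  annihilates \<open>M\<close>: a scalar acts through any of its preimages in \<open>R\<close>, the choice being
  immaterial by the assumption on the kernel.
\<close>

definition descend_scalars ::
    "('r, 'c) ring_scheme \<Rightarrow> ('r \<Rightarrow> 's) \<Rightarrow> ('r, 'm) module \<Rightarrow> ('s, 'm) module" where
  "descend_scalars R \<pi> M = \<lparr>carrier = carrier M, mult = undefined, one = undefined,
     zero = \<zero>\<^bsub>M\<^esub>, add = add M, smult = (\<lambda>s x. inv_into (carrier R) \<pi> s \<odot>\<^bsub>M\<^esub> x)\<rparr>"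

text \<open>For an \<open>n \<times> n\<close> matrix \<open>X\<close> over \<open>A\<close>, the \<open>A[t]\<close>-module \<open>A\<^sup>n\<close> on which \<open>t\<close> acts as \<open>X\<close>.\<close>

definition mat_module :: "'a::comm_ring_1 mat \<Rightarrow> ('a poly, 'a vec) module" where
  "mat_module X = \<lparr>carrier = carrier_vec (dim_row X), mult = undefined, one = undefined,
     zero = 0\<^sub>v (dim_row X), add = (+), smult = (\<lambda>f v. poly_mat f X *\<^sub>v v)\<rparr>"

text \<open>\<open>cok(P(X)) = A\<^sup>n / P(X) A\<^sup>n\<close> as a module over \<open>A[t]/(P(t))\<close>.\<close>

definition cok_poly :: "'a::comm_ring_1 poly \<Rightarrow> 'a mat \<Rightarrow> ('a poly set, 'a vec set) module" where
  "cok_poly P X = descend_scalars class_ring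
     (\<lambda>f. (PIdl\<^bsub>class_ring\<^esub> P) +>\<^bsub>class_ring\<^esub> f)
     (quot_module (mat_module X) ((\<lambda>v. poly_mat P X *\<^sub>v v) ` carrier_vec (dim_row X)))"

definition multiples :: "nat \<Rightarrow> ('r, 'm) module \<Rightarrow> 'm set" where
  "multiples m M = (\<lambda>x. [m] \<cdot>\<^bsub>M\<^esub> x) ` carrier M"

definition module_iso ::
    "('r, 'c) ring_scheme \<Rightarrow> ('r, 'm) module \<Rightarrow> ('r, 'n) module \<Rightarrow> bool" where
  "module_iso R M N \<longleftrightarrow> (\<exists>f \<in> module_hom R M N. bij_betw f (carrier M) (carrier N))"

definition module_aut :: "('r, 'c) ring_scheme \<Rightarrow> ('r, 'm) module \<Rightarrow> ('m \<Rightarrow> 'm) set" where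
  "module_aut R M = module_hom R M M \<inter> Bij (carrier M)"

text \<open>
  The invariants \<open>r\<^sub>q(G)\<close> and \<open>u\<^sub>q(G)\<close>, the dimensions of \<open>G/pG\<close> and \<open>p\<^sup>k\<^sup>-\<^sup>1G\<close> over
  \<open>\<F>\<^sub>q = \<F>\<^sub>p[t]/(Q)\<close>, where \<open>R = (\<int>/p\<^sup>k\<int>)[t]/(P)\<close>, \<open>Q\<close> is \<open>P\<close> modulo \<open>p\<close>, and \<open>\<F>\<^sub>q\<close> acts
  through the surjection \<open>R \<rightarrow> \<F>\<^sub>q\<close> with kernel \<open>pR\<close>.
\<close>

definition r_q :: "nat \<Rightarrow> 'a::nontriv mod_ring poly \<Rightarrow> 'b::prime_card mod_ring poly
    \<Rightarrow> ('a mod_ring poly set, 'm) module \<Rightarrow> nat" where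
  "r_q p P Q G = vectorspace.dim (poly_quot Q)
     (descend_scalars (poly_quot P) reduce_quot (quot_module G (multiples p G)))"

definition u_q :: "nat \<Rightarrow> nat \<Rightarrow> 'a::nontriv mod_ring poly \<Rightarrow> 'b::prime_card mod_ring poly
    \<Rightarrow> ('a mod_ring poly set, 'm) module \<Rightarrow> nat" where
  "u_q p k P Q G = vectorspace.dim (poly_quot Q)
     (descend_scalars (poly_quot P) reduce_quot (G\<lparr>carrier := multiples (p ^ (k - 1)) G\<rparr>))"

end

theory Submission
  imports Defs
begin

text \<open>
  Write \<open>A = \<int>/p\<^sup>k\<close>, \<open>d = deg P\<close>, \<open>q = p\<^sup>d\<close>, \<open>r = r\<^sub>q(G)\<close> and \<open>u = u\<^sub>q(G)\<close>.  Modules over \<open>R = A[t]/(P)\<close> are handled as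
  modules over \<open>A[t]\<close>, which acts through \<open>A[t] \<rightarrow> R\<close>; this changes neither linear maps nor
  isomorphisms.  The maximal ideal \<open>J = (p, P)\<close> of \<open>A[t]\<close> has residue field \<open>\<F>\<^sub>q\<close>.

  A tuple \<open>g\<close> in \<open>G\<^sup>n\<close> is the same thing as an \<open>A\<close>-linear map \<open>F\<^sub>g : A\<^sup>n \<rightarrow> G\<close> (\<open>lin\<close>).  For a lift \<open>X\<close>
  of \<open>Xbar\<close>, an isomorphism \<open>cok(P(X)) \<simeq> G\<close> amounts to a tuple \<open>g\<close> with \<open>F\<^sub>g\<close> surjective,
  \<open>F\<^sub>g(X v) = t F\<^sub>g(v)\<close> and \<open>ker F\<^sub>g = P(X) A\<^sup>n\<close>, and \<open>Aut\<^sub>R(G)\<close> permutes these tuples simply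
  transitively (\<open>card_presentations\<close>).  So the number of lifts with cokernel \<open>G\<close>, multiplied by
  \<open>|Aut\<^sub>R(G)|\<close>, is the number of such pairs \<open>(X, g)\<close>, and these are counted by choosing \<open>g\<close> first.

  To count the tuples \<open>g\<close> that occur, fix one lift \<open>X\<^sub>0\<close>.  For every pair, \<open>F\<^sub>g\<close> is surjective and satisfies
  \<open>F\<^sub>g(X\<^sub>0 v) = t F\<^sub>g(v)\<close> modulo \<open>pG\<close>.  A map with the second property induces an \<open>\<F>\<^sub>q\<close>-linear map from
  \<open>A\<^sup>n/(P(X\<^sub>0) A\<^sup>n + p A\<^sup>n) = cok(P(Xbar))\<close>, of dimension \<open>r\<close>, to \<open>G/pG\<close>, and by Nakayama it is
  surjective iff the values at a basis generate \<open>G/pG\<close>.  All lists of values are equally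
  frequent, which gives \<open>|pG|\<^sup>n \<Prod>\<^sub>i\<^sub><\<^sub>r (q\<^sup>r - q\<^sup>i)\<close> choices (\<open>card_surjective_homs\<close>).

  It remains to count the lifts \<open>X\<close> that go with such a \<open>g\<close>.  There is a lift \<open>X\<^sub>1\<close> that satisfies \<open>F\<^sub>g(X\<^sub>1 v) = t F\<^sub>g(v)\<close> exactly
  (\<open>ex_commuting_lift\<close>).  Let \<open>N = ker F\<^sub>g\<close> and \<open>M = N \<inter> p A\<^sup>n\<close>.  The lifts with this property are
  the matrices \<open>X\<^sub>1 + W\<close> with \<open>W A\<^sup>n \<subseteq> M\<close>, and \<open>P(X) A\<^sup>n \<subseteq> N\<close> for all of them.  Let \<open>v\<^sub>1, \<dots>, v\<^sub>r\<close> be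
  a basis modulo \<open>p A\<^sup>n\<close> of the vectors that \<open>P(X)\<close> maps into \<open>p A\<^sup>n\<close>.  Again by Nakayama,
  \<open>P(X) A\<^sup>n = N\<close> iff the vectors \<open>P(X) v\<^sub>i\<close> generate \<open>M\<close> modulo \<open>pN\<close> (\<open>kernel_iff_gen\<close>).  If \<open>W\<close> kills
  \<open>X\<^sub>1\<^sup>c v\<^sub>i\<close> for \<open>c < d - 1\<close> modulo \<open>pN\<close>, then \<open>P(X + W) v\<^sub>i\<close> differs from \<open>P(X) v\<^sub>i\<close> by \<open>W X\<^sub>1\<^sup>d\<^sup>-\<^sup>1 v\<^sub>i\<close>
  modulo \<open>pN\<close> (\<open>perturbation\<close>), and as the vectors \<open>X\<^sub>1\<^sup>c v\<^sub>i\<close> with \<open>c < d\<close> are independent modulo \<open>p\<close>,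
  this difference can be prescribed (\<open>ex_matrix_with_values\<close>).  Hence all lists
  \<open>(P(X) v\<^sub>i)\<^sub>i\<close> modulo \<open>pN\<close> are equally frequent, and the answer is given by the number of generating lists of
  length \<open>r\<close> of \<open>M/pN\<close>, a space of dimension \<open>r - u\<close> (\<open>card_M\<close>, \<open>card_good_lifts\<close>).

  The product of the two counts is \<open>card_cok_lifts\<close>; dividing by the number of matrices and
  rearranging yields the stated probability.
\<close>

text \<open>From here on \<open>coeff\<close> and \<open>monom\<close> refer to the type of polynomials.\<close>

hide_const (open) up_ring.coeff up_ring.monom

section \<open>Counting generating lists modulo a submodule\<close>

lemma double_counting:
  fixes W :: "'w set" and B :: "'b set"
  assumes "finite W" "finite B"
    and 1: "\<And>b. b \<in> B \<Longrightarrow> card {w \<in> W. Q w b} = a"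
    and 2: "\<And>w. w \<in> W \<Longrightarrow> card {b \<in> B. Q w b} = c"
  shows "card B * a = card W * c"
proof -
  have "card B * a = (\<Sum>b\<in>B. card {w \<in> W. Q w b})" using 1 by simp
  also have "\<dots> = (\<Sum>w\<in>W. card {b \<in> B. Q w b})"
    using sum.swap_restrict[OF assms(2,1), of "\<lambda>_ _. 1::nat" "\<lambda>b w. Q w b"] by simp
  also have "\<dots> = card W * c" using 2 by simp
  finally show ?thesis .
qed

lemma card_image_fibres:
  assumes "finite A" and "\<And>y. y \<in> f ` A \<Longrightarrow> card {x \<in> A. f x = y} = c"
  shows "card A = card (f ` A) * c"
proof -
  have "card A = (\<Sum>y\<in>f ` A. card {x \<in> A. f x = y})"
    using card_eq_sum sum.image_gen[OF assms(1), of "\<lambda>_. 1::nat" f] by (metis (no_types, lifting) card_eq_sum sum.cong)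
  thus ?thesis using assms(2) by simp
qed

definition adjoin :: "('c::comm_ring_1, 'm) module \<Rightarrow> 'm set \<Rightarrow> 'm \<Rightarrow> 'm set" where
  "adjoin M L y = (\<lambda>(l, a). l \<oplus>\<^bsub>M\<^esub> a \<odot>\<^bsub>M\<^esub> y) ` (L \<times> UNIV)"

text \<open>
  The submodule generated by \<open>L\<close> and a list.  It is built by adjoining one element after the
  other, so that its size can be followed along the list.
\<close>

primrec gen :: "('c::comm_ring_1, 'm) module \<Rightarrow> 'm set \<Rightarrow> 'm list \<Rightarrow> 'm set" where
  "gen M L [] = L"
| "gen M L (y # ys) = gen M (adjoin M L y) ys"

text \<open>
  Each element lies outside the submodule generated by \<open>L\<close> and its predecessors.  If a maximal
  ideal maps the list into \<open>L\<close>, this is linear independence over the residue field modulo \<open>L\<close>.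
\<close>

primrec indep :: "('c::comm_ring_1, 'm) module \<Rightarrow> 'm set \<Rightarrow> 'm list \<Rightarrow> bool" where
  "indep M L [] = True"
| "indep M L (y # ys) = (y \<in> carrier M \<and> y \<notin> L \<and> indep M (adjoin M L y) ys)"

lemma gen_append: "gen M L (ys @ zs) = gen M (gen M L ys) zs"
  by (induction ys arbitrary: L) auto

lemma indep_append: "indep M L (ys @ zs) \<longleftrightarrow> indep M L ys \<and> indep M (gen M L ys) zs"
  by (induction ys arbitrary: L) auto

lemma indep_carrier: "indep M L ys \<Longrightarrow> set ys \<subseteq> carrier M"
  by (induction ys arbitrary: L) auto

abbreviation cring_module :: "('c::comm_ring_1, 'm) module \<Rightarrow> bool" where
  "cring_module M \<equiv> Module.module (class_ring :: 'c ring) M"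

abbreviation submod :: "'m set \<Rightarrow> ('c::comm_ring_1, 'm) module \<Rightarrow> bool" where
  "submod L M \<equiv> LinearCombinations.submodule (class_ring :: 'c ring) L M"

lemma submodD:
  assumes "submod L M"
  shows "cring_module M" "L \<subseteq> carrier M" "\<zero>\<^bsub>M\<^esub> \<in> L"
    "x \<in> L \<Longrightarrow> x \<in> carrier M"
    "x \<in> L \<Longrightarrow> y \<in> L \<Longrightarrow> x \<oplus>\<^bsub>M\<^esub> y \<in> L" "x \<in> L \<Longrightarrow> a \<odot>\<^bsub>M\<^esub> x \<in> L"
    "x \<in> L \<Longrightarrow> \<ominus>\<^bsub>M\<^esub> x \<in> L" "x \<in> L \<Longrightarrow> y \<in> L \<Longrightarrow> x \<ominus>\<^bsub>M\<^esub> y \<in> L"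
proof -
  interpret M: Module.module "class_ring :: 'a ring" M
    using assms by (simp add: LinearCombinations.submodule_def)
  show "cring_module M" by unfold_locales
  have sub: "L \<subseteq> carrier M" and zero: "\<zero>\<^bsub>M\<^esub> \<in> L"
    and add: "\<And>x y. x \<in> L \<Longrightarrow> y \<in> L \<Longrightarrow> x \<oplus>\<^bsub>M\<^esub> y \<in> L"
    and sm: "\<And>x a. x \<in> L \<Longrightarrow> a \<odot>\<^bsub>M\<^esub> x \<in> L"
    using assms by (auto simp: LinearCombinations.submodule_def)
  show "L \<subseteq> carrier M" "\<zero>\<^bsub>M\<^esub> \<in> L" "x \<in> L \<Longrightarrow> x \<in> carrier M" using sub zero by auto
  show "x \<in> L \<Longrightarrow> y \<in> L \<Longrightarrow> x \<oplus>\<^bsub>M\<^esub> y \<in> L" "x \<in> L \<Longrightarrow> a \<odot>\<^bsub>M\<^esub> x \<in> L"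
    by (fact add, fact sm)
  have neg: "\<ominus>\<^bsub>M\<^esub> x \<in> L" if "x \<in> L" for x
    using sm[OF that, of "-1"] that sub M.smult_l_minus[of 1 x] M.smult_one[of x]
    by (auto simp: class_ring_simps)
  show "x \<in> L \<Longrightarrow> \<ominus>\<^bsub>M\<^esub> x \<in> L" by (fact neg)
  show "x \<in> L \<Longrightarrow> y \<in> L \<Longrightarrow> x \<ominus>\<^bsub>M\<^esub> y \<in> L" by (simp add: a_minus_def add neg)
qed

lemma submodI:
  assumes "cring_module M" "L \<subseteq> carrier M" "\<zero>\<^bsub>M\<^esub> \<in> L"
    "\<And>x y. x \<in> L \<Longrightarrow> y \<in> L \<Longrightarrow> x \<oplus>\<^bsub>M\<^esub> y \<in> L" "\<And>x a. x \<in> L \<Longrightarrow> a \<odot>\<^bsub>M\<^esub> x \<in> L"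
  shows "submod L M"
  using assms by (auto simp: LinearCombinations.submodule_def)

lemma cring_moduleD:
  assumes "cring_module (M :: ('c::comm_ring_1, 'm) module)"
  shows "abelian_group M"
    "x \<in> carrier M \<Longrightarrow> a \<odot>\<^bsub>M\<^esub> x \<in> carrier M"
    "x \<in> carrier M \<Longrightarrow> (a + b) \<odot>\<^bsub>M\<^esub> x = a \<odot>\<^bsub>M\<^esub> x \<oplus>\<^bsub>M\<^esub> b \<odot>\<^bsub>M\<^esub> x"
    "x \<in> carrier M \<Longrightarrow> y \<in> carrier M \<Longrightarrow> a \<odot>\<^bsub>M\<^esub> (x \<oplus>\<^bsub>M\<^esub> y) = a \<odot>\<^bsub>M\<^esub> x \<oplus>\<^bsub>M\<^esub> a \<odot>\<^bsub>M\<^esub> y"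
    "x \<in> carrier M \<Longrightarrow> (a * b) \<odot>\<^bsub>M\<^esub> x = a \<odot>\<^bsub>M\<^esub> (b \<odot>\<^bsub>M\<^esub> x)"
    "x \<in> carrier M \<Longrightarrow> 1 \<odot>\<^bsub>M\<^esub> x = x"
    "x \<in> carrier M \<Longrightarrow> 0 \<odot>\<^bsub>M\<^esub> x = \<zero>\<^bsub>M\<^esub>"
    "a \<odot>\<^bsub>M\<^esub> \<zero>\<^bsub>M\<^esub> = \<zero>\<^bsub>M\<^esub>"
    "x \<in> carrier M \<Longrightarrow> (- a) \<odot>\<^bsub>M\<^esub> x = \<ominus>\<^bsub>M\<^esub> (a \<odot>\<^bsub>M\<^esub> x)"
    "x \<in> carrier M \<Longrightarrow> (a - b) \<odot>\<^bsub>M\<^esub> x = a \<odot>\<^bsub>M\<^esub> x \<ominus>\<^bsub>M\<^esub> b \<odot>\<^bsub>M\<^esub> x"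
    "x \<in> carrier M \<Longrightarrow> y \<in> carrier M \<Longrightarrow> a \<odot>\<^bsub>M\<^esub> (x \<ominus>\<^bsub>M\<^esub> y) = a \<odot>\<^bsub>M\<^esub> x \<ominus>\<^bsub>M\<^esub> a \<odot>\<^bsub>M\<^esub> y"
proof -
  interpret M: Module.module "class_ring :: 'c ring" M by fact
  show "abelian_group M" by unfold_locales
  show "x \<in> carrier M \<Longrightarrow> a \<odot>\<^bsub>M\<^esub> x \<in> carrier M" by simp
  show "x \<in> carrier M \<Longrightarrow> (a + b) \<odot>\<^bsub>M\<^esub> x = a \<odot>\<^bsub>M\<^esub> x \<oplus>\<^bsub>M\<^esub> b \<odot>\<^bsub>M\<^esub> x"
    using M.smult_l_distr[of a b x] by simp
  show "x \<in> carrier M \<Longrightarrow> y \<in> carrier M \<Longrightarrow> a \<odot>\<^bsub>M\<^esub> (x \<oplus>\<^bsub>M\<^esub> y) = a \<odot>\<^bsub>M\<^esub> x \<oplus>\<^bsub>M\<^esub> a \<odot>\<^bsub>M\<^esub> y"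
    by (simp add: M.smult_r_distr)
  show "x \<in> carrier M \<Longrightarrow> (a * b) \<odot>\<^bsub>M\<^esub> x = a \<odot>\<^bsub>M\<^esub> (b \<odot>\<^bsub>M\<^esub> x)"
    using M.smult_assoc1[of a b x] by simp
  show "x \<in> carrier M \<Longrightarrow> 1 \<odot>\<^bsub>M\<^esub> x = x" using M.smult_one[of x] by simp
  show "x \<in> carrier M \<Longrightarrow> 0 \<odot>\<^bsub>M\<^esub> x = \<zero>\<^bsub>M\<^esub>" using M.smult_l_null[of x] by simp
  show "a \<odot>\<^bsub>M\<^esub> \<zero>\<^bsub>M\<^esub> = \<zero>\<^bsub>M\<^esub>" using M.smult_r_null[of a] by simp
  show neg: "(- a) \<odot>\<^bsub>M\<^esub> x = \<ominus>\<^bsub>M\<^esub> (a \<odot>\<^bsub>M\<^esub> x)" if "x \<in> carrier M" for a x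
    using M.smult_l_minus[of a x] that by (simp add: class_ring_simps)
  show "(a - b) \<odot>\<^bsub>M\<^esub> x = a \<odot>\<^bsub>M\<^esub> x \<ominus>\<^bsub>M\<^esub> b \<odot>\<^bsub>M\<^esub> x" if "x \<in> carrier M"
    using M.smult_l_distr[of a "-b" x] that by (simp add: neg a_minus_def)
  show "x \<in> carrier M \<Longrightarrow> y \<in> carrier M \<Longrightarrow> a \<odot>\<^bsub>M\<^esub> (x \<ominus>\<^bsub>M\<^esub> y) = a \<odot>\<^bsub>M\<^esub> x \<ominus>\<^bsub>M\<^esub> a \<odot>\<^bsub>M\<^esub> y"
    using M.smult_r_minus[of a y] by (simp add: a_minus_def M.smult_r_distr)
qed

context
  fixes M :: "('c::comm_ring_1, 'm) module"
  assumes M: "cring_module M"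
begin

interpretation M: abelian_group M using cring_moduleD(1)[OF M] .
private lemmas mD = cring_moduleD[OF M]

lemma adjoin_superset: "submod L M \<Longrightarrow> y \<in> carrier M \<Longrightarrow> L \<subseteq> adjoin M L y"
proof
  fix x assume "submod L M" "y \<in> carrier M" "x \<in> L"
  moreover from this have "x \<in> carrier M" by (blast dest: submodD(4))
  ultimately have "x = x \<oplus>\<^bsub>M\<^esub> 0 \<odot>\<^bsub>M\<^esub> y" by (simp add: mD)
  thus "x \<in> adjoin M L y" using \<open>x \<in> L\<close> unfolding adjoin_def by (auto intro: image_eqI[of _ _ "(x, 0)"])
qed

lemma mem_adjoin: "submod L M \<Longrightarrow> y \<in> carrier M \<Longrightarrow> y \<in> adjoin M L y"
  unfolding adjoin_def by (rule image_eqI[of _ _ "(\<zero>\<^bsub>M\<^esub>, 1)"]) (simp_all add: mD submodD(3))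

lemma adjoin_subset:
  "submod K M \<Longrightarrow> L \<subseteq> K \<Longrightarrow> y \<in> K \<Longrightarrow> adjoin M L y \<subseteq> K"
  unfolding adjoin_def using submodD(5,6)[of K M] by auto

lemma submod_adjoin:
  assumes L: "submod L M" and y: "y \<in> carrier M"
  shows "submod (adjoin M L y) M"
proof (rule submodI[OF M])
  note LD = submodD[OF L]
  show "adjoin M L y \<subseteq> carrier M" using LD y by (auto simp: adjoin_def mD)
  show "\<zero>\<^bsub>M\<^esub> \<in> adjoin M L y" using adjoin_superset[OF L y] LD(3) by blast
  fix u v assume "u \<in> adjoin M L y"
  then obtain l a where u: "u = l \<oplus>\<^bsub>M\<^esub> a \<odot>\<^bsub>M\<^esub> y" "l \<in> L" by (auto simp: adjoin_def)
  { assume "v \<in> adjoin M L y"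
    then obtain l' a' where v: "v = l' \<oplus>\<^bsub>M\<^esub> a' \<odot>\<^bsub>M\<^esub> y" "l' \<in> L" by (auto simp: adjoin_def)
    have "u \<oplus>\<^bsub>M\<^esub> v = (l \<oplus>\<^bsub>M\<^esub> l') \<oplus>\<^bsub>M\<^esub> (a + a') \<odot>\<^bsub>M\<^esub> y"
      using u v y LD(4) by (simp add: mD M.a_ac)
    thus "u \<oplus>\<^bsub>M\<^esub> v \<in> adjoin M L y" using LD(5) u v by (auto simp: adjoin_def) }
  fix c
  have "c \<odot>\<^bsub>M\<^esub> u = c \<odot>\<^bsub>M\<^esub> l \<oplus>\<^bsub>M\<^esub> (c * a) \<odot>\<^bsub>M\<^esub> y"
    using u y LD(4) by (simp add: mD)
  thus "c \<odot>\<^bsub>M\<^esub> u \<in> adjoin M L y" using LD(6) u by (auto simp: adjoin_def)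
qed

lemma submod_gen: "submod L M \<Longrightarrow> set ys \<subseteq> carrier M \<Longrightarrow> submod (gen M L ys) M"
  by (induction ys arbitrary: L) (auto intro: submod_adjoin)

lemma gen_superset: "submod L M \<Longrightarrow> set ys \<subseteq> carrier M \<Longrightarrow> L \<subseteq> gen M L ys"
proof (induction ys arbitrary: L)
  case (Cons y ys)
  then show ?case using adjoin_superset[of L y] submod_adjoin[of L y] by fastforce
qed auto

lemma set_subset_gen: "submod L M \<Longrightarrow> set ys \<subseteq> carrier M \<Longrightarrow> set ys \<subseteq> gen M L ys"
proof (induction ys arbitrary: L)
  case (Cons y ys)
  then show ?case
    using mem_adjoin[of L y] submod_adjoin[of L y] gen_superset[of "adjoin M L y" ys] by fastforce
qed auto

lemma gen_subset: "submod K M \<Longrightarrow> L \<subseteq> K \<Longrightarrow> set ys \<subseteq> K \<Longrightarrow> gen M L ys \<subseteq> K"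
proof (induction ys arbitrary: L)
  case (Cons y ys)
  then show ?case using adjoin_subset[of K L y] by simp
qed auto

lemma adjoin_absorb:
  assumes "submod L M" "y \<in> L" shows "adjoin M L y = L"
  using adjoin_superset[OF assms(1)] adjoin_subset[OF assms(1) _ assms(2)] submodD[OF assms(1)] assms(2) by blast

end

lemma minus_eq_minus_if_add_eq_add:
  assumes "abelian_group M"
    and "l \<oplus>\<^bsub>M\<^esub> a = l' \<oplus>\<^bsub>M\<^esub> a'" "l \<in> carrier M" "l' \<in> carrier M" "a \<in> carrier M" "a' \<in> carrier M"
  shows "a \<ominus>\<^bsub>M\<^esub> a' = l' \<ominus>\<^bsub>M\<^esub> l"
proof -
  interpret abelian_group M by fact
  have "a = \<ominus>\<^bsub>M\<^esub> l \<oplus>\<^bsub>M\<^esub> (l' \<oplus>\<^bsub>M\<^esub> a')"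
    using r_neg1[of l a] assms by simp
  hence "a \<ominus>\<^bsub>M\<^esub> a' = (\<ominus>\<^bsub>M\<^esub> l \<oplus>\<^bsub>M\<^esub> l') \<oplus>\<^bsub>M\<^esub> (a' \<oplus>\<^bsub>M\<^esub> \<ominus>\<^bsub>M\<^esub> a')"
    using assms(3-) by (simp add: a_minus_def a_assoc)
  thus ?thesis using assms(3-) by (simp add: r_neg a_minus_def a_comm)
qed

text \<open>
  A maximal ideal \<open>J\<close> of a commutative ring with finite residue field, and a set \<open>T\<close> of
  representatives of its residue classes.  Working with representatives makes the ring itself
  act on everything.  The locale is used for \<open>(p, P)\<close> in \<open>A[t]\<close> and for \<open>(p)\<close> in \<open>A\<close>.
\<close>

locale residue_system =
  fixes J T :: "'c::comm_ring_1 set"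
  assumes J_zero: "0 \<in> J" and J_proper: "1 \<notin> J"
    and J_add: "a \<in> J \<Longrightarrow> b \<in> J \<Longrightarrow> a + b \<in> J"
    and J_mult: "b \<in> J \<Longrightarrow> a * b \<in> J"
    and J_inverse: "a \<notin> J \<Longrightarrow> \<exists>b. b * a - 1 \<in> J"
    and T_finite: "finite T"
    and T_exhaust: "\<exists>t\<in>T. a - t \<in> J"
    and T_unique: "t \<in> T \<Longrightarrow> t' \<in> T \<Longrightarrow> t - t' \<in> J \<Longrightarrow> t = t'"
begin

abbreviation q :: nat where "q \<equiv> card T"

lemma q_gt_1: "q > 1"
proof -
  obtain t0 t1 where t: "t0 \<in> T" "0 - t0 \<in> J" "t1 \<in> T" "1 - t1 \<in> J" using T_exhaust by blast
  have "t0 \<noteq> t1"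
  proof
    assume "t0 = t1"
    hence "(1 - t1) + (- 1) * (0 - t0) = 1" by simp
    thus False using J_add[OF t(4) J_mult[OF t(2), of "- 1"]] J_proper by simp
  qed
  hence "card {t0, t1} = 2" by simp
  moreover have "card {t0, t1} \<le> card T" using t by (intro card_mono T_finite) auto
  ultimately show ?thesis by linarith
qed

text \<open>
  A scalar outside \<open>J\<close> is invertible modulo \<open>J\<close>, and \<open>J\<close> acts as zero on \<open>y\<close> modulo \<open>L\<close>.
\<close>

lemma smult_mem_imp_mem:
  assumes L: "submod L M" and y: "y \<in> carrier M" and J: "\<And>j. j \<in> J \<Longrightarrow> j \<odot>\<^bsub>M\<^esub> y \<in> L"
    and a: "a \<notin> J" "a \<odot>\<^bsub>M\<^esub> y \<in> L"
  shows "y \<in> L"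
proof -
  note mD = cring_moduleD[OF submodD(1)[OF L]]
  interpret M: abelian_group M by (rule mD)
  obtain b where b: "b * a - 1 \<in> J" using J_inverse a by blast
  have "(b * a) \<odot>\<^bsub>M\<^esub> y \<ominus>\<^bsub>M\<^esub> (b * a - 1) \<odot>\<^bsub>M\<^esub> y \<in> L"
    using J[OF b] submodD(6)[OF L a(2), of b] mD(5)[OF y, of b a] by (intro submodD(8)[OF L]) simp_all
  also have "(b * a) \<odot>\<^bsub>M\<^esub> y \<ominus>\<^bsub>M\<^esub> (b * a - 1) \<odot>\<^bsub>M\<^esub> y = (b * a - (b * a - 1)) \<odot>\<^bsub>M\<^esub> y"
    by (rule mD(10)[OF y, symmetric])
  also have "\<dots> = y" using mD(6)[OF y] by simp
  finally show ?thesis .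
qed

text \<open>
  The sums \<open>l + t y\<close> with \<open>t \<in> T\<close> exhaust the new module, because \<open>J y \<subseteq> L\<close>, and they are
  pairwise different, because otherwise \<open>y \<in> L\<close> by \<open>smult_mem_imp_mem\<close>.
\<close>

lemma card_adjoin:
  assumes L: "submod L M" and fin: "finite (carrier M)" and y: "y \<in> carrier M" "y \<notin> L"
    and J: "\<And>j. j \<in> J \<Longrightarrow> j \<odot>\<^bsub>M\<^esub> y \<in> L"
  shows "card (adjoin M L y) = q * card L"
proof -
  note mD = cring_moduleD[OF submodD(1)[OF L]] and LD = submodD[OF L]
  interpret M: abelian_group M by (rule mD)
  let ?f = "\<lambda>(l, a). l \<oplus>\<^bsub>M\<^esub> a \<odot>\<^bsub>M\<^esub> y"
  have inj: "inj_on ?f (L \<times> T)"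
  proof (rule inj_onI, clarify)
    fix l a l' a' assume l: "l \<in> L" "l' \<in> L" "a \<in> T" "a' \<in> T"
      and eq: "l \<oplus>\<^bsub>M\<^esub> a \<odot>\<^bsub>M\<^esub> y = l' \<oplus>\<^bsub>M\<^esub> a' \<odot>\<^bsub>M\<^esub> y"
    note c = LD(4)[OF l(1)] LD(4)[OF l(2)] mD(2)[OF y(1), of a] mD(2)[OF y(1), of a']
    have "(a - a') \<odot>\<^bsub>M\<^esub> y = l' \<ominus>\<^bsub>M\<^esub> l"
      unfolding mD(10)[OF y(1)] using eq c by (intro minus_eq_minus_if_add_eq_add[OF mD(1)])
    hence "(a - a') \<odot>\<^bsub>M\<^esub> y \<in> L" using LD(8) l by simp
    hence "a - a' \<in> J" using smult_mem_imp_mem[OF L y(1) J] y(2) by blast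
    hence aa: "a = a'" using T_unique l by blast
    with eq c show "l = l' \<and> a = a'" by (simp add: M.add.right_cancel)
  qed
  have "adjoin M L y = ?f ` (L \<times> T)"
  proof
    show "adjoin M L y \<subseteq> ?f ` (L \<times> T)"
    proof
      fix u assume "u \<in> adjoin M L y"
      then obtain l a where u: "u = l \<oplus>\<^bsub>M\<^esub> a \<odot>\<^bsub>M\<^esub> y" "l \<in> L" by (auto simp: adjoin_def)
      obtain t where t: "t \<in> T" "a - t \<in> J" using T_exhaust by blast
      have "a \<odot>\<^bsub>M\<^esub> y = (a - t) \<odot>\<^bsub>M\<^esub> y \<oplus>\<^bsub>M\<^esub> t \<odot>\<^bsub>M\<^esub> y"
        using mD(3)[OF y(1), of "a - t" t] by simp
      hence "u = (l \<oplus>\<^bsub>M\<^esub> (a - t) \<odot>\<^bsub>M\<^esub> y) \<oplus>\<^bsub>M\<^esub> t \<odot>\<^bsub>M\<^esub> y"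
        using u y LD(4) mD(2) by (simp add: M.a_assoc)
      thus "u \<in> ?f ` (L \<times> T)" using LD(5)[OF u(2) J[OF t(2)]] t(1) by auto
    qed
  qed (auto simp: adjoin_def)
  thus ?thesis using card_image[OF inj] by (simp add: card_cartesian_product mult.commute)
qed

lemma card_gen:
  assumes "indep M L ys" "submod L M" "finite (carrier M)"
    and "\<And>y j. y \<in> set ys \<Longrightarrow> j \<in> J \<Longrightarrow> j \<odot>\<^bsub>M\<^esub> y \<in> L"
  shows "card (gen M L ys) = q ^ length ys * card L"
  using assms
proof (induction ys arbitrary: L)
  case (Cons y ys)
  have M: "cring_module M" and y: "y \<in> carrier M" "y \<notin> L" using Cons.prems by (auto dest: submodD)
  note sup = adjoin_superset[OF M Cons.prems(2) y(1)]
  have "card (gen M (adjoin M L y) ys) = q ^ length ys * card (adjoin M L y)"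
    using Cons.prems sup by (intro Cons.IH submod_adjoin[OF M]) auto
  moreover have "card (adjoin M L y) = q * card L"
    using Cons.prems y by (intro card_adjoin) auto
  ultimately show ?case by simp
qed auto

lemma ex_indep_gen:
  assumes L: "submod L M" and K: "submod K M" and LK: "L \<subseteq> K" and fin: "finite (carrier M)"
  shows "\<exists>ys. set ys \<subseteq> K \<and> indep M L ys \<and> gen M L ys = K"
  using L LK
proof (induction "card (K - L)" arbitrary: L rule: less_induct)
  case (less L)
  have M: "cring_module M" by (rule submodD(1)[OF K])
  have finK: "finite K" using submodD(2)[OF K] fin finite_subset by blast
  show ?case
  proof (cases "L = K")
    case True
    thus ?thesis by (intro exI[of _ "[]"]) auto
  next
    case False
    then obtain y where y: "y \<in> K" "y \<notin> L" using less.prems by blast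
    have yM: "y \<in> carrier M" using y submodD(4)[OF K] by blast
    have sub: "adjoin M L y \<subseteq> K" using adjoin_subset[OF M K less.prems(2) y(1)] .
    have sup: "L \<subseteq> adjoin M L y" using adjoin_superset[OF M less.prems(1) yM] .
    have "card (K - adjoin M L y) < card (K - L)"
      using finK y sup mem_adjoin[OF M less.prems(1) yM] by (intro psubset_card_mono) auto
    from less.hyps[OF this submod_adjoin[OF M less.prems(1) yM] sub] obtain ys where
      "set ys \<subseteq> K" "indep M (adjoin M L y) ys" "gen M (adjoin M L y) ys = K" by blast
    thus ?thesis using y yM by (intro exI[of _ "y # ys"]) auto
  qed
qed

text \<open>
  Modulo \<open>L\<close> these are the spanning lists of length \<open>m\<close> of an \<open>s\<close>-dimensional space.  A head in
  \<open>L\<close> leaves the problem for \<open>m - 1\<close> and \<open>s\<close>, any other head the problem for \<open>m - 1\<close> and \<open>s - 1\<close>;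
  so \<open>b(m, s) = \<Prod>\<^sub>i\<^sub><\<^sub>s (q\<^sup>m - q\<^sup>i)\<close> has to satisfy \<open>b(m + 1, s) = b(m, s) + (q\<^sup>s - 1) q\<^sup>m b(m, s - 1)\<close>.
\<close>

lemma card_generating_lists:
  assumes L: "submod L M" and K: "submod K M" and LK: "L \<subseteq> K" and fin: "finite (carrier M)"
    and J: "\<And>y j. y \<in> K \<Longrightarrow> j \<in> J \<Longrightarrow> j \<odot>\<^bsub>M\<^esub> y \<in> L"
    and card: "card K = q ^ s * card L"
  shows "real (card {ws. length ws = m \<and> set ws \<subseteq> K \<and> gen M L ws = K})
       = real (card L) ^ m * (\<Prod>i<s. real q ^ m - real q ^ i)"
  using L LK J card
proof (induction m arbitrary: L s)
  case 0
  have finK: "finite K" using submodD(2)[OF K] fin finite_subset by blast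
  have "finite L" using 0 finK finite_subset by blast
  hence cL: "card L > 0" using submodD(3)[OF 0(1)] by (auto simp: card_gt_0_iff)
  have set: "{ws. length ws = 0 \<and> set ws \<subseteq> K \<and> gen M L ws = K} = (if L = K then {[]} else {})"
    by auto
  show ?case
  proof (cases "L = K")
    case True
    hence "q ^ s = 1" using 0(4) cL by simp
    hence "s = 0" using q_gt_1 by (metis less_irrefl_nat nat_power_eq_Suc_0_iff One_nat_def)
    thus ?thesis unfolding set using True by simp
  next
    case False
    hence "s \<noteq> 0" using 0(4) card_subset_eq[OF finK 0(2)] by (intro notI) simp
    hence "(\<Prod>i<s. (real q)^0 - real q ^ i) = 0" by (intro prod_zero bexI[of _ 0]) auto
    thus ?thesis unfolding set using False by simp
  qed
next
  case (Suc m)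
  have M: "cring_module M" by (rule submodD(1)[OF K])
  have finK: "finite K" using submodD(2)[OF K] fin finite_subset by blast
  note IH = Suc.IH
  note prems = Suc.prems
  let ?S = "\<lambda>L m. {ws. length ws = m \<and> set ws \<subseteq> K \<and> gen M L ws = K}"
  let ?b = "\<lambda>m s. \<Prod>i<s. real q ^ m - real q ^ i"
  have finS: "finite (?S L m)" for L m
    by (rule finite_subset[OF _ finite_lists_length_eq[OF finK, of m]]) auto
  have split: "?S L (Suc m) = (\<Union>w\<in>K. (#) w ` ?S (adjoin M L w) m)"
    by (auto simp: length_Suc_conv)
  have "card (?S L (Suc m)) = (\<Sum>w\<in>K. card (?S (adjoin M L w) m))"
    unfolding split by (subst card_UN_disjoint) (auto simp: finK finS card_image)
  also have "\<dots> = (\<Sum>w\<in>L. card (?S (adjoin M L w) m)) + (\<Sum>w\<in>K - L. card (?S (adjoin M L w) m))"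
    by (subst sum.subset_diff[OF prems(2) finK]) (rule add.commute)
  finally have "real (card (?S L (Suc m))) = (\<Sum>w\<in>L. real (card (?S (adjoin M L w) m)))
      + (\<Sum>w\<in>K - L. real (card (?S (adjoin M L w) m)))" by simp
  also have "(\<Sum>w\<in>L. real (card (?S (adjoin M L w) m))) = (\<Sum>w\<in>L. real (card L) ^ m * ?b m s)"
    using adjoin_absorb[OF M prems(1)] IH[OF prems] by (intro sum.cong) auto
  finally have eq: "real (card (?S L (Suc m))) = real (card L) ^ Suc m * ?b m s
      + (\<Sum>w\<in>K - L. real (card (?S (adjoin M L w) m)))" by simp
  show ?case
  proof (cases s)
    case 0
    hence "L = K" using prems(4) card_subset_eq[OF finK prems(2)] by simp
    thus ?thesis using eq 0 by simp
  next
    case (Suc s')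
    have "real (card (?S (adjoin M L w) m)) = (real q * card L) ^ m * ?b m s'" if w: "w \<in> K - L" for w
    proof -
      have wM: "w \<in> carrier M" using w submodD(4)[OF K] by blast
      have c: "card (adjoin M L w) = q * card L"
        using w prems fin by (intro card_adjoin[OF prems(1)] wM) auto
      have "real (card (?S (adjoin M L w) m)) = real (card (adjoin M L w)) ^ m * ?b m s'"
        using adjoin_superset[OF M prems(1) wM] prems(3,4) c w Suc
        by (intro IH submod_adjoin[OF M prems(1) wM] adjoin_subset[OF M K prems(2)]) auto
      thus ?thesis unfolding c by simp
    qed
    hence "(\<Sum>w\<in>K - L. real (card (?S (adjoin M L w) m))) = real (card (K - L)) * ((real q * card L) ^ m * ?b m s')"
      by simp
    moreover have "real (card (K - L)) = (real q ^ s - 1) * card L"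
      using card_Diff_subset[of L K] finK prems(2,4) finite_subset[OF prems(2) finK] card_mono[OF finK prems(2)]
      by (simp add: of_nat_diff algebra_simps)
    ultimately have eq2: "real (card (?S L (Suc m))) = real (card L) ^ Suc m *
        (?b m s + (real q ^ s - 1) * real q ^ m * ?b m s')"
      using eq by (simp add: algebra_simps power_mult_distrib)
    have r: "?b (Suc m) s = (real q ^ Suc m - 1) * real q ^ s' * ?b m s'"
    proof -
      have "?b (Suc m) s = (real q ^ Suc m - 1) * (\<Prod>i<s'. real q * (real q ^ m - real q ^ i))"
        unfolding Suc prod.lessThan_Suc_shift by (simp add: algebra_simps)
      also have "(\<Prod>i<s'. real q * (real q ^ m - real q ^ i)) = real q ^ s' * ?b m s'"
        by (simp add: prod.distrib)
      finally show ?thesis by simp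
    qed
    have l: "?b m s = ?b m s' * (real q ^ m - real q ^ s')" unfolding Suc by simp
    show ?thesis unfolding eq2 r unfolding l Suc by (simp add: algebra_simps)
  qed
qed

text \<open>
  \<open>\<Gamma>\<close> is the graph of a map that is defined modulo \<open>H\<close>, and it stays one when \<open>(y, g)\<close> is adjoined:
  if \<open>a y\<close> is in the old domain, then \<open>a \<in> J\<close>, so \<open>a y\<close> already had the value \<open>0\<close> and \<open>a g \<in> H\<close>.
\<close>

lemma graph_of_extension:
  assumes N: "cring_module N" and M: "cring_module M"
    and G: "submod \<Gamma> (direct_sum M N)" and L: "submod L0 M" and H: "submod H N"
    and sub: "L0 \<times> H \<subseteq> \<Gamma>"
    and ker: "\<And>z. (\<zero>\<^bsub>M\<^esub>, z) \<in> \<Gamma> \<Longrightarrow> z \<in> H"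
    and ind: "indep M (fst ` \<Gamma>) ys"
    and len: "length gs = length ys"
    and Jy: "\<And>y j. y \<in> set ys \<Longrightarrow> j \<in> J \<Longrightarrow> j \<odot>\<^bsub>M\<^esub> y \<in> L0"
    and Jg: "\<And>g j. g \<in> set gs \<Longrightarrow> j \<in> J \<Longrightarrow> j \<odot>\<^bsub>N\<^esub> g \<in> H" and gN: "set gs \<subseteq> carrier N"
  shows "fst ` gen (direct_sum M N) \<Gamma> (zip ys gs) = gen M (fst ` \<Gamma>) ys
    \<and> (\<forall>z. (\<zero>\<^bsub>M\<^esub>, z) \<in> gen (direct_sum M N) \<Gamma> (zip ys gs) \<longrightarrow> z \<in> H)"
  using len G sub ker ind Jy Jg gN
proof (induction gs ys arbitrary: \<Gamma> rule: list_induct2)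
  case (Cons g gs y ys)
  note mD = cring_moduleD[OF M] and nD = cring_moduleD[OF N]
  note HD = submodD[OF H] and LD = submodD[OF L]
  interpret M: abelian_group M by (rule mD)
  interpret N: abelian_group N by (rule nD)
  let ?D = "direct_sum M N"
  note GD = submodD[OF Cons.prems(1)]
  have D: "cring_module ?D" by (rule direct_sum_is_module[OF M N])
  have Gc: "x \<in> carrier M" "z \<in> carrier N" if "(x, z) \<in> \<Gamma>" for x z
    using that GD(2) by (auto simp: direct_sum_def)
  have y: "y \<in> carrier M" "y \<notin> fst ` \<Gamma>" and g: "g \<in> carrier N" using Cons.prems by auto
  have yg: "(y, g) \<in> carrier ?D" using y g by (auto simp: direct_sum_def)
  let ?G = "adjoin ?D \<Gamma> (y, g)"
  have mem: "(x, z) \<in> ?G \<longleftrightarrow> (\<exists>a x' z'. (x', z') \<in> \<Gamma> \<and> x = x' \<oplus>\<^bsub>M\<^esub> a \<odot>\<^bsub>M\<^esub> y \<and> z = z' \<oplus>\<^bsub>N\<^esub> a \<odot>\<^bsub>N\<^esub> g)" for x z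
    unfolding adjoin_def by (force simp: direct_sum_def image_iff)
  have fst: "fst ` ?G = adjoin M (fst ` \<Gamma>) y"
  proof (rule Set.set_eqI)
    fix x
    have "x \<in> fst ` ?G \<longleftrightarrow> (\<exists>z. (x, z) \<in> ?G)" by force
    also have "\<dots> \<longleftrightarrow> (\<exists>a x' z'. (x', z') \<in> \<Gamma> \<and> x = x' \<oplus>\<^bsub>M\<^esub> a \<odot>\<^bsub>M\<^esub> y)" unfolding mem by blast
    also have "\<dots> \<longleftrightarrow> x \<in> adjoin M (fst ` \<Gamma>) y" unfolding adjoin_def by force
    finally show "x \<in> fst ` ?G \<longleftrightarrow> x \<in> adjoin M (fst ` \<Gamma>) y" .
  qed
  have ker': "z \<in> H" if 0: "(\<zero>\<^bsub>M\<^esub>, z) \<in> ?G" for z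
  proof -
    obtain a x' z' where a: "(x', z') \<in> \<Gamma>" "\<zero>\<^bsub>M\<^esub> = x' \<oplus>\<^bsub>M\<^esub> a \<odot>\<^bsub>M\<^esub> y" "z = z' \<oplus>\<^bsub>N\<^esub> a \<odot>\<^bsub>N\<^esub> g"
      using 0 mem by blast
    have x': "x' = \<ominus>\<^bsub>M\<^esub> (a \<odot>\<^bsub>M\<^esub> y)"
      using a(2) Gc[OF a(1)] mD(2)[OF y(1), of a] by (intro M.minus_equality[symmetric]) simp_all
    have "a \<in> J"
    proof (rule ccontr)
      assume "a \<notin> J"
      have sub1: "submod (fst ` \<Gamma>) M"
      proof (rule submodI[OF M])
        show "fst ` \<Gamma> \<subseteq> carrier M" using Gc by auto
        show "\<zero>\<^bsub>M\<^esub> \<in> fst ` \<Gamma>" using GD(3) by (force simp: direct_sum_def)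
        fix u v c assume "u \<in> fst ` \<Gamma>"
        then obtain u' where u: "(u, u') \<in> \<Gamma>" by force
        show "c \<odot>\<^bsub>M\<^esub> u \<in> fst ` \<Gamma>" using GD(6)[OF u, of c] by (force simp: direct_sum_def)
        assume "v \<in> fst ` \<Gamma>"
        then obtain v' where v: "(v, v') \<in> \<Gamma>" by force
        show "u \<oplus>\<^bsub>M\<^esub> v \<in> fst ` \<Gamma>" using GD(5)[OF u v] by (force simp: direct_sum_def)
      qed
      have L0sub: "L0 \<subseteq> fst ` \<Gamma>" using Cons.prems(2) HD(3) by force
      have "x' \<in> fst ` \<Gamma>" using image_eqI[OF _ a(1), of x' fst] by simp
      from submodD(7)[OF sub1 this] have "a \<odot>\<^bsub>M\<^esub> y \<in> fst ` \<Gamma>"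
        unfolding x' using M.minus_minus[OF mD(2)[OF y(1), of a]] by simp
      from smult_mem_imp_mem[OF sub1 y(1) _ \<open>a \<notin> J\<close> this] y(2) Cons.prems(5)[of y] L0sub show False by auto
    qed
    hence "a \<odot>\<^bsub>M\<^esub> y \<in> L0" and ag: "a \<odot>\<^bsub>N\<^esub> g \<in> H" using Cons.prems(5,6) by auto
    hence "(a \<odot>\<^bsub>M\<^esub> y, \<zero>\<^bsub>N\<^esub>) \<in> \<Gamma>" using Cons.prems(2) HD(3) by auto
    from GD(5)[OF a(1) this] have "(\<zero>\<^bsub>M\<^esub>, z') \<in> \<Gamma>"
      using a(2) Gc[OF a(1)] by (simp add: direct_sum_def)
    hence "z' \<in> H" using Cons.prems(3) by blast
    thus "z \<in> H" using a(3) ag HD(5) by simp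
  qed
  have sup: "\<Gamma> \<subseteq> ?G" using adjoin_superset[OF D Cons.prems(1) yg] .
  have "fst ` gen ?D ?G (zip ys gs) = gen M (fst ` ?G) ys
    \<and> (\<forall>z. (\<zero>\<^bsub>M\<^esub>, z) \<in> gen ?D ?G (zip ys gs) \<longrightarrow> z \<in> H)"
    using Cons.prems sup ker'
    by (intro Cons.IH submod_adjoin[OF D Cons.prems(1) yg]) (auto simp: fst)
  thus ?case by (simp add: fst)
qed auto

end

section \<open>Reduction modulo \<open>p\<close> and the residue field of \<open>A[t]\<close>\<close>


lemma of_int_eq_mod_ring_iff:
  "(of_int x :: 'p::nontriv mod_ring) = of_int y \<longleftrightarrow> int CARD('p) dvd x - y"
  by (simp add: of_int_eq_iff_cong_CHAR cong_iff_dvd_diff)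

lemma of_int_to_int_mod_ring [simp]: "of_int (to_int_mod_ring a) = (a :: 'a::nontriv mod_ring)"
  by (simp add: of_int_of_int_mod_ring)

lemma card_polys_coeff_zero:
  "finite {f :: 'a::{finite,zero} poly. \<forall>i\<ge>n. coeff f i = 0}
    \<and> card {f :: 'a poly. \<forall>i\<ge>n. coeff f i = 0} = CARD('a) ^ n"
proof (induction n)
  case 0
  have "{f :: 'a poly. \<forall>i\<ge>0. coeff f i = 0} = {0}" by (auto simp: poly_eq_iff)
  thus ?case by simp
next
  case (Suc n)
  let ?D = "\<lambda>n. {f :: 'a poly. \<forall>i\<ge>n. coeff f i = 0}"
  have "?D (Suc n) = (\<lambda>(a, f). pCons a f) ` (UNIV \<times> ?D n)"
  proof
    show "?D (Suc n) \<subseteq> (\<lambda>(a, f). pCons a f) ` (UNIV \<times> ?D n)"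
    proof
      fix f assume f: "f \<in> ?D (Suc n)"
      obtain a g where "f = pCons a g" by (cases f)
      moreover have "g \<in> ?D n"
      proof (clarify)
        fix i assume "n \<le> i"
        hence "coeff f (Suc i) = 0" using f by simp
        thus "coeff g i = 0" using \<open>f = pCons a g\<close> by simp
      qed
      ultimately show "f \<in> (\<lambda>(a, f). pCons a f) ` (UNIV \<times> ?D n)" by auto
    qed
    show "(\<lambda>(a, f). pCons a f) ` (UNIV \<times> ?D n) \<subseteq> ?D (Suc n)"
      by (auto simp: coeff_pCons split: nat.split)
  qed
  moreover have "inj_on (\<lambda>(a, f). pCons a f) (UNIV \<times> ?D n)" by (auto simp: inj_on_def)
  ultimately show ?case using Suc by (simp add: card_image card_cartesian_product)
qed

lemma card_polys_degree_less:
  assumes "n > 0"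
  shows "finite {f :: 'a::{finite,zero} poly. degree f < n}"
    and "card {f :: 'a poly. degree f < n} = CARD('a) ^ n"
proof -
  have "{f :: 'a poly. degree f < n} = {f. \<forall>i\<ge>n. coeff f i = 0}"
    using assms by (auto simp: coeff_eq_0 intro!: degree_lessI)
  thus "finite {f :: 'a poly. degree f < n}" "card {f :: 'a poly. degree f < n} = CARD('a) ^ n"
    using card_polys_coeff_zero[of n, where 'a = 'a] by auto
qed

text \<open>
  The arguments \<open>A\<close> and \<open>F\<close> carry the types \<open>'a\<close> and \<open>'p\<close> of the two coefficient rings, which
  occur in no other parameter.
\<close>

locale prime_power_reduction =
  fixes p k :: nat and A :: "'a::nontriv itself" and F :: "'p::prime_card itself"
  assumes prime_p: "prime p" and k_pos: "k \<ge> 1"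
    and card_p: "CARD('p) = p" and card_a: "CARD('a) = p ^ k"
begin

abbreviation red :: "'a mod_ring \<Rightarrow> 'p mod_ring" where "red \<equiv> reduce_mod"

definition lft :: "'p mod_ring \<Rightarrow> 'a mod_ring" where "lft a = of_int (to_int_mod_ring a)"

lemma p_dvd: "p dvd p ^ k" using k_pos by (simp add: dvd_power)

lemma red_of_int: "red (of_int x) = of_int x"
proof -
  have "int CARD('a) dvd to_int_mod_ring (of_int x :: 'a mod_ring) - x"
    by (subst of_int_eq_mod_ring_iff[symmetric]) simp
  hence "int p dvd to_int_mod_ring (of_int x :: 'a mod_ring) - x"
    unfolding card_a using p_dvd by (meson dvd_trans int_dvd_int_iff)
  thus ?thesis unfolding reduce_mod_def of_int_eq_mod_ring_iff card_p .
qed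

lemma ex_of_int: "\<exists>x. (a :: 'a mod_ring) = of_int x"
  by (metis of_int_to_int_mod_ring)

sublocale red: comm_ring_hom red
proof
  fix a b :: "'a mod_ring"
  obtain x y where xy: "a = of_int x" "b = of_int y" using ex_of_int by metis
  show "red (a + b) = red a + red b" "red (a * b) = red a * red b"
    unfolding xy by (simp_all only: of_int_add[symmetric] of_int_mult[symmetric] red_of_int)
  show "red 0 = 0" "red 1 = 1" using red_of_int[of 0] red_of_int[of 1] by simp_all
qed

sublocale redp: map_poly_comm_ring_hom red ..

lemma red_of_nat: "red (of_nat x) = of_nat x" using red_of_int[of "int x"] by simp

lemma of_nat_p_field: "(of_nat p :: 'p mod_ring) = 0" by (metis card_p of_nat_card_eq_0)

lemma red_lft [simp]: "red (lft a) = a" by (simp add: lft_def red_of_int)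

lemma lft_0 [simp]: "lft 0 = 0" by (simp add: lft_def)

lemma lft_inject [simp]: "lft a = lft b \<longleftrightarrow> a = b" by (metis red_lft)

lemma red_eq_0_iff: "red a = 0 \<longleftrightarrow> (\<exists>b. a = of_nat p * b)"
proof
  assume "red a = 0"
  hence "(of_int (to_int_mod_ring a) :: 'p mod_ring) = of_int 0" by (simp add: reduce_mod_def)
  hence "int p dvd to_int_mod_ring a" unfolding of_int_eq_mod_ring_iff card_p by simp
  then obtain c where "to_int_mod_ring a = int p * c" by blast
  hence "a = of_int (int p * c)" by (metis of_int_to_int_mod_ring)
  thus "\<exists>b. a = of_nat p * b" by auto
qed (auto simp: red.hom_mult red_of_nat of_nat_p_field)

lemma map_red_lft [simp]: "map_poly red (map_poly lft f) = f"
  by (simp add: map_poly_map_poly o_def)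

lemma map_red_p_mult [simp]: "map_poly red (Polynomial.smult (of_nat p) g) = 0"
  by (simp add: poly_eq_iff coeff_map_poly red.hom_mult red_of_nat of_nat_p_field)

lemma map_red_p [simp]: "map_poly red [:of_nat p:] = 0"
  by (simp add: poly_eq_iff coeff_map_poly coeff_pCons red_of_nat of_nat_p_field split: nat.split)

lemma map_red_eq_0_iff: "map_poly red f = 0 \<longleftrightarrow> (\<exists>g. f = [:of_nat p:] * g)"
proof
  assume 0: "map_poly red f = 0"
  have "\<exists>b. coeff f i = of_nat p * b" for i
    using 0 red_eq_0_iff[of "coeff f i"] by (simp add: poly_eq_iff coeff_map_poly)
  then obtain b where b: "\<And>i. coeff f i = of_nat p * b i" by metis
  have "f = [:of_nat p:] * (\<Sum>i\<le>degree f. monom (b i) i)"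
  proof (rule poly_eqI)
    fix i
    show "coeff f i = coeff ([:of_nat p:] * (\<Sum>i\<le>degree f. monom (b i) i)) i"
      using b[of i] coeff_eq_0[of f i] by (auto simp: coeff_sum coeff_monom not_le)
  qed
  thus "\<exists>g. f = [:of_nat p:] * g" by blast
next
  assume "\<exists>g. f = [:of_nat p:] * g"
  then obtain g where "f = [:of_nat p:] * g" by blast
  thus "map_poly red f = 0" by simp
qed

lemma residue_scalars: "residue_system {a. red a = 0} (range lft)"
proof
  fix a :: "'a mod_ring"
  show "\<exists>t\<in>range lft. a - t \<in> {a. red a = 0}" by (auto simp: red.hom_minus intro!: exI[of _ "red a"])
  show "\<exists>b. b * a - 1 \<in> {a. red a = 0}" if "a \<notin> {a. red a = 0}"
    using that by (auto simp: red.hom_minus red.hom_mult red.hom_one intro!: exI[of _ "lft (inverse (red a))"])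
qed (auto simp: red.hom_minus red.hom_mult red.hom_add)

lemma card_residue_scalars: "card (range lft) = p"
proof -
  have "card (range lft) = CARD('p mod_ring)" by (intro card_image) (auto simp: inj_on_def)
  thus ?thesis by (simp add: card_p)
qed

end

locale monic_lift = prime_power_reduction p k A F
  for p k and A :: "'a::nontriv itself" and F :: "'p::prime_card itself" +
  fixes P :: "'a mod_ring poly" and Q :: "'p mod_ring poly"
  assumes monic: "lead_coeff P = 1" and Q_def: "Q = map_poly reduce_mod P" and irred: "irreducible Q"
begin

abbreviation d where "d \<equiv> degree P"

text \<open>
  The ideal \<open>(p, P)\<close> (see \<open>mem_J_iff\<close>), as the kernel of \<open>A[t] \<rightarrow> \<F>\<^sub>p[t]/(Q)\<close>.
\<close>

definition J :: "'a mod_ring poly set" where "J = {f. Q dvd map_poly red f}"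

text \<open>
  Representatives of the residue field: its classes are given by the remainders modulo \<open>Q\<close>.
\<close>

definition T :: "'a mod_ring poly set" where "T = map_poly lft ` {f. degree f < d}"

lemma degree_Q: "degree Q = d" and monic_Q: "lead_coeff Q = 1"
proof -
  have "coeff Q d = 1" using monic by (simp add: Q_def coeff_map_poly)
  moreover have "degree Q \<le> d" unfolding Q_def by (rule degree_map_poly_le)
  ultimately show "degree Q = d" "lead_coeff Q = 1"
    by (metis le_degree zero_neq_one order_antisym)+
qed

lemma d_pos: "d > 0"
proof (rule ccontr)
  assume "\<not> d > 0"
  hence "degree Q = 0" using degree_Q by simp
  moreover have "Q \<noteq> 0" using monic_Q by auto
  ultimately have "Q dvd 1" using is_unit_iff_degree by blast
  thus False using irred irreducible_not_unit by blast
qed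

lemma p_in_J: "[:of_nat p:] \<in> J"
  unfolding J_def by (simp only: map_red_p mem_Collect_eq dvd_0_right)

lemma mem_J_iff: "f \<in> J \<longleftrightarrow> (\<exists>a b. f = a * P + [:of_nat p:] * b)"
proof
  assume "f \<in> J"
  then obtain g where g: "map_poly red f = Q * g" by (auto simp: J_def elim!: dvdE)
  have "map_poly red (f - map_poly lft g * P) = 0"
    by (simp add: redp.hom_minus redp.hom_mult g Q_def)
  then obtain b where "f - map_poly lft g * P = [:of_nat p:] * b" using map_red_eq_0_iff by blast
  thus "\<exists>a b. f = a * P + [:of_nat p:] * b" by (metis add.commute diff_eq_eq)
next
  assume "\<exists>a b. f = a * P + [:of_nat p:] * b"
  thus "f \<in> J" unfolding J_def by (auto simp: redp.hom_add redp.hom_mult Q_def)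
qed

sublocale residue_system J T
proof
  show "1 \<notin> J"
  proof
    assume "1 \<in> J"
    hence "Q dvd map_poly red 1" unfolding J_def by blast
    thus False using irreducible_not_unit[OF irred] by (simp only: redp.hom_one)
  qed
  show "finite T" unfolding T_def using card_polys_degree_less(1)[OF d_pos] by blast
  fix a :: "'a mod_ring poly"
  have Q0: "Q \<noteq> 0" using irred by auto
  show "\<exists>t\<in>T. a - t \<in> J"
  proof
    show "map_poly lft (map_poly red a mod Q) \<in> T"
      using degree_mod_less'[of Q] Q0 d_pos degree_Q
      unfolding T_def by (metis degree_0 image_eqI mem_Collect_eq)
    show "a - map_poly lft (map_poly red a mod Q) \<in> J"
      by (simp add: J_def redp.hom_minus dvd_minus_mod)
  qed
  show "\<exists>b. b * a - 1 \<in> J" if "a \<notin> J"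
  proof -
    have "coprime Q (map_poly red a)"
      using that by (intro prime_elem_imp_coprime irreducible_imp_prime_elem_gcd irred) (simp add: J_def)
    then obtain u v where "u * Q + v * map_poly red a = 1" using bezout_coefficients_fst_snd[of Q "map_poly red a"] by (metis coprime_iff_gcd_eq_1)
    hence "v * map_poly red a - 1 = - u * Q" by (simp add: algebra_simps)
    hence "Q dvd map_poly red (map_poly lft v * a - 1)" by (simp add: redp.hom_minus redp.hom_mult)
    hence "map_poly lft v * a - 1 \<in> J" unfolding J_def by blast
    thus ?thesis by blast
  qed
  show "t = t'" if t: "t \<in> T" "t' \<in> T" "t - t' \<in> J" for t t'
  proof -
    obtain f f' where f: "t = map_poly lft f" "t' = map_poly lft f'" "degree f < d" "degree f' < d"
      using t(1,2) by (auto simp: T_def)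
    have "Q dvd f - f'" using t(3) unfolding f(1,2) J_def by (simp add: redp.hom_minus)
    moreover have "degree (f - f') < degree Q" using f degree_Q by (simp add: degree_diff_less)
    ultimately have "f - f' = 0" using dvd_imp_degree_le[of Q "f - f'"] by linarith
    thus ?thesis by (simp add: f(1,2))
  qed
qed (auto simp: J_def redp.hom_add redp.hom_mult)

lemma card_T: "card T = p ^ d"
proof -
  have "card T = card {f :: 'p mod_ring poly. degree f < d}" unfolding T_def
    by (intro card_image inj_onI) (metis map_red_lft)
  thus ?thesis using card_polys_degree_less(2)[OF d_pos, where 'a = "'p mod_ring"] by (simp add: card_p)
qed

end

section \<open>Polynomials in a matrix and linear maps on \<open>A\<^sup>n\<close>\<close>


lemma poly_mat_carrier [simp]: "X \<in> carrier_mat n n \<Longrightarrow> poly_mat f X \<in> carrier_mat n n"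
  by (auto simp: poly_mat_def)

lemma index_poly_mat:
  assumes "X \<in> carrier_mat n n" "i < n" "j < n" "degree f \<le> N"
  shows "poly_mat f X $$ (i, j) = (\<Sum>l\<le>N. coeff f l * (X ^\<^sub>m l) $$ (i, j))"
proof -
  have "poly_mat f X $$ (i, j) = (\<Sum>l\<le>degree f. coeff f l * (X ^\<^sub>m l) $$ (i, j))"
    using assms(1-3) unfolding poly_mat_def by auto
  also have "\<dots> = (\<Sum>l\<le>N. coeff f l * (X ^\<^sub>m l) $$ (i, j))"
    using assms(4) by (intro sum.mono_neutral_left) (auto simp: coeff_eq_0)
  finally show ?thesis .
qed

lemma zero_smult_vec [simp]: "(0 :: 'a::comm_ring_1) \<cdot>\<^sub>v v = 0\<^sub>v (dim_vec v)"
  by (intro eq_vecI) auto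

lemma smult_mat_mult_vec: "dim_col A = dim_vec v \<Longrightarrow>
    ((a :: 'a::comm_ring_1) \<cdot>\<^sub>m A) *\<^sub>v v = a \<cdot>\<^sub>v (A *\<^sub>v v)"
  by (intro eq_vecI) (auto simp: scalar_prod_def sum_distrib_left mult.assoc)

lemma mat_mult_smult_vec: "dim_col A = dim_vec v \<Longrightarrow>
    A *\<^sub>v ((a :: 'a::comm_ring_1) \<cdot>\<^sub>v v) = a \<cdot>\<^sub>v (A *\<^sub>v v)"
  by (intro eq_vecI) (auto simp: scalar_prod_def sum_distrib_left mult_ac)

context
  fixes X :: "'a::comm_ring_1 mat" and n :: nat
  assumes X: "X \<in> carrier_mat n n"
begin

lemma dim_poly_mat [simp]: "dim_row (poly_mat f X) = n" "dim_col (poly_mat f X) = n"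
  using poly_mat_carrier[OF X, of f] by auto

lemma poly_mat_add: "poly_mat (f + g) X = poly_mat f X + poly_mat g X"
proof (rule eq_matI)
  let ?N = "max (degree f) (degree g)"
  fix i j assume "i < dim_row (poly_mat f X + poly_mat g X)" "j < dim_col (poly_mat f X + poly_mat g X)"
  hence ij: "i < n" "j < n" using poly_mat_carrier[OF X, of g] by auto
  thus "poly_mat (f + g) X $$ (i, j) = (poly_mat f X + poly_mat g X) $$ (i, j)"
    using poly_mat_carrier[OF X, of g]
    by (simp add: index_poly_mat[OF X ij, of _ ?N] degree_add_le_max sum.distrib distrib_right carrier_matD)
qed (use poly_mat_carrier[OF X] in auto)

lemma poly_mat_smult: "poly_mat (Polynomial.smult a f) X = a \<cdot>\<^sub>m poly_mat f X"
proof (rule eq_matI)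
  fix i j assume "i < dim_row (a \<cdot>\<^sub>m poly_mat f X)" "j < dim_col (a \<cdot>\<^sub>m poly_mat f X)"
  hence ij: "i < n" "j < n" using poly_mat_carrier[OF X, of f] by auto
  thus "poly_mat (Polynomial.smult a f) X $$ (i, j) = (a \<cdot>\<^sub>m poly_mat f X) $$ (i, j)"
    using poly_mat_carrier[OF X, of f]
    by (simp add: index_poly_mat[OF X ij, of _ "degree f"] degree_smult_le sum_distrib_left mult.assoc carrier_matD)
qed (use poly_mat_carrier[OF X] in auto)

lemma poly_mat_pCons: "poly_mat (pCons a f) X = a \<cdot>\<^sub>m 1\<^sub>m n + poly_mat f X * X"
proof (rule eq_matI)
  note c = poly_mat_carrier[OF X, of f] pow_carrier_mat[OF X]
  fix i j assume "i < dim_row (a \<cdot>\<^sub>m 1\<^sub>m n + poly_mat f X * X)" "j < dim_col (a \<cdot>\<^sub>m 1\<^sub>m n + poly_mat f X * X)"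
  hence ij: "i < n" "j < n" using c X by auto
  have "poly_mat (pCons a f) X $$ (i, j) = (\<Sum>l\<le>Suc (degree f). coeff (pCons a f) l * (X ^\<^sub>m l) $$ (i, j))"
    by (rule index_poly_mat[OF X ij]) (simp add: degree_pCons_le)
  also have "\<dots> = a * (1\<^sub>m n) $$ (i, j) + (\<Sum>l\<le>degree f. coeff f l * (X ^\<^sub>m l * X) $$ (i, j))"
    using X by (subst sum.atMost_Suc_shift) simp
  also have "(\<Sum>l\<le>degree f. coeff f l * (X ^\<^sub>m l * X) $$ (i, j))
      = (\<Sum>l\<le>degree f. \<Sum>k<n. coeff f l * (X ^\<^sub>m l) $$ (i, k) * X $$ (k, j))"
    using X ij c(2) by (intro sum.cong refl)
      (simp add: scalar_prod_def sum_distrib_left mult.assoc atLeast0LessThan carrier_matD)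
  also have "\<dots> = (\<Sum>k<n. poly_mat f X $$ (i, k) * X $$ (k, j))"
    by (subst sum.swap) (use ij in \<open>auto intro!: sum.cong simp: index_poly_mat[OF X, of _ _ _ "degree f"] sum_distrib_right\<close>)
  also have "\<dots> = (poly_mat f X * X) $$ (i, j)"
    using X ij by (simp add: scalar_prod_def atLeast0LessThan)
  finally show "poly_mat (pCons a f) X $$ (i, j) = (a \<cdot>\<^sub>m 1\<^sub>m n + poly_mat f X * X) $$ (i, j)"
    using X ij c(1) by (simp add: carrier_matD)
qed (use X poly_mat_carrier[OF X] in auto)

lemma poly_mat_0: "poly_mat 0 X = 0\<^sub>m n n"
  using X by (intro eq_matI) (auto simp: poly_mat_def)

lemma act_carrier [simp]: "v \<in> carrier_vec n \<Longrightarrow> poly_mat f X *\<^sub>v v \<in> carrier_vec n"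
  using poly_mat_carrier[OF X] by (rule mult_mat_vec_carrier)

lemma act_pCons: "v \<in> carrier_vec n \<Longrightarrow>
    poly_mat (pCons a f) X *\<^sub>v v = a \<cdot>\<^sub>v v + poly_mat f X *\<^sub>v (X *\<^sub>v v)"
  using X poly_mat_carrier[OF X, of f] unfolding poly_mat_pCons
  by (subst add_mult_distrib_mat_vec[of _ n n]) (auto simp: smult_mat_mult_vec assoc_mult_mat_vec[of _ n n _ n])

lemma act_0: "v \<in> carrier_vec n \<Longrightarrow> poly_mat 0 X *\<^sub>v v = 0\<^sub>v n"
  unfolding poly_mat_0 by (intro eq_vecI) (auto simp: scalar_prod_def)

lemma act_add_poly: "v \<in> carrier_vec n \<Longrightarrow>
    poly_mat (f + g) X *\<^sub>v v = poly_mat f X *\<^sub>v v + poly_mat g X *\<^sub>v v"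
  unfolding poly_mat_add by (rule add_mult_distrib_mat_vec[OF poly_mat_carrier[OF X] poly_mat_carrier[OF X]])

lemma act_add_vec: "v \<in> carrier_vec n \<Longrightarrow> w \<in> carrier_vec n \<Longrightarrow>
    poly_mat f X *\<^sub>v (v + w) = poly_mat f X *\<^sub>v v + poly_mat f X *\<^sub>v w"
  using poly_mat_carrier[OF X] by (intro mult_add_distrib_mat_vec) auto

lemma act_smult: "v \<in> carrier_vec n \<Longrightarrow>
    poly_mat (Polynomial.smult a f) X *\<^sub>v v = a \<cdot>\<^sub>v (poly_mat f X *\<^sub>v v)"
  unfolding poly_mat_smult by (intro smult_mat_mult_vec) auto

lemma act_smult_vec: "v \<in> carrier_vec n \<Longrightarrow>
    poly_mat f X *\<^sub>v (a \<cdot>\<^sub>v v) = a \<cdot>\<^sub>v (poly_mat f X *\<^sub>v v)"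
  by (intro mat_mult_smult_vec) auto

lemma act_const: "v \<in> carrier_vec n \<Longrightarrow> poly_mat [:a:] X *\<^sub>v v = a \<cdot>\<^sub>v v"
  using X by (simp add: act_pCons act_0)

lemma act_X: "v \<in> carrier_vec n \<Longrightarrow> poly_mat [:0, 1:] X *\<^sub>v v = X *\<^sub>v v"
  using X by (simp add: act_pCons act_0) 

lemma act_one: "v \<in> carrier_vec n \<Longrightarrow> poly_mat 1 X *\<^sub>v v = v"
  unfolding one_pCons by (simp add: act_const)

lemma act_commute: "v \<in> carrier_vec n \<Longrightarrow> X *\<^sub>v (poly_mat f X *\<^sub>v v) = poly_mat f X *\<^sub>v (X *\<^sub>v v)"
proof (induction f arbitrary: v)
  case (pCons a f)
  have "X *\<^sub>v v \<in> carrier_vec n" using X pCons by auto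
  thus ?case using X pCons by (simp add: act_pCons mult_add_distrib_mat_vec[OF X] mat_mult_smult_vec)
qed (use X in \<open>auto simp: act_0 scalar_prod_def intro!: eq_vecI\<close>)

lemma act_mult: "v \<in> carrier_vec n \<Longrightarrow> poly_mat (f * g) X *\<^sub>v v = poly_mat f X *\<^sub>v (poly_mat g X *\<^sub>v v)"
proof (induction f arbitrary: v)
  case (pCons a f)
  have Xv: "X *\<^sub>v v \<in> carrier_vec n" using X pCons by auto
  have "poly_mat (pCons a f * g) X *\<^sub>v v = poly_mat (Polynomial.smult a g + pCons 0 (f * g)) X *\<^sub>v v"
    by (simp only: mult_pCons_left)
  also have "\<dots> = a \<cdot>\<^sub>v (poly_mat g X *\<^sub>v v) + (0 \<cdot>\<^sub>v v + poly_mat (f * g) X *\<^sub>v (X *\<^sub>v v))"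
    by (simp only: act_add_poly[OF pCons.prems] act_smult[OF pCons.prems] act_pCons[OF pCons.prems])
  also have "0 \<cdot>\<^sub>v v + poly_mat (f * g) X *\<^sub>v (X *\<^sub>v v) = poly_mat (f * g) X *\<^sub>v (X *\<^sub>v v)"
    using pCons.prems act_carrier[OF Xv] by simp
  also have "\<dots> = poly_mat f X *\<^sub>v (X *\<^sub>v (poly_mat g X *\<^sub>v v))"
    by (simp only: pCons.IH[OF Xv] act_commute[OF pCons.prems])
  also have "a \<cdot>\<^sub>v (poly_mat g X *\<^sub>v v) + \<dots> = poly_mat (pCons a f) X *\<^sub>v (poly_mat g X *\<^sub>v v)"
    by (simp only: act_pCons[OF act_carrier[OF pCons.prems]])
  finally show ?case .
qed (simp add: act_0)

lemma mat_module_simps: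
  "carrier (mat_module X) = carrier_vec n" "\<zero>\<^bsub>mat_module X\<^esub> = 0\<^sub>v n"
  "add (mat_module X) = (+)" "smult (mat_module X) = (\<lambda>f v. poly_mat f X *\<^sub>v v)"
  using X by (auto simp: mat_module_def)

lemma mat_module: "cring_module (mat_module X)"
proof (rule moduleI)
  show "cring (class_ring :: 'a poly ring)" by (rule class_cring.cring_axioms)
  show "abelian_group (mat_module X)"
  proof (rule abelian_groupI, unfold mat_module_simps)
    fix v :: "'a vec" assume v: "v \<in> carrier_vec n"
    show "\<exists>w\<in>carrier_vec n. w + v = 0\<^sub>v n" using v by (intro bexI[of _ "- v"]) auto
  qed auto
qed (auto simp: mat_module_simps act_add_poly act_add_vec act_mult act_one)

lemma mat_module_minus:
  assumes v: "v \<in> carrier_vec n"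
  shows "\<ominus>\<^bsub>mat_module X\<^esub> v = - v" and "w \<in> carrier_vec n \<Longrightarrow> w \<ominus>\<^bsub>mat_module X\<^esub> v = w - v"
proof -
  interpret M: abelian_group "mat_module X" by (rule cring_moduleD[OF mat_module])
  show m: "\<ominus>\<^bsub>mat_module X\<^esub> v = - v"
    using v by (intro M.minus_equality) (auto simp: mat_module_simps)
  show "w \<in> carrier_vec n \<Longrightarrow> w \<ominus>\<^bsub>mat_module X\<^esub> v = w - v"
    using v unfolding a_minus_def m by (auto simp: mat_module_simps)
qed

end

lemma vec_span_induct:
  fixes L :: "'a::comm_ring_1 vec set"
  assumes "0\<^sub>v n \<in> L" and add: "\<And>v w. v \<in> L \<Longrightarrow> w \<in> L \<Longrightarrow> v + w \<in> L"
    and sm: "\<And>a v. v \<in> L \<Longrightarrow> a \<cdot>\<^sub>v v \<in> L" and unit: "\<And>j. j < n \<Longrightarrow> unit_vec n j \<in> L"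
    and v: "v \<in> carrier_vec n"
  shows "v \<in> L"
proof -
  have "m \<le> n \<Longrightarrow> vec n (\<lambda>i. if i < m then v $ i else 0) \<in> L" for m
  proof (induction m)
    case 0
    have "vec n (\<lambda>i. if i < 0 then v $ i else 0) = 0\<^sub>v n" by (intro eq_vecI) auto
    thus ?case using assms(1) by simp
  next
    case (Suc m)
    have "vec n (\<lambda>i. if i < Suc m then v $ i else 0)
        = vec n (\<lambda>i. if i < m then v $ i else 0) + v $ m \<cdot>\<^sub>v unit_vec n m"
      using Suc by (intro eq_vecI) (auto simp: less_Suc_eq)
    thus ?case using Suc add sm unit by simp
  qed
  moreover have "vec n (\<lambda>i. if i < n then v $ i else 0) = v" using v by (intro eq_vecI) auto
  ultimately show ?thesis using order_refl[of n] by metis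
qed

text \<open>
  The \<open>A\<close>-linear map \<open>A\<^sup>n \<rightarrow> G\<close> that sends the \<open>j\<close>-th unit vector to \<open>g j\<close>; a scalar \<open>a\<close> acts on
  the \<open>A[t]\<close>-module \<open>G\<close> as the constant polynomial \<open>[:a:]\<close>.
\<close>

definition lin :: "('a::comm_ring_1 poly, 'g) module \<Rightarrow> nat \<Rightarrow> (nat \<Rightarrow> 'g) \<Rightarrow> 'a vec \<Rightarrow> 'g" where
  "lin G n g v = finsum G (\<lambda>j. [:v $ j:] \<odot>\<^bsub>G\<^esub> g j) {..<n}"

context
  fixes G :: "('a::comm_ring_1 poly, 'g) module" and n :: nat
  assumes G: "cring_module G"
begin

interpretation G: abelian_group G by (rule cring_moduleD[OF G])
private lemmas gD = cring_moduleD[OF G]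

lemma lin_closed: "g \<in> {..<n} \<rightarrow> carrier G \<Longrightarrow> lin G n g v \<in> carrier G"
  unfolding lin_def by (intro G.finsum_closed) (auto simp: gD Pi_iff)

lemma lin_add:
  assumes "g \<in> {..<n} \<rightarrow> carrier G" "v \<in> carrier_vec n" "w \<in> carrier_vec n"
  shows "lin G n g (v + w) = lin G n g v \<oplus>\<^bsub>G\<^esub> lin G n g w"
proof -
  have "lin G n g (v + w) = finsum G (\<lambda>j. [:v $ j:] \<odot>\<^bsub>G\<^esub> g j \<oplus>\<^bsub>G\<^esub> [:w $ j:] \<odot>\<^bsub>G\<^esub> g j) {..<n}"
    unfolding lin_def
  proof (rule G.finsum_cong')
    fix j assume j: "j \<in> {..<n}"
    hence gj: "g j \<in> carrier G" using assms by auto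
    have "[:(v + w) $ j:] = [:v $ j:] + [:w $ j:]" using j assms by simp
    thus "[:(v + w) $ j:] \<odot>\<^bsub>G\<^esub> g j = [:v $ j:] \<odot>\<^bsub>G\<^esub> g j \<oplus>\<^bsub>G\<^esub> [:w $ j:] \<odot>\<^bsub>G\<^esub> g j"
      using gD(3)[OF gj] by metis
  qed (use assms in \<open>auto simp: gD Pi_iff\<close>)
  also have "\<dots> = lin G n g v \<oplus>\<^bsub>G\<^esub> lin G n g w"
    unfolding lin_def using assms by (intro G.finsum_addf) (auto simp: gD Pi_iff)
  finally show ?thesis .
qed

lemma lin_smult:
  assumes "g \<in> {..<n} \<rightarrow> carrier G" "v \<in> carrier_vec n"
  shows "lin G n g (a \<cdot>\<^sub>v v) = [:a:] \<odot>\<^bsub>G\<^esub> lin G n g v"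
proof -
  interpret GM: Module.module "class_ring :: 'a poly ring" G by (rule G)
  have "[:a:] \<odot>\<^bsub>G\<^esub> lin G n g v = finsum G (\<lambda>j. [:a:] \<odot>\<^bsub>G\<^esub> ([:v $ j:] \<odot>\<^bsub>G\<^esub> g j)) {..<n}"
    unfolding lin_def using assms by (intro GM.finsum_smult_ldistr) (auto simp: gD Pi_iff)
  also have "\<dots> = lin G n g (a \<cdot>\<^sub>v v)"
    unfolding lin_def
  proof (rule G.finsum_cong'[symmetric])
    fix j assume j: "j \<in> {..<n}"
    hence gj: "g j \<in> carrier G" using assms by auto
    have "[:(a \<cdot>\<^sub>v v) $ j:] = [:a:] * [:v $ j:]" using j assms by simp
    thus "[:(a \<cdot>\<^sub>v v) $ j:] \<odot>\<^bsub>G\<^esub> g j = [:a:] \<odot>\<^bsub>G\<^esub> ([:v $ j:] \<odot>\<^bsub>G\<^esub> g j)"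
      using gD(5)[OF gj] by metis
  qed (use assms in \<open>auto simp: gD Pi_iff\<close>)
  finally show ?thesis by simp
qed

lemma lin_unit:
  assumes "g \<in> {..<n} \<rightarrow> carrier G" "i < n"
  shows "lin G n g (unit_vec n i) = g i"
proof -
  have "lin G n g (unit_vec n i) = finsum G (\<lambda>j. if i = j then g j else \<zero>\<^bsub>G\<^esub>) {..<n}"
    unfolding lin_def
  proof (rule G.finsum_cong')
    fix j assume j: "j \<in> {..<n}"
    hence gj: "g j \<in> carrier G" using assms by auto
    show "[:unit_vec n i $ j:] \<odot>\<^bsub>G\<^esub> g j = (if i = j then g j else \<zero>\<^bsub>G\<^esub>)"
      using j assms gD(6,7)[OF gj] by (auto simp: unit_vec_def one_pCons[symmetric])
  qed (use assms in auto)
  also have "\<dots> = g i" using assms by (intro G.finsum_singleton) auto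
  finally show ?thesis .
qed

lemma lin_eqI:
  assumes F: "\<And>v. v \<in> carrier_vec n \<Longrightarrow> F v \<in> carrier G"
    and add: "\<And>v w. v \<in> carrier_vec n \<Longrightarrow> w \<in> carrier_vec n \<Longrightarrow> F (v + w) = F v \<oplus>\<^bsub>G\<^esub> F w"
    and sm: "\<And>a v. v \<in> carrier_vec n \<Longrightarrow> F (a \<cdot>\<^sub>v v) = [:a:] \<odot>\<^bsub>G\<^esub> F v"
    and g: "\<And>j. j < n \<Longrightarrow> g j = F (unit_vec n j)"
    and v: "v \<in> carrier_vec n"
  shows "F v = lin G n g v"
proof -
  have gc: "g \<in> {..<n} \<rightarrow> carrier G" using F g by auto
  have "v \<in> {v \<in> carrier_vec n. F v = lin G n g v}"
  proof (rule vec_span_induct[OF _ _ _ _ v])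
    have "F (0\<^sub>v n) = \<zero>\<^bsub>G\<^esub>" using sm[of "0\<^sub>v n" 0] gD(7)[OF F[of "0\<^sub>v n"]] by simp
    moreover have "lin G n g (0\<^sub>v n) = \<zero>\<^bsub>G\<^esub>"
      using lin_smult[OF gc, of "0\<^sub>v n" 0] gD(7)[OF lin_closed[OF gc]] by simp
    ultimately show "0\<^sub>v n \<in> {v \<in> carrier_vec n. F v = lin G n g v}" by simp
  qed (auto simp: add sm lin_add[OF gc] lin_smult[OF gc] lin_unit[OF gc] g)
  thus ?thesis by simp
qed

lemma lin_mem:
  assumes H: "submod H G" and g: "\<And>j. j < n \<Longrightarrow> g j \<in> H" and v: "v \<in> carrier_vec n"
  shows "lin G n g v \<in> H"
proof -
  have gc: "g \<in> {..<n} \<rightarrow> carrier G" using submodD(4)[OF H] g by auto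
  note HD = submodD[OF H]
  have "v \<in> {v \<in> carrier_vec n. lin G n g v \<in> H}"
  proof (rule vec_span_induct[OF _ _ _ _ v])
    show "0\<^sub>v n \<in> {v \<in> carrier_vec n. lin G n g v \<in> H}"
      using lin_smult[OF gc, of "0\<^sub>v n" 0] gD(7)[OF lin_closed[OF gc]] HD(3) by simp
  qed (auto simp: lin_add[OF gc] lin_smult[OF gc] lin_unit[OF gc] g HD)
  thus ?thesis by simp
qed

end

section \<open>Extension of linear maps and equidistribution of values\<close>

text \<open>
  The fibres over the image are translates of the kernel.
\<close>

lemma card_hom_image_kernel:
  assumes L: "submod L M" and fin: "finite (carrier M)" and N: "abelian_group N"
    and f: "\<And>x. x \<in> L \<Longrightarrow> f x \<in> carrier N"
    and add: "\<And>x y. x \<in> L \<Longrightarrow> y \<in> L \<Longrightarrow> f (x \<oplus>\<^bsub>M\<^esub> y) = f x \<oplus>\<^bsub>N\<^esub> f y"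
  shows "card L = card (f ` L) * card {x \<in> L. f x = \<zero>\<^bsub>N\<^esub>}"
proof (rule card_image_fibres)
  note LD = submodD[OF L]
  interpret N: abelian_group N by (rule N)
  interpret M: abelian_group M by (rule cring_moduleD[OF LD(1)])
  show "finite L" using LD(2) fin finite_subset by blast
  fix y assume "y \<in> f ` L"
  then obtain a where a: "a \<in> L" "y = f a" by blast
  have "bij_betw (\<lambda>x. a \<oplus>\<^bsub>M\<^esub> x) {x \<in> L. f x = \<zero>\<^bsub>N\<^esub>} {x \<in> L. f x = y}"
  proof (rule bij_betwI[where g = "\<lambda>x. \<ominus>\<^bsub>M\<^esub> a \<oplus>\<^bsub>M\<^esub> x"])
    show "(\<lambda>x. a \<oplus>\<^bsub>M\<^esub> x) \<in> {x \<in> L. f x = \<zero>\<^bsub>N\<^esub>} \<rightarrow> {x \<in> L. f x = y}"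
      using a LD(5) by (auto simp: add f)
    show "(\<lambda>x. \<ominus>\<^bsub>M\<^esub> a \<oplus>\<^bsub>M\<^esub> x) \<in> {x \<in> L. f x = y} \<rightarrow> {x \<in> L. f x = \<zero>\<^bsub>N\<^esub>}"
    proof
      fix x assume x: "x \<in> {x \<in> L. f x = y}"
      have m: "\<ominus>\<^bsub>M\<^esub> a \<oplus>\<^bsub>M\<^esub> x \<in> L" using LD(5)[OF LD(7)[OF a(1)]] x by simp
      have "a \<oplus>\<^bsub>M\<^esub> (\<ominus>\<^bsub>M\<^esub> a \<oplus>\<^bsub>M\<^esub> x) = x" using a x LD(4) by (simp add: M.r_neg2)
      hence "f a = f a \<oplus>\<^bsub>N\<^esub> f (\<ominus>\<^bsub>M\<^esub> a \<oplus>\<^bsub>M\<^esub> x)" using add[OF a(1) m] x a by simp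
      hence "f (\<ominus>\<^bsub>M\<^esub> a \<oplus>\<^bsub>M\<^esub> x) = \<zero>\<^bsub>N\<^esub>" using f[OF a(1)] f[OF m] by simp
      thus "\<ominus>\<^bsub>M\<^esub> a \<oplus>\<^bsub>M\<^esub> x \<in> {x \<in> L. f x = \<zero>\<^bsub>N\<^esub>}" using m by simp
    qed
  qed (use a LD(4) in \<open>auto simp: M.r_neg1 M.r_neg2\<close>)
  thus "card {x \<in> L. f x = y} = card {x \<in> L. f x = \<zero>\<^bsub>N\<^esub>}" using bij_betw_same_card by force
qed

text \<open>
  Prescribing the values \<open>gs\<close> on \<open>ys\<close> determines a linear map only modulo \<open>H\<close>, so it is given by
  its graph \<open>\<Gamma>\<close>, a submodule in which the first component determines the second one modulo \<open>H\<close>.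
  The list \<open>ys\<close> is completed to a basis of \<open>M\<close> modulo \<open>L\<close>, with the value \<open>0\<close> at the new elements.
\<close>

lemma (in residue_system) ex_linear_relation:
  assumes N: "cring_module N" and M: "cring_module M" and fin: "finite (carrier M)"
    and L: "submod L M" and H: "submod H N" and K: "submod K N" and HK: "H \<subseteq> K"
    and ind: "indep M L ys" and len: "length gs = length ys"
    and Jy: "\<And>y j. y \<in> carrier M \<Longrightarrow> j \<in> J \<Longrightarrow> j \<odot>\<^bsub>M\<^esub> y \<in> L"
    and Jg: "\<And>g j. g \<in> set gs \<Longrightarrow> j \<in> J \<Longrightarrow> j \<odot>\<^bsub>N\<^esub> g \<in> H" and gK: "set gs \<subseteq> K"
  obtains \<Gamma> where "submod \<Gamma> (direct_sum M N)" "L \<times> H \<subseteq> \<Gamma>" "\<Gamma> \<subseteq> carrier M \<times> K"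
    "fst ` \<Gamma> = carrier M" "\<And>z. (\<zero>\<^bsub>M\<^esub>, z) \<in> \<Gamma> \<Longrightarrow> z \<in> H"
    "\<And>i. i < length ys \<Longrightarrow> (ys ! i, gs ! i) \<in> \<Gamma>"
proof -
  let ?D = "direct_sum M N"
  note mD = cring_moduleD[OF M] and nD = cring_moduleD[OF N]
  note LD = submodD[OF L] and HD = submodD[OF H] and KD = submodD[OF K]
  interpret M: abelian_group M by (rule mD)
  have D: "cring_module ?D" by (rule direct_sum_is_module[OF M N])
  have ysM: "set ys \<subseteq> carrier M" by (rule indep_carrier[OF ind])
  have LH: "submod (L \<times> H) ?D"
    using LD HD by (intro submodI[OF D]) (auto simp: direct_sum_def)
  have CK: "submod (carrier M \<times> K) ?D"
    using mD(2) KD by (intro submodI[OF D]) (auto simp: direct_sum_def)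
  have car: "submod (carrier M) M" using mD by (intro submodI[OF M]) auto
  obtain zs where zs: "set zs \<subseteq> carrier M" "indep M (gen M L ys) zs" "gen M (gen M L ys) zs = carrier M"
    using ex_indep_gen[OF submod_gen[OF M L ysM] car gen_subset[OF M car LD(2) ysM] fin] by blast
  define ys' where "ys' = ys @ zs"
  define gs' where "gs' = gs @ map (\<lambda>_. \<zero>\<^bsub>N\<^esub>) zs"
  have ys': "indep M L ys'" "gen M L ys' = carrier M" using ind zs by (auto simp: ys'_def indep_append gen_append)
  have ys'M: "set ys' \<subseteq> carrier M" by (rule indep_carrier[OF ys'(1)])
  have gs': "set gs' \<subseteq> K" using gK KD(3) by (auto simp: gs'_def)
  have len': "length gs' = length ys'" using len by (simp add: gs'_def ys'_def)
  define \<Gamma> where "\<Gamma> = gen ?D (L \<times> H) (zip ys' gs')"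
  have fstLH: "fst ` (L \<times> H) = L" using HD(3) by force
  have zipc: "set (zip ys' gs') \<subseteq> carrier M \<times> K"
    using ys'M gs' by (auto dest: set_zip_leftD set_zip_rightD)
  have zipD: "set (zip ys' gs') \<subseteq> carrier ?D"
    using zipc KD(2) by (force simp: direct_sum_def)
  have "fst ` gen ?D (L \<times> H) (zip ys' gs') = gen M (fst ` (L \<times> H)) ys'
      \<and> (\<forall>z. (\<zero>\<^bsub>M\<^esub>, z) \<in> gen ?D (L \<times> H) (zip ys' gs') \<longrightarrow> z \<in> H)"
  proof (rule graph_of_extension[OF N M LH L H subset_refl])
    show "indep M (fst ` (L \<times> H)) ys'" unfolding fstLH by (rule ys')
    show "\<And>g j. g \<in> set gs' \<Longrightarrow> j \<in> J \<Longrightarrow> j \<odot>\<^bsub>N\<^esub> g \<in> H"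
      using Jg HD(3) nD(8) by (auto simp: gs'_def)
  qed (use len' gs' KD(2) Jy ys'M in auto)
  hence main: "fst ` \<Gamma> = gen M L ys' \<and> (\<forall>z. (\<zero>\<^bsub>M\<^esub>, z) \<in> \<Gamma> \<longrightarrow> z \<in> H)"
    unfolding fstLH \<Gamma>_def .
  show ?thesis
  proof
    show "submod \<Gamma> ?D" unfolding \<Gamma>_def by (rule submod_gen[OF D LH zipD])
    show "L \<times> H \<subseteq> \<Gamma>" unfolding \<Gamma>_def by (rule gen_superset[OF D LH zipD])
    show "\<Gamma> \<subseteq> carrier M \<times> K" unfolding \<Gamma>_def
      using LD(2) HK zipc by (intro gen_subset[OF D CK]) auto
    show "fst ` \<Gamma> = carrier M" using main ys'(2) by simp
    show "\<And>z. (\<zero>\<^bsub>M\<^esub>, z) \<in> \<Gamma> \<Longrightarrow> z \<in> H" using main by blast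
    fix i assume i: "i < length ys"
    hence "(ys' ! i, gs' ! i) \<in> set (zip ys' gs')"
      using len len' by (auto simp: set_zip ys'_def intro!: exI[of _ i])
    hence "(ys' ! i, gs' ! i) \<in> \<Gamma>" using set_subset_gen[OF D LH zipD] unfolding \<Gamma>_def by blast
    thus "(ys ! i, gs ! i) \<in> \<Gamma>" using i len by (simp add: ys'_def gs'_def nth_append)
  qed
qed

lemma gen_cong:
  assumes H: "submod H M" and ws: "set ws \<subseteq> carrier M" "set ws' \<subseteq> carrier M" "length ws = length ws'"
    and c: "\<And>i. i < length ws \<Longrightarrow> ws ! i \<ominus>\<^bsub>M\<^esub> ws' ! i \<in> H"
  shows "gen M H ws = gen M H ws'"
proof -
  note M = submodD(1)[OF H]
  interpret M: abelian_group M by (rule cring_moduleD[OF M])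
  have "gen M H us \<subseteq> gen M H us'"
    if us: "set us \<subseteq> carrier M" "set us' \<subseteq> carrier M" "length us = length us'"
      "\<And>i. i < length us \<Longrightarrow> us ! i \<ominus>\<^bsub>M\<^esub> us' ! i \<in> H" for us us'
  proof -
    note S = submod_gen[OF M H us(2)]
    have sub: "H \<subseteq> gen M H us'" "set us' \<subseteq> gen M H us'"
      using gen_superset[OF M H us(2)] set_subset_gen[OF M H us(2)] by auto
    have "us ! i \<in> gen M H us'" if i: "i < length us" for i
    proof -
      have us'i: "us' ! i \<in> set us'" and usi: "us ! i \<in> set us" using us(3) i by simp_all
      hence ui: "us ! i \<in> carrier M" "us' ! i \<in> carrier M" using us(1,2) by blast+
      have "(us ! i \<ominus>\<^bsub>M\<^esub> us' ! i) \<oplus>\<^bsub>M\<^esub> us' ! i \<in> gen M H us'"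
        by (rule submodD(5)[OF S]) (use sub us(4)[OF i] us'i in blast)+
      also have "(us ! i \<ominus>\<^bsub>M\<^esub> us' ! i) \<oplus>\<^bsub>M\<^esub> us' ! i = us ! i"
        using ui by (simp add: a_minus_def M.a_assoc M.l_neg)
      finally show ?thesis .
    qed
    hence "set us \<subseteq> gen M H us'" by (auto simp: in_set_conv_nth)
    thus ?thesis using sub by (intro gen_subset[OF M S])
  qed
  from this[OF ws c] this[OF ws(2,1)] show ?thesis
  proof (rule subset_antisym)
    fix i assume i: "i < length ws'"
    have "ws ! i \<in> set ws" "ws' ! i \<in> set ws'" using ws(3) i by simp_all
    hence wi: "ws ! i \<in> carrier M" "ws' ! i \<in> carrier M" using ws(1,2) by blast+
    have "\<ominus>\<^bsub>M\<^esub> (ws ! i \<ominus>\<^bsub>M\<^esub> ws' ! i) \<in> H" using submodD(7)[OF H c] i ws by simp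
    also have "\<ominus>\<^bsub>M\<^esub> (ws ! i \<ominus>\<^bsub>M\<^esub> ws' ! i) = ws' ! i \<ominus>\<^bsub>M\<^esub> ws ! i"
      using wi by (simp add: a_minus_def M.minus_add M.a_comm)
    finally show "ws' ! i \<ominus>\<^bsub>M\<^esub> ws ! i \<in> H" .
  qed (use ws in auto)
qed

text \<open>
  If permutations of \<open>W\<close> translate the evaluation \<open>E\<close> by every \<open>b \<in> K\<^sup>r\<close> modulo \<open>H\<close>, then \<open>E\<close> is
  equidistributed modulo \<open>H\<close>, and a set \<open>Z\<close> that is a union of classes modulo \<open>H\<close> is hit in
  proportion to its size.  The proof counts the pairs \<open>(w, b)\<close> with \<open>E w + b \<in> Z\<close> in two ways.
\<close>

lemma uniform_evaluation:
  assumes M: "abelian_group M" and K: "\<And>x y. x \<in> K \<Longrightarrow> y \<in> K \<Longrightarrow> x \<oplus>\<^bsub>M\<^esub> y \<in> K"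
      "\<And>x. x \<in> K \<Longrightarrow> \<ominus>\<^bsub>M\<^esub> x \<in> K" "K \<subseteq> carrier M" and finK: "finite K" and finW: "finite W"
    and E: "\<And>w. w \<in> W \<Longrightarrow> length (E w) = r \<and> set (E w) \<subseteq> K"
    and trans: "\<And>b. length b = r \<Longrightarrow> set b \<subseteq> K \<Longrightarrow> \<exists>\<tau>. bij_betw \<tau> W W \<and>
        (\<forall>w\<in>W. \<forall>i<r. E (\<tau> w) ! i \<ominus>\<^bsub>M\<^esub> (E w ! i \<oplus>\<^bsub>M\<^esub> b ! i) \<in> H)"
    and stable: "\<And>b c. length b = r \<Longrightarrow> length c = r \<Longrightarrow> set b \<subseteq> K \<Longrightarrow> set c \<subseteq> K \<Longrightarrow>
        (\<And>i. i < r \<Longrightarrow> b ! i \<ominus>\<^bsub>M\<^esub> c ! i \<in> H) \<Longrightarrow> b \<in> Z \<longleftrightarrow> c \<in> Z"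
    and Z: "\<And>b. b \<in> Z \<Longrightarrow> length b = r \<and> set b \<subseteq> K"
  shows "card K ^ r * card {w \<in> W. E w \<in> Z} = card W * card Z"
proof -
  interpret M: abelian_group M by (rule M)
  let ?B = "{b. length b = r \<and> set b \<subseteq> K}"
  let ?a = "\<lambda>x y. map2 (\<lambda>x y. x \<oplus>\<^bsub>M\<^esub> y) x y"
  have set_zip: "x \<in> set b \<and> y \<in> set c" if "(x, y) \<in> set (zip b c)" for x y and b c :: "'a list"
    using that by (auto dest: set_zip_leftD set_zip_rightD)
  have a_B: "?a b c \<in> ?B" if "b \<in> ?B" "c \<in> ?B" for b c
    using that K(1) by (auto dest!: set_zip)
  have nth_K: "b ! i \<in> K \<and> b ! i \<in> carrier M" if "b \<in> ?B" "i < r" for b i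
  proof -
    have "b ! i \<in> set b" using that by (intro nth_mem) simp
    thus ?thesis using that K(3) by blast
  qed
  have "card ?B * card {w \<in> W. E w \<in> Z} = card W * card Z"
  proof (rule double_counting[where Q = "\<lambda>w b. ?a (E w) b \<in> Z"])
    show "finite ?B" using finite_lists_length_eq[OF finK, of r] by (simp add: conj_commute)
    fix b assume b: "b \<in> ?B"
    then obtain \<tau> where \<tau>: "bij_betw \<tau> W W"
      "\<And>w i. w \<in> W \<Longrightarrow> i < r \<Longrightarrow> E (\<tau> w) ! i \<ominus>\<^bsub>M\<^esub> (E w ! i \<oplus>\<^bsub>M\<^esub> b ! i) \<in> H" using trans by blast
    have iff: "E (\<tau> w) \<in> Z \<longleftrightarrow> ?a (E w) b \<in> Z" if w: "w \<in> W" for w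
    proof (rule stable)
      have "\<tau> w \<in> W" using \<tau>(1) w bij_betwE by blast
      thus "length (E (\<tau> w)) = r" "set (E (\<tau> w)) \<subseteq> K" using E by auto
      have "?a (E w) b \<in> ?B" using a_B[OF _ b] E[OF w] by blast
      thus "length (?a (E w) b) = r" "set (?a (E w) b) \<subseteq> K" by auto
      fix i assume "i < r"
      thus "E (\<tau> w) ! i \<ominus>\<^bsub>M\<^esub> ?a (E w) b ! i \<in> H" using \<tau>(2)[OF w] E[OF w] b by simp
    qed
    have "bij_betw \<tau> {w \<in> W. ?a (E w) b \<in> Z} {w \<in> W. E w \<in> Z}"
    proof (rule bij_betw_imageI)
      have inj: "inj_on \<tau> W" and im: "\<tau> ` W = W" using \<tau>(1) by (simp_all add: bij_betw_def)
      show "inj_on \<tau> {w \<in> W. ?a (E w) b \<in> Z}" by (rule inj_on_subset[OF inj]) auto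
      show "\<tau> ` {w \<in> W. ?a (E w) b \<in> Z} = {w \<in> W. E w \<in> Z}"
      proof (intro equalityI subsetI)
        fix x assume "x \<in> \<tau> ` {w \<in> W. ?a (E w) b \<in> Z}"
        then obtain w where "x = \<tau> w" "w \<in> W" "?a (E w) b \<in> Z" by blast
        thus "x \<in> {w \<in> W. E w \<in> Z}" using iff im by blast
      next
        fix x assume x: "x \<in> {w \<in> W. E w \<in> Z}"
        then obtain w where "x = \<tau> w" "w \<in> W" using im by blast
        thus "x \<in> \<tau> ` {w \<in> W. ?a (E w) b \<in> Z}" using x iff by blast
      qed
    qed
    thus "card {w \<in> W. ?a (E w) b \<in> Z} = card {w \<in> W. E w \<in> Z}" by (rule bij_betw_same_card)
  next
    fix w assume w: "w \<in> W"
    have Ew: "E w \<in> ?B" using E[OF w] by blast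
    let ?n = "map (\<lambda>x. \<ominus>\<^bsub>M\<^esub> x) (E w)"
    have n: "?n \<in> ?B" using Ew K(2) by auto
    have "bij_betw (?a (E w)) {b \<in> ?B. ?a (E w) b \<in> Z} Z"
    proof (rule bij_betwI[where g = "?a ?n"])
      have cancel: "?a (E w) (?a ?n c) = c" "?a ?n (?a (E w) c) = c" if c: "c \<in> ?B" for c
        using Ew c nth_K[OF Ew] nth_K[OF c] by (auto intro!: nth_equalityI simp: M.r_neg1 M.r_neg2)
      show "?a (E w) \<in> {b \<in> ?B. ?a (E w) b \<in> Z} \<rightarrow> Z" by auto
      show "?a ?n \<in> Z \<rightarrow> {b \<in> ?B. ?a (E w) b \<in> Z}"
      proof
        fix c assume c: "c \<in> Z"
        hence cB: "c \<in> ?B" using Z by blast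
        show "?a ?n c \<in> {b \<in> ?B. ?a (E w) b \<in> Z}" using a_B[OF n cB] cancel(1)[OF cB] c by simp
      qed
      show "\<And>x. x \<in> {b \<in> ?B. ?a (E w) b \<in> Z} \<Longrightarrow> ?a ?n (?a (E w) x) = x" using cancel(2) by blast
      show "\<And>y. y \<in> Z \<Longrightarrow> ?a (E w) (?a ?n y) = y" using cancel(1) Z by blast
    qed
    thus "card {b \<in> ?B. ?a (E w) b \<in> Z} = card Z" by (rule bij_betw_same_card)
  qed (rule finW)
  moreover have "card ?B = card K ^ r" using card_lists_length_eq[OF finK, of r] by (simp add: conj_commute)
  ultimately show ?thesis by simp
qed

lemma finite_card_carrier_vec:
  "finite (carrier_vec n :: 'a::finite vec set) \<and> card (carrier_vec n :: 'a vec set) = CARD('a) ^ n"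
proof -
  let ?P = "{..<n} \<rightarrow>\<^sub>E (UNIV :: 'a set)"
  have b: "bij_betw (vec n) ?P (carrier_vec n :: 'a vec set)"
  proof (rule bij_betwI[where g = "\<lambda>v. restrict (\<lambda>i. v $ i) {..<n}"])
    fix x assume "x \<in> ?P"
    thus "restrict (\<lambda>i. vec n x $ i) {..<n} = x" by (intro ext) (auto simp: PiE_def extensional_def)
  qed auto
  have "finite ?P" by (intro finite_PiE) auto
  thus ?thesis using bij_betw_finite[OF b] bij_betw_same_card[OF b] by (simp add: card_PiE)
qed

lemma finite_card_carrier_mat:
  "finite (carrier_mat n m :: 'a::finite mat set) \<and> card (carrier_mat n m :: 'a mat set) = CARD('a) ^ (n * m)"
proof -
  let ?P = "({..<n} \<times> {..<m}) \<rightarrow>\<^sub>E (UNIV :: 'a set)"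
  have b: "bij_betw (mat n m) ?P (carrier_mat n m :: 'a mat set)"
  proof (rule bij_betwI[where g = "\<lambda>X. restrict (\<lambda>ij. X $$ ij) ({..<n} \<times> {..<m})"])
    fix x assume x: "x \<in> ?P"
    show "restrict (\<lambda>ij. mat n m x $$ ij) ({..<n} \<times> {..<m}) = x"
    proof (rule ext)
      fix ij show "restrict (\<lambda>ij. mat n m x $$ ij) ({..<n} \<times> {..<m}) ij = x ij"
        using PiE_arb[OF x, of ij] by (cases ij) auto
    qed
  qed (auto intro!: eq_matI)
  have "finite ?P" by (intro finite_PiE) auto
  thus ?thesis using bij_betw_finite[OF b] bij_betw_same_card[OF b]
    by (simp add: card_PiE card_cartesian_product)
qed

lemma submod_matI:
  fixes X :: "'a::comm_ring_1 mat"
  assumes X: "X \<in> carrier_mat n n" and L: "L \<subseteq> carrier_vec n" "0\<^sub>v n \<in> L"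
    and add: "\<And>v w. v \<in> L \<Longrightarrow> w \<in> L \<Longrightarrow> v + w \<in> L" and sm: "\<And>a v. v \<in> L \<Longrightarrow> a \<cdot>\<^sub>v v \<in> L"
    and XL: "\<And>v. v \<in> L \<Longrightarrow> X *\<^sub>v v \<in> L"
  shows "submod L (mat_module X)"
proof (rule submodI[OF mat_module[OF X]])
  fix v f assume "v \<in> L"
  hence "poly_mat f X *\<^sub>v v \<in> L"
  proof (induction f arbitrary: v)
    case 0 thus ?case using L act_0[OF X, of v] by auto
  next
    case (pCons a f) thus ?case using L add sm XL act_pCons[OF X, of v a f] by auto
  qed
  thus "f \<odot>\<^bsub>mat_module X\<^esub> v \<in> L" by (simp add: mat_module_simps[OF X])
qed (use L add in \<open>auto simp: mat_module_simps[OF X]\<close>)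

lemma submod_matD:
  fixes X :: "'a::comm_ring_1 mat"
  assumes X: "X \<in> carrier_mat n n" and L: "submod L (mat_module X)"
  shows "L \<subseteq> carrier_vec n" "0\<^sub>v n \<in> L" "v \<in> L \<Longrightarrow> v \<in> carrier_vec n"
    "v \<in> L \<Longrightarrow> w \<in> L \<Longrightarrow> v + w \<in> L" "v \<in> L \<Longrightarrow> a \<cdot>\<^sub>v v \<in> L" "v \<in> L \<Longrightarrow> X *\<^sub>v v \<in> L"
    "v \<in> L \<Longrightarrow> poly_mat f X *\<^sub>v v \<in> L" "v \<in> L \<Longrightarrow> w \<in> L \<Longrightarrow> v - w \<in> L"
proof -
  note LD = submodD[OF L, unfolded mat_module_simps[OF X]]
  show c: "L \<subseteq> carrier_vec n" "0\<^sub>v n \<in> L" "v \<in> L \<Longrightarrow> v \<in> carrier_vec n"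
    "v \<in> L \<Longrightarrow> w \<in> L \<Longrightarrow> v + w \<in> L" "v \<in> L \<Longrightarrow> poly_mat f X *\<^sub>v v \<in> L"
    using LD(2,3,4,5,6) by auto
  show "v \<in> L \<Longrightarrow> a \<cdot>\<^sub>v v \<in> L" using LD(6)[of v "[:a:]"] LD(4) act_const[OF X] by simp
  show "v \<in> L \<Longrightarrow> X *\<^sub>v v \<in> L" using LD(6)[of v "[:0,1:]"] LD(4) act_X[OF X] by simp
  show "v \<in> L \<Longrightarrow> w \<in> L \<Longrightarrow> v - w \<in> L"
    using LD(8)[of v w] LD(4) mat_module_minus(2)[OF X] by simp
qed

definition mat_of_columns :: "nat \<Rightarrow> (nat \<Rightarrow> 'a vec) \<Rightarrow> 'a mat" where
  "mat_of_columns n c = mat n n (\<lambda>(i, j). c j $ i)"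

lemma mat_of_columns_carrier [simp]: "mat_of_columns n c \<in> carrier_mat n n"
  by (simp add: mat_of_columns_def)

lemma mat_of_columns_unit:
  fixes c :: "nat \<Rightarrow> 'a::comm_ring_1 vec"
  assumes "j < n" "c j \<in> carrier_vec n"
  shows "mat_of_columns n c *\<^sub>v unit_vec n j = c j"
  using assms by (intro eq_vecI) (auto simp: mat_of_columns_def scalar_prod_right_unit)

section \<open>Congruences modulo a submodule\<close>

context
  fixes H :: "'m set" and M :: "('c::comm_ring_1, 'm) module"
  assumes H: "submod H M"
begin

interpretation M: abelian_group M by (rule cring_moduleD[OF submodD(1)[OF H]])
private lemmas MD = cring_moduleD[OF submodD(1)[OF H]]
private lemmas HD = submodD[OF H]

lemma diff_self: "x \<in> carrier M \<Longrightarrow> x \<ominus>\<^bsub>M\<^esub> x \<in> H"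
  using HD(3) by (simp add: a_minus_def M.r_neg)

lemma diff_sym:
  assumes "x \<ominus>\<^bsub>M\<^esub> y \<in> H" "x \<in> carrier M" "y \<in> carrier M"
  shows "y \<ominus>\<^bsub>M\<^esub> x \<in> H"
proof -
  have "\<ominus>\<^bsub>M\<^esub> (x \<ominus>\<^bsub>M\<^esub> y) = y \<ominus>\<^bsub>M\<^esub> x" using assms by (simp add: a_minus_def M.minus_add M.a_comm)
  thus ?thesis using HD(7)[OF assms(1)] by simp
qed

lemma diff_trans:
  assumes "x \<ominus>\<^bsub>M\<^esub> y \<in> H" "y \<ominus>\<^bsub>M\<^esub> z \<in> H" "x \<in> carrier M" "y \<in> carrier M" "z \<in> carrier M"
  shows "x \<ominus>\<^bsub>M\<^esub> z \<in> H"
proof -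
  have "(x \<ominus>\<^bsub>M\<^esub> y) \<oplus>\<^bsub>M\<^esub> (y \<ominus>\<^bsub>M\<^esub> z) = x \<ominus>\<^bsub>M\<^esub> z"
    using assms(3-) by (simp add: a_minus_def M.a_assoc M.r_neg1)
  thus ?thesis using HD(5)[OF assms(1,2)] by simp
qed

lemma diff_add:
  assumes "x \<ominus>\<^bsub>M\<^esub> y \<in> H" "x' \<ominus>\<^bsub>M\<^esub> y' \<in> H"
    and c: "x \<in> carrier M" "y \<in> carrier M" "x' \<in> carrier M" "y' \<in> carrier M"
  shows "(x \<oplus>\<^bsub>M\<^esub> x') \<ominus>\<^bsub>M\<^esub> (y \<oplus>\<^bsub>M\<^esub> y') \<in> H"
proof -
  have "(x \<ominus>\<^bsub>M\<^esub> y) \<oplus>\<^bsub>M\<^esub> (x' \<ominus>\<^bsub>M\<^esub> y') = (x \<oplus>\<^bsub>M\<^esub> x') \<ominus>\<^bsub>M\<^esub> (y \<oplus>\<^bsub>M\<^esub> y')"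
    using c by (simp add: a_minus_def M.minus_add M.a_ac)
  thus ?thesis using HD(5)[OF assms(1,2)] by simp
qed

lemma diff_smult:
  assumes "x \<ominus>\<^bsub>M\<^esub> y \<in> H" "x \<in> carrier M" "y \<in> carrier M"
  shows "a \<odot>\<^bsub>M\<^esub> x \<ominus>\<^bsub>M\<^esub> a \<odot>\<^bsub>M\<^esub> y \<in> H"
  using HD(6)[OF assms(1), of a] assms(2,3) by (simp add: MD(11))

lemma diff_mem:
  assumes "x \<ominus>\<^bsub>M\<^esub> y \<in> H" "y \<in> K" "submod K M" "H \<subseteq> K" "x \<in> carrier M"
  shows "x \<in> K"
proof -
  have y: "y \<in> carrier M" using submodD(4)[OF assms(3,2)] .
  have "(x \<ominus>\<^bsub>M\<^esub> y) \<oplus>\<^bsub>M\<^esub> y = x" using assms(5) y by (simp add: a_minus_def M.a_assoc M.l_neg)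
  moreover have "(x \<ominus>\<^bsub>M\<^esub> y) \<oplus>\<^bsub>M\<^esub> y \<in> K"
    by (rule submodD(5)[OF assms(3) _ assms(2)]) (use assms(1,4) in blast)
  ultimately show ?thesis by simp
qed

end

lemma submod_zero: "cring_module M \<Longrightarrow> submod {\<zero>\<^bsub>M\<^esub>} M"
proof (rule submodI)
  assume M: "cring_module M"
  interpret M: abelian_group M by (rule cring_moduleD[OF M])
  show "{\<zero>\<^bsub>M\<^esub>} \<subseteq> carrier M" by simp
  show "\<And>x y. x \<in> {\<zero>\<^bsub>M\<^esub>} \<Longrightarrow> y \<in> {\<zero>\<^bsub>M\<^esub>} \<Longrightarrow> x \<oplus>\<^bsub>M\<^esub> y \<in> {\<zero>\<^bsub>M\<^esub>}" by simp
  show "\<And>x a. x \<in> {\<zero>\<^bsub>M\<^esub>} \<Longrightarrow> a \<odot>\<^bsub>M\<^esub> x \<in> {\<zero>\<^bsub>M\<^esub>}" using cring_moduleD(8)[OF M] by simp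
qed auto

lemma submod_carrier: "cring_module M \<Longrightarrow> submod (carrier M) M"
proof (rule submodI)
  assume M: "cring_module M"
  interpret M: abelian_group M by (rule cring_moduleD[OF M])
  show "\<zero>\<^bsub>M\<^esub> \<in> carrier M" by simp
  show "\<And>x y. x \<in> carrier M \<Longrightarrow> y \<in> carrier M \<Longrightarrow> x \<oplus>\<^bsub>M\<^esub> y \<in> carrier M" by simp
  show "\<And>x a. x \<in> carrier M \<Longrightarrow> a \<odot>\<^bsub>M\<^esub> x \<in> carrier M" using cring_moduleD(2)[OF M] by simp
qed auto

lemma diff_eq_zero:
  assumes "abelian_group M" "x \<ominus>\<^bsub>M\<^esub> y = \<zero>\<^bsub>M\<^esub>" "x \<in> carrier M" "y \<in> carrier M"
  shows "x = y"
proof -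
  interpret M: abelian_group M by fact
  have "(x \<ominus>\<^bsub>M\<^esub> y) \<oplus>\<^bsub>M\<^esub> y = x" using assms(3,4) by (simp add: a_minus_def M.a_assoc M.l_neg)
  thus ?thesis using assms by simp
qed

lemma relation_functional:
  assumes G: "submod \<Gamma> (direct_sum M N)" and M: "cring_module M" and N: "cring_module N"
    and ker: "\<And>z. (\<zero>\<^bsub>M\<^esub>, z) \<in> \<Gamma> \<Longrightarrow> z \<in> H"
    and xz: "(x, z) \<in> \<Gamma>" and xz': "(x, z') \<in> \<Gamma>"
  shows "z \<ominus>\<^bsub>N\<^esub> z' \<in> H"
proof -
  note mD = cring_moduleD[OF M] and nD = cring_moduleD[OF N]
  interpret M: abelian_group M by (rule mD)
  interpret N: abelian_group N by (rule nD)
  have c: "x \<in> carrier M" "z \<in> carrier N" "z' \<in> carrier N"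
    using submodD(4)[OF G xz] submodD(4)[OF G xz'] by (auto simp: direct_sum_def)
  have "((-1) \<odot>\<^bsub>M\<^esub> x, (-1) \<odot>\<^bsub>N\<^esub> z') \<in> \<Gamma>" using submodD(6)[OF G xz', of "-1"] by (simp add: direct_sum_def)
  hence "(\<ominus>\<^bsub>M\<^esub> x, \<ominus>\<^bsub>N\<^esub> z') \<in> \<Gamma>" using mD(6,9)[OF c(1)] nD(6,9)[OF c(3)] by simp
  from submodD(5)[OF G xz this] have "(\<zero>\<^bsub>M\<^esub>, z \<ominus>\<^bsub>N\<^esub> z') \<in> \<Gamma>"
    using c by (simp add: direct_sum_def M.r_neg a_minus_def)
  thus ?thesis by (rule ker)
qed

lemma lin_zip_add:
  assumes G: "cring_module G" and g: "g \<in> {..<n} \<rightarrow> carrier G" "h \<in> {..<n} \<rightarrow> carrier G"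
  shows "lin G n (restrict (\<lambda>j. g j \<oplus>\<^bsub>G\<^esub> h j) {..<n}) v = lin G n g v \<oplus>\<^bsub>G\<^esub> lin G n h v"
proof -
  note gD = cring_moduleD[OF G]
  interpret G: abelian_group G by (rule gD)
  have "lin G n (restrict (\<lambda>j. g j \<oplus>\<^bsub>G\<^esub> h j) {..<n}) v
      = finsum G (\<lambda>j. [:v $ j:] \<odot>\<^bsub>G\<^esub> g j \<oplus>\<^bsub>G\<^esub> [:v $ j:] \<odot>\<^bsub>G\<^esub> h j) {..<n}"
    unfolding lin_def using g by (intro G.finsum_cong') (auto simp: gD Pi_iff)
  also have "\<dots> = lin G n g v \<oplus>\<^bsub>G\<^esub> lin G n h v"
    unfolding lin_def using g by (intro G.finsum_addf) (auto simp: gD Pi_iff)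
  finally show ?thesis .
qed

text \<open>
  A map that commutes with \<open>t\<close> modulo \<open>H\<close> commutes with all polynomials modulo \<open>H\<close>.  For \<open>H = 0\<close>
  this says that \<open>lin G n g\<close> is \<open>A[t]\<close>-linear.
\<close>

lemma lin_act_cong:
  fixes X :: "'a::comm_ring_1 mat"
  assumes G: "cring_module G" and H: "submod H G" and g: "g \<in> {..<n} \<rightarrow> carrier G"
    and X: "X \<in> carrier_mat n n"
    and c: "\<And>v. v \<in> carrier_vec n \<Longrightarrow> lin G n g (X *\<^sub>v v) \<ominus>\<^bsub>G\<^esub> [:0, 1:] \<odot>\<^bsub>G\<^esub> lin G n g v \<in> H"
    and v: "v \<in> carrier_vec n"
  shows "lin G n g (poly_mat f X *\<^sub>v v) \<ominus>\<^bsub>G\<^esub> f \<odot>\<^bsub>G\<^esub> lin G n g v \<in> H"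
  using v
proof (induction f arbitrary: v)
  case 0
  note gD = cring_moduleD[OF G] and cl = lin_closed[OF G g]
  interpret G: abelian_group G by (rule gD)
  have "lin G n g (0 \<cdot>\<^sub>v v) = \<zero>\<^bsub>G\<^esub>" using lin_smult[OF G g 0, of 0] gD(7)[OF cl] by simp
  hence e: "lin G n g (0\<^sub>v n) = \<zero>\<^bsub>G\<^esub>" using 0 by simp
  show ?case unfolding act_0[OF X 0] e gD(7)[OF cl] by (rule diff_self[OF H G.zero_closed])
next
  case (pCons a f)
  note gD = cring_moduleD[OF G] and cl = lin_closed[OF G g]
  interpret G: abelian_group G by (rule gD)
  have Xv: "X *\<^sub>v v \<in> carrier_vec n" using X pCons.prems by auto
  have 1: "lin G n g (poly_mat (pCons a f) X *\<^sub>v v) = [:a:] \<odot>\<^bsub>G\<^esub> lin G n g v \<oplus>\<^bsub>G\<^esub> lin G n g (poly_mat f X *\<^sub>v (X *\<^sub>v v))"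
    using pCons.prems act_carrier[OF X Xv, of f] act_pCons[OF X pCons.prems, of a f]
    by (simp add: lin_add[OF G g] lin_smult[OF G g])
  have p: "pCons a f = [:a:] + f * [:0, 1:]" by (simp add: mult.commute[of f])
  have 2: "pCons a f \<odot>\<^bsub>G\<^esub> lin G n g v = [:a:] \<odot>\<^bsub>G\<^esub> lin G n g v \<oplus>\<^bsub>G\<^esub> f \<odot>\<^bsub>G\<^esub> ([:0, 1:] \<odot>\<^bsub>G\<^esub> lin G n g v)"
    unfolding p gD(3)[OF cl] gD(5)[OF cl] ..
  show ?case unfolding 1 2
    by (intro diff_add[OF H] diff_self[OF H] gD(2) cl
        diff_trans[OF H pCons.IH[OF Xv] diff_smult[OF H c[OF pCons.prems]]])
qed

section \<open>Reduction of vectors\<close>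

lemma submod_smult_image:
  assumes L: "submod L M" shows "submod ((\<lambda>x. c \<odot>\<^bsub>M\<^esub> x) ` L) M"
proof (rule submodI[OF submodD(1)[OF L]])
  note LD = submodD[OF L] and mD = cring_moduleD[OF submodD(1)[OF L]]
  let ?p = "\<lambda>x. c \<odot>\<^bsub>M\<^esub> x"
  show "?p ` L \<subseteq> carrier M" using LD(4) mD(2) by auto
  show "\<zero>\<^bsub>M\<^esub> \<in> ?p ` L" using LD(3) mD(8) by (metis image_eqI)
  fix x y a assume "x \<in> ?p ` L"
  then obtain x' where x: "x' \<in> L" "x = ?p x'" by blast
  have "a \<odot>\<^bsub>M\<^esub> x = ?p (a \<odot>\<^bsub>M\<^esub> x')"
    unfolding x(2) using mD(5)[OF LD(4)[OF x(1)], symmetric] by (simp only: mult.commute)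
  thus "a \<odot>\<^bsub>M\<^esub> x \<in> ?p ` L" using LD(6)[OF x(1)] by blast
  assume "y \<in> ?p ` L"
  then obtain y' where y: "y' \<in> L" "y = ?p y'" by blast
  have "x \<oplus>\<^bsub>M\<^esub> y = ?p (x' \<oplus>\<^bsub>M\<^esub> y')" using x y mD(4) LD(4) by simp
  thus "x \<oplus>\<^bsub>M\<^esub> y \<in> ?p ` L" using LD(5) x y by blast
qed

context prime_power_reduction
begin

abbreviation redv :: "'a mod_ring vec \<Rightarrow> 'p mod_ring vec" where "redv \<equiv> map_vec red"

definition pvec :: "nat \<Rightarrow> 'a mod_ring vec set" where
  "pvec n = (\<lambda>v. of_nat p \<cdot>\<^sub>v v) ` carrier_vec n"

lemma redv_eq_0_iff:
  assumes v: "v \<in> carrier_vec n"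
  shows "redv v = 0\<^sub>v n \<longleftrightarrow> v \<in> pvec n"
proof
  assume 0: "redv v = 0\<^sub>v n"
  have "\<exists>b. v $ i = of_nat p * b" if i: "i < n" for i
  proof -
    have "redv v $ i = 0\<^sub>v n $ i" using 0 by simp
    thus ?thesis using i v red_eq_0_iff by simp
  qed
  then obtain b where "\<And>i. i < n \<Longrightarrow> v $ i = of_nat p * b i" by metis
  hence "v = of_nat p \<cdot>\<^sub>v vec n b" using v by (intro eq_vecI) auto
  thus "v \<in> pvec n" by (auto simp: pvec_def)
next
  assume "v \<in> pvec n"
  thus "redv v = 0\<^sub>v n" by (auto simp: pvec_def red.hom_mult red_of_nat of_nat_p_field intro!: eq_vecI)
qed

lemma redv_add: "v \<in> carrier_vec n \<Longrightarrow> w \<in> carrier_vec n \<Longrightarrow> redv (v + w) = redv v + redv w"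
  by (intro eq_vecI) (auto simp: red.hom_add)

lemma redv_minus: "v \<in> carrier_vec n \<Longrightarrow> w \<in> carrier_vec n \<Longrightarrow> redv (v - w) = redv v - redv w"
  by (intro eq_vecI) (auto simp: red.hom_minus)

lemma redv_smult: "redv (a \<cdot>\<^sub>v v) = red a \<cdot>\<^sub>v redv v"
  by (intro eq_vecI) (auto simp: red.hom_mult)

lemma redv_eq_iff:
  assumes "v \<in> carrier_vec n" "w \<in> carrier_vec n"
  shows "redv v = redv w \<longleftrightarrow> v - w \<in> pvec n"
proof -
  have "redv v = redv w \<longleftrightarrow> redv v - redv w = 0\<^sub>v n"
  proof
    assume e: "redv v - redv w = 0\<^sub>v n"
    show "redv v = redv w"
    proof (rule eq_vecI)
      fix i assume "i < dim_vec (redv w)"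
      hence i: "i < n" using assms by simp
      have "(redv v - redv w) $ i = 0" using e i by simp
      thus "redv v $ i = redv w $ i" using i assms by simp
    qed (use assms in simp)
  qed (use assms in \<open>auto intro!: eq_vecI\<close>)
  thus ?thesis using redv_eq_0_iff[of "v - w" n] assms redv_minus by simp
qed

lemma redv_surj: "w \<in> carrier_vec n \<Longrightarrow> \<exists>v \<in> carrier_vec n. redv v = w"
  by (intro bexI[of _ "map_vec lft w"]) (auto intro!: eq_vecI)

lemma redv_act:
  assumes X: "X \<in> carrier_mat n n" and v: "v \<in> carrier_vec n"
  shows "redv (poly_mat f X *\<^sub>v v) = poly_mat (map_poly red f) (map_mat red X) *\<^sub>v redv v"
  using v
proof (induction f arbitrary: v)
  case 0
  have rX: "map_mat red X \<in> carrier_mat n n" using X by simp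
  show ?case using act_0[OF X 0] act_0[OF rX, of "redv v"] 0 by (auto intro!: eq_vecI)
next
  case (pCons a f)
  have rX: "map_mat red X \<in> carrier_mat n n" and Xv: "X *\<^sub>v v \<in> carrier_vec n" using X pCons.prems by auto
  have h: "map_poly red (pCons a f) = pCons (red a) (map_poly red f)"
    by (simp add: poly_eq_iff coeff_map_poly coeff_pCons split: nat.split)
  have rv: "redv v \<in> carrier_vec n" using pCons.prems by simp
  show ?case unfolding h act_pCons[OF X pCons.prems] act_pCons[OF rX rv]
    using act_carrier[OF X Xv] pCons.prems
    by (subst redv_add) (auto simp: redv_smult pCons.IH[OF Xv] red.mult_mat_vec_hom[OF X pCons.prems])
qed

lemma finite_V: "finite (carrier_vec n :: 'a mod_ring vec set)"
  using finite_card_carrier_vec by blast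

lemma card_V: "card (carrier_vec n :: 'a mod_ring vec set) = p ^ (k * n)"
  using finite_card_carrier_vec[where 'a = "'a mod_ring"] by (simp add: card_a power_mult)

lemma card_Vbar: "card (carrier_vec n :: 'p mod_ring vec set) = p ^ n"
  using finite_card_carrier_vec[where 'a = "'p mod_ring"] by (simp add: card_p)

lemma p_gt_0: "p > 0" using prime_p prime_gt_0_nat by blast

lemma pvec_act: "X \<in> carrier_mat n n \<Longrightarrow> v \<in> carrier_vec n \<Longrightarrow>
    [:of_nat p:] \<odot>\<^bsub>mat_module X\<^esub> v = of_nat p \<cdot>\<^sub>v v"
  by (simp add: mat_module_simps act_const)

lemma pvec_mem: "v \<in> carrier_vec n \<Longrightarrow> of_nat p \<cdot>\<^sub>v v \<in> pvec n"
  by (auto simp: pvec_def)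

lemma pvec_carrier: "pvec n \<subseteq> carrier_vec n" by (auto simp: pvec_def)

lemma submod_pvec: "X \<in> carrier_mat n n \<Longrightarrow> submod (pvec n) (mat_module X)"
  using submod_smult_image[where c = "[:of_nat p:]", OF submod_carrier[OF mat_module[of X n]]]
  by (simp add: mat_module_simps pvec_def act_const cong: image_cong)

lemma card_V_pvec: "card (carrier_vec n :: 'a mod_ring vec set) = p ^ n * card (pvec n)"
proof -
  let ?X = "0\<^sub>m n n :: 'a mod_ring mat" and ?Y = "0\<^sub>m n n :: 'p mod_ring mat"
  have X: "?X \<in> carrier_mat n n" and Y: "?Y \<in> carrier_mat n n" by auto
  note simps = mat_module_simps[OF X] mat_module_simps[OF Y]
  have "card (carrier (mat_module ?X)) = card (redv ` carrier (mat_module ?X))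
      * card {v \<in> carrier (mat_module ?X). redv v = \<zero>\<^bsub>mat_module ?Y\<^esub>}"
    by (rule card_hom_image_kernel[OF submod_carrier[OF mat_module[OF X]] _ cring_moduleD(1)[OF mat_module[OF Y]]])
      (auto simp: simps finite_V redv_add)
  moreover have "redv ` carrier_vec n = carrier_vec n" using redv_surj by force
  moreover have "{v \<in> carrier_vec n. redv v = 0\<^sub>v n} = pvec n"
    using redv_eq_0_iff pvec_carrier by blast
  ultimately show ?thesis by (simp add: simps card_Vbar)
qed

lemma card_pvec: "card (pvec n) = p ^ ((k - 1) * n)"
proof -
  have "k * n = n + (k - 1) * n" using k_pos by (cases k) auto
  hence "p ^ n * card (pvec n) = p ^ n * p ^ ((k - 1) * n)"
    using card_V_pvec[of n] card_V[of n] by (metis power_add)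
  thus ?thesis using p_gt_0 by simp
qed

text \<open>
  As \<open>p\<^sup>k = 0\<close>, the decomposition only has to be iterated \<open>k\<close> times.  The set \<open>I\<close> is not assumed to
  be stable under \<open>t\<close>: below it is the image of an \<open>A\<close>-linear map that commutes with \<open>t\<close> only
  modulo \<open>p\<close>.
\<close>

lemma nakayama:
  fixes M :: "('a mod_ring poly, 'm) module"
  assumes L: "submod L M" and I: "I \<subseteq> L" "\<And>x y. x \<in> I \<Longrightarrow> y \<in> I \<Longrightarrow> x \<oplus>\<^bsub>M\<^esub> y \<in> I"
      "\<And>a x. x \<in> I \<Longrightarrow> [:a:] \<odot>\<^bsub>M\<^esub> x \<in> I"
    and dec: "\<And>x. x \<in> L \<Longrightarrow> \<exists>i\<in>I. \<exists>y\<in>L. x = i \<oplus>\<^bsub>M\<^esub> [:of_nat p:] \<odot>\<^bsub>M\<^esub> y"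
  shows "L \<subseteq> I"
proof
  note LD = submodD[OF L] and mD = cring_moduleD[OF submodD(1)[OF L]]
  interpret M: abelian_group M by (rule mD)
  fix x assume x: "x \<in> L"
  have "\<exists>i\<in>I. \<exists>y\<in>L. x = i \<oplus>\<^bsub>M\<^esub> [:of_nat p ^ m:] \<odot>\<^bsub>M\<^esub> y" if "m \<ge> 1" for m
    using that
  proof (induction m rule: dec_induct)
    case base thus ?case using dec[OF x] by simp
  next
    case (step m)
    then obtain i y where iy: "i \<in> I" "y \<in> L" "x = i \<oplus>\<^bsub>M\<^esub> [:of_nat p ^ m:] \<odot>\<^bsub>M\<^esub> y" by blast
    obtain i' y' where iy': "i' \<in> I" "y' \<in> L" "y = i' \<oplus>\<^bsub>M\<^esub> [:of_nat p:] \<odot>\<^bsub>M\<^esub> y'" using dec[OF iy(2)] by blast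
    have c: "i \<in> carrier M" "y' \<in> carrier M" "i' \<in> carrier M" using iy iy' I(1) LD(4) by auto
    have e: "[:of_nat p ^ Suc m:] = [:of_nat p ^ m:] * [:of_nat p :: 'a mod_ring:]" by simp
    have "[:of_nat p ^ m:] \<odot>\<^bsub>M\<^esub> y
        = [:of_nat p ^ m:] \<odot>\<^bsub>M\<^esub> i' \<oplus>\<^bsub>M\<^esub> [:of_nat p ^ Suc m:] \<odot>\<^bsub>M\<^esub> y'"
      unfolding e mD(5)[OF c(2)] iy'(3) by (intro mD(4) c mD(2))
    hence "x = (i \<oplus>\<^bsub>M\<^esub> [:of_nat p ^ m:] \<odot>\<^bsub>M\<^esub> i') \<oplus>\<^bsub>M\<^esub> [:of_nat p ^ Suc m:] \<odot>\<^bsub>M\<^esub> y'"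
      using iy(3) c mD(2) by (simp add: M.a_assoc)
    thus ?case using I(2)[OF iy(1) I(3)[OF iy'(1)]] iy'(2) by blast
  qed
  from this[OF k_pos] obtain i y where iy: "i \<in> I" "y \<in> L" "x = i \<oplus>\<^bsub>M\<^esub> [:of_nat p ^ k:] \<odot>\<^bsub>M\<^esub> y" by blast
  have "(of_nat p ^ k :: 'a mod_ring) = 0" by (metis card_a of_nat_card_eq_0 of_nat_power)
  hence "x = i" using iy LD(4) I(1) mD(7)[of y] by (auto simp: subset_iff)
  thus "x \<in> I" using iy by simp
qed

end

section \<open>Surjections onto \<open>G\<close> that are linear modulo \<open>p\<close>\<close>

context monic_lift
begin

lemma J_smult:
  fixes M :: "('a mod_ring poly, 'm) module"
  assumes M: "cring_module M" and PM: "\<And>x. x \<in> carrier M \<Longrightarrow> P \<odot>\<^bsub>M\<^esub> x = \<zero>\<^bsub>M\<^esub>"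
    and j: "j \<in> J" and x: "x \<in> carrier M"
  obtains y where "y \<in> carrier M" "j \<odot>\<^bsub>M\<^esub> x = [:of_nat p:] \<odot>\<^bsub>M\<^esub> y"
proof -
  note mD = cring_moduleD[OF M]
  interpret M: abelian_group M by (rule mD)
  obtain a b where jab: "j = a * P + [:of_nat p:] * b" using j mem_J_iff by blast
  have "j \<odot>\<^bsub>M\<^esub> x = a \<odot>\<^bsub>M\<^esub> (P \<odot>\<^bsub>M\<^esub> x) \<oplus>\<^bsub>M\<^esub> [:of_nat p:] \<odot>\<^bsub>M\<^esub> (b \<odot>\<^bsub>M\<^esub> x)"
    unfolding jab mD(3)[OF x] mD(5)[OF x] ..
  also have "\<dots> = [:of_nat p:] \<odot>\<^bsub>M\<^esub> (b \<odot>\<^bsub>M\<^esub> x)"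
    unfolding PM[OF x] mD(8) by (intro M.l_zero mD(2) x)
  finally show ?thesis using that mD(2)[OF x] by blast
qed

end

text \<open>
  The data of the theorem as modules over \<open>A[t]\<close>.  The assumption \<open>card_G\<close> says that \<open>G/pG\<close> has
  \<open>q\<^sup>r\<close> elements, and \<open>card_cok\<close> says the same of \<open>cok(P(Xbar))\<close>.
\<close>

locale cokernel_count = monic_lift p k A F P Q
  for p k :: nat and A :: "'a::nontriv itself" and F :: "'p::prime_card itself"
    and P :: "'a mod_ring poly" and Q :: "'p mod_ring poly" +
  fixes n r :: nat and G :: "('a mod_ring poly, 'g) module" and Xbar :: "'p mod_ring mat"
  assumes G: "cring_module G" and finG: "finite (carrier G)"
    and PG: "x \<in> carrier G \<Longrightarrow> P \<odot>\<^bsub>G\<^esub> x = \<zero>\<^bsub>G\<^esub>"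
    and Xbar: "Xbar \<in> carrier_mat n n"
    and card_G: "card (carrier G) = q ^ r * card ((\<lambda>x. [:of_nat p:] \<odot>\<^bsub>G\<^esub> x) ` carrier G)"
    and card_cok: "p ^ n = q ^ r * card ((\<lambda>v. poly_mat Q Xbar *\<^sub>v v) ` carrier_vec n)"
begin

interpretation G: abelian_group G by (rule cring_moduleD[OF G])

lemmas gD = cring_moduleD[OF G]

abbreviation V :: "'a mod_ring vec set" where "V \<equiv> carrier_vec n"

definition pG :: "'g set" where "pG = (\<lambda>x. [:of_nat p:] \<odot>\<^bsub>G\<^esub> x) ` carrier G"

definition Ubar :: "'p mod_ring vec set" where "Ubar = (\<lambda>v. poly_mat Q Xbar *\<^sub>v v) ` carrier_vec n"

text \<open>
  For every lift \<open>X\<close> this is \<open>P(X) A\<^sup>n + p A\<^sup>n\<close>; the relevant inclusion is \<open>U_decompose\<close>.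
\<close>

definition U :: "'a mod_ring vec set" where "U = {v \<in> V. redv v \<in> Ubar}"

definition lifts :: "'a mod_ring mat set" where "lifts = {X \<in> carrier_mat n n. map_mat red X = Xbar}"

lemma liftsD: "X \<in> lifts \<Longrightarrow> X \<in> carrier_mat n n" "X \<in> lifts \<Longrightarrow> map_mat red X = Xbar"
  by (auto simp: lifts_def)

lemma submod_pG: "submod pG G" unfolding pG_def by (rule submod_smult_image[OF submod_carrier[OF G]])

lemma card_G': "card (carrier G) = q ^ r * card pG" unfolding pG_def by (rule card_G)

lemma pG_carrier: "pG \<subseteq> carrier G" by (rule submodD(2)[OF submod_pG])

lemma pG_mem: "x \<in> carrier G \<Longrightarrow> [:of_nat p:] \<odot>\<^bsub>G\<^esub> x \<in> pG" by (auto simp: pG_def)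

lemma J_pG:
  assumes "j \<in> J" "x \<in> carrier G" shows "j \<odot>\<^bsub>G\<^esub> x \<in> pG"
proof -
  obtain y where y: "y \<in> carrier G" "j \<odot>\<^bsub>G\<^esub> x = [:of_nat p:] \<odot>\<^bsub>G\<^esub> y"
    using J_smult[OF G PG assms] by blast
  show ?thesis unfolding y(2) by (rule pG_mem[OF y(1)])
qed

lemma Ubar_closed:
  "0\<^sub>v n \<in> Ubar" "v \<in> Ubar \<Longrightarrow> w \<in> Ubar \<Longrightarrow> v + w \<in> Ubar" "v \<in> Ubar \<Longrightarrow> a \<cdot>\<^sub>v v \<in> Ubar"
  "v \<in> Ubar \<Longrightarrow> Xbar *\<^sub>v v \<in> Ubar" "Ubar \<subseteq> carrier_vec n"
proof -
  have m: "x \<in> carrier_vec n \<Longrightarrow> poly_mat Q Xbar *\<^sub>v x \<in> Ubar" for x by (auto simp: Ubar_def)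
  show "v \<in> Ubar \<Longrightarrow> w \<in> Ubar \<Longrightarrow> v + w \<in> Ubar"
    using m by (auto simp: Ubar_def act_add_vec[OF Xbar, symmetric])
  show sm: "v \<in> Ubar \<Longrightarrow> a \<cdot>\<^sub>v v \<in> Ubar" for v a
    using m by (auto simp: Ubar_def act_smult_vec[OF Xbar, symmetric])
  show "v \<in> Ubar \<Longrightarrow> Xbar *\<^sub>v v \<in> Ubar"
    using m Xbar by (auto simp: Ubar_def act_commute[OF Xbar])
  show c: "Ubar \<subseteq> carrier_vec n" using Xbar by (auto simp: Ubar_def)
  show "0\<^sub>v n \<in> Ubar" using sm[OF m[of "0\<^sub>v n"], of 0] Xbar by simp
qed

lemma submod_U:
  assumes X: "X \<in> lifts" shows "submod U (mat_module X)"
proof (rule submod_matI[OF liftsD(1)[OF X]])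
  have r0: "redv (0\<^sub>v n) = 0\<^sub>v n" by (intro eq_vecI) auto
  show "0\<^sub>v n \<in> U" using Ubar_closed(1) by (simp add: U_def r0)
  fix v assume v: "v \<in> U"
  hence vc: "v \<in> V" by (simp add: U_def)
  have "redv (X *\<^sub>v v) = Xbar *\<^sub>v redv v"
    using red.mult_mat_vec_hom[OF liftsD(1)[OF X] vc] liftsD(2)[OF X] by simp
  thus "X *\<^sub>v v \<in> U" using v liftsD(1)[OF X] Ubar_closed(4) by (auto simp: U_def)
qed (auto simp: U_def redv_add redv_smult Ubar_closed)

lemma J_U:
  assumes X: "X \<in> lifts" and j: "j \<in> J" and v: "v \<in> V" shows "poly_mat j X *\<^sub>v v \<in> U"
proof -
  obtain h where h: "map_poly red j = Q * h" using j by (auto simp: J_def elim!: dvdE)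
  have rv: "redv v \<in> carrier_vec n" using v by simp
  have "redv (poly_mat j X *\<^sub>v v) = poly_mat Q Xbar *\<^sub>v (poly_mat h Xbar *\<^sub>v redv v)"
    unfolding redv_act[OF liftsD(1)[OF X] v] liftsD(2)[OF X] h by (rule act_mult[OF Xbar rv])
  also have "\<dots> \<in> Ubar" using act_carrier[OF Xbar rv] by (auto simp: Ubar_def)
  finally show ?thesis using act_carrier[OF liftsD(1)[OF X] v] by (simp add: U_def)
qed

lemma pvec_U: "pvec n \<subseteq> U"
proof
  fix v assume v: "v \<in> pvec n"
  hence vV: "v \<in> V" using pvec_carrier by blast
  have "redv v = 0\<^sub>v n" using v redv_eq_0_iff[OF vV] by simp
  thus "v \<in> U" using vV Ubar_closed(1) by (simp add: U_def)
qed

lemma U_decompose: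
  assumes X: "X \<in> lifts" and v: "v \<in> U"
  obtains w b where "w \<in> V" "b \<in> pvec n" "v = poly_mat P X *\<^sub>v w + b"
proof -
  obtain wb where wb: "wb \<in> carrier_vec n" "redv v = poly_mat Q Xbar *\<^sub>v wb" using v by (auto simp: U_def Ubar_def)
  obtain w where w: "w \<in> V" "redv w = wb" using redv_surj[OF wb(1)] by blast
  have c: "poly_mat P X *\<^sub>v w \<in> V" "v \<in> V" using act_carrier[OF liftsD(1)[OF X] w(1)] v by (auto simp: U_def)
  have "redv v = redv (poly_mat P X *\<^sub>v w)"
    unfolding redv_act[OF liftsD(1)[OF X] w(1)] liftsD(2)[OF X] w(2) wb(2) Q_def ..
  hence "v - poly_mat P X *\<^sub>v w \<in> pvec n" using redv_eq_iff c by blast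
  moreover have "v = a + (v - a)" if "a \<in> V" for a using c(2) that by (intro eq_vecI) auto
  hence "v = poly_mat P X *\<^sub>v w + (v - poly_mat P X *\<^sub>v w)" using c(1) by blast
  ultimately show ?thesis using that w(1) by blast
qed

lemma card_V_U: "card V = q ^ r * card U"
proof -
  define X where "X = map_mat lft Xbar"
  have X: "X \<in> lifts" using Xbar by (auto simp: X_def lifts_def intro!: eq_matI)
  note X' = liftsD(1)[OF X]
  note simps = mat_module_simps[OF X'] mat_module_simps[OF Xbar]
  have "card U = card (redv ` U) * card {v \<in> U. redv v = \<zero>\<^bsub>mat_module Xbar\<^esub>}"
    by (rule card_hom_image_kernel[OF submod_U[OF X] _ cring_moduleD(1)[OF mat_module[OF Xbar]]])
      (auto simp: simps finite_V redv_add U_def)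
  moreover have "redv ` U = Ubar"
  proof
    show "Ubar \<subseteq> redv ` U"
    proof
      fix w assume w: "w \<in> Ubar"
      then obtain v where "v \<in> V" "redv v = w" using redv_surj[of w n] Ubar_closed(5) by blast
      thus "w \<in> redv ` U" using w by (auto simp: U_def)
    qed
  qed (auto simp: U_def)
  moreover have "{v \<in> U. redv v = 0\<^sub>v n} = pvec n"
    using redv_eq_0_iff[of _ n] pvec_U by (auto simp: U_def)
  ultimately have "card U = card Ubar * card (pvec n)" by (simp add: simps)
  thus ?thesis using card_V_pvec[of n] card_cok by (simp add: Ubar_def)
qed

lemma ex_basis_mod_U:
  assumes X: "X \<in> lifts"
  obtains ys where "indep (mat_module X) U ys" "gen (mat_module X) U ys = V" "length ys = r" "set ys \<subseteq> V"
proof -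
  note X' = liftsD(1)[OF X] and simps = mat_module_simps[OF liftsD(1)[OF X]]
  obtain ys where ys: "set ys \<subseteq> V" "indep (mat_module X) U ys" "gen (mat_module X) U ys = V"
    using ex_indep_gen[OF submod_U[OF X] submod_carrier[OF mat_module[OF X']]] finite_V[of n]
    by (auto simp: simps U_def)
  have "card (gen (mat_module X) U ys) = q ^ length ys * card U"
    using ys J_U[OF X] by (intro card_gen submod_U[OF X]) (auto simp: simps finite_V)
  moreover have "card U > 0"
    using finite_subset[OF _ finite_V[of n], of U] pvec_U pvec_mem[of "0\<^sub>v n" n]
    by (auto simp: card_gt_0_iff U_def)
  ultimately have "q ^ length ys = q ^ r" using card_V_U ys(3) by simp
  hence "length ys = r" using q_gt_1 by (simp add: power_inject_exp)
  thus ?thesis using that ys by blast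
qed

text \<open>
  The tuples whose map \<open>lin G n g\<close> is \<open>A[t]\<close>-linear modulo \<open>pG\<close> when \<open>t\<close> acts on \<open>A\<^sup>n\<close> as \<open>X\<close>.
\<close>

definition homs_mod_p :: "'a mod_ring mat \<Rightarrow> (nat \<Rightarrow> 'g) set" where
  "homs_mod_p X = {g \<in> {..<n} \<rightarrow>\<^sub>E carrier G.
     \<forall>v\<in>V. lin G n g (X *\<^sub>v v) \<ominus>\<^bsub>G\<^esub> [:0, 1:] \<odot>\<^bsub>G\<^esub> lin G n g v \<in> pG}"

lemma homs_mod_pD:
  assumes "g \<in> homs_mod_p X"
  shows "g \<in> {..<n} \<rightarrow> carrier G" "lin G n g v \<in> carrier G"
    "v \<in> V \<Longrightarrow> lin G n g (X *\<^sub>v v) \<ominus>\<^bsub>G\<^esub> [:0, 1:] \<odot>\<^bsub>G\<^esub> lin G n g v \<in> pG"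
proof -
  show g: "g \<in> {..<n} \<rightarrow> carrier G" using assms by (auto simp: homs_mod_p_def)
  show "lin G n g v \<in> carrier G" by (rule lin_closed[OF G g])
  show "v \<in> V \<Longrightarrow> lin G n g (X *\<^sub>v v) \<ominus>\<^bsub>G\<^esub> [:0, 1:] \<odot>\<^bsub>G\<^esub> lin G n g v \<in> pG"
    using assms by (simp add: homs_mod_p_def)
qed

lemma finite_homs_mod_p: "finite (homs_mod_p X)"
  by (rule finite_subset[of _ "{..<n} \<rightarrow>\<^sub>E carrier G"]) (auto simp: homs_mod_p_def finG intro!: finite_PiE)

lemma lin_pvec:
  assumes g: "g \<in> {..<n} \<rightarrow> carrier G" and b: "b \<in> pvec n"
  shows "lin G n g b \<in> pG"
  using b lin_smult[OF G g] pG_mem[OF lin_closed[OF G g]] by (auto simp: pvec_def)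

text \<open>
  Modulo \<open>pG\<close> the value at \<open>P(X) w\<close> is \<open>P\<close> times the value at \<open>w\<close>, and \<open>P\<close> kills \<open>G\<close>.
\<close>

lemma lin_U:
  assumes X: "X \<in> lifts" and g: "g \<in> homs_mod_p X" and v: "v \<in> U" shows "lin G n g v \<in> pG"
proof -
  note gd = homs_mod_pD[OF g]
  obtain w b where w: "w \<in> V" "b \<in> pvec n" "v = poly_mat P X *\<^sub>v w + b" using U_decompose[OF X v] .
  have "lin G n g (poly_mat P X *\<^sub>v w) \<ominus>\<^bsub>G\<^esub> P \<odot>\<^bsub>G\<^esub> lin G n g w \<in> pG"
    by (rule lin_act_cong[OF G submod_pG gd(1) liftsD(1)[OF X] gd(3) w(1)])
  hence "lin G n g (poly_mat P X *\<^sub>v w) \<in> pG"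
    unfolding PG[OF gd(2)[of w]]
    by (rule diff_mem[OF submod_pG _ submodD(3)[OF submod_pG] submod_pG subset_refl gd(2)])
  thus ?thesis unfolding w(3) using w(1,2) pvec_carrier act_carrier[OF liftsD(1)[OF X] w(1)]
    by (subst lin_add[OF G gd(1)]) (auto intro!: submodD(5)[OF submod_pG] lin_pvec[OF gd(1)])
qed

lemma submod_lin_vimage:
  assumes X: "X \<in> lifts" and g: "g \<in> homs_mod_p X" and K: "submod K G" "pG \<subseteq> K"
  shows "submod {v \<in> V. lin G n g v \<in> K} (mat_module X)"
proof (rule submod_matI[OF liftsD(1)[OF X]])
  note gd = homs_mod_pD[OF g] and KD = submodD[OF K(1)]
  have "lin G n g (0\<^sub>v n) = \<zero>\<^bsub>G\<^esub>"
    using lin_smult[OF G gd(1), of "0\<^sub>v n" 0] gD(7)[OF gd(2)[of "0\<^sub>v n"]] by simp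
  thus "0\<^sub>v n \<in> {v \<in> V. lin G n g v \<in> K}" using KD(3) by simp
  fix v assume v: "v \<in> {v \<in> V. lin G n g v \<in> K}"
  hence "[:0, 1:] \<odot>\<^bsub>G\<^esub> lin G n g v \<in> K" using KD(6) by simp
  hence "lin G n g (X *\<^sub>v v) \<in> K"
    using diff_mem[OF submod_pG gd(3) _ K gd(2)] v by simp
  thus "X *\<^sub>v v \<in> {v \<in> V. lin G n g v \<in> K}" using v liftsD(1)[OF X] by auto
next
  note gd = homs_mod_pD[OF g] and KD = submodD[OF K(1)]
  fix v w assume "v \<in> {v \<in> V. lin G n g v \<in> K}" "w \<in> {v \<in> V. lin G n g v \<in> K}"
  thus "v + w \<in> {v \<in> V. lin G n g v \<in> K}" using KD(5) by (simp add: lin_add[OF G gd(1)])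
next
  note gd = homs_mod_pD[OF g] and KD = submodD[OF K(1)]
  fix v a assume "v \<in> {v \<in> V. lin G n g v \<in> K}"
  thus "a \<cdot>\<^sub>v v \<in> {v \<in> V. lin G n g v \<in> K}" using KD(6) by (simp add: lin_smult[OF G gd(1)])
qed auto

context
  fixes X :: "'a mod_ring mat" and ys :: "'a mod_ring vec list"
  assumes X: "X \<in> lifts" and ind: "indep (mat_module X) U ys"
    and gen_ys: "gen (mat_module X) U ys = V" and len: "length ys = r" and ysV: "set ys \<subseteq> V"
begin

lemma V_subset_vimage:
  assumes g: "g \<in> homs_mod_p X" and K: "submod K G" "pG \<subseteq> K" and ys: "\<And>y. y \<in> set ys \<Longrightarrow> lin G n g y \<in> K"
    and v: "v \<in> V"
  shows "lin G n g v \<in> K"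
proof -
  have "gen (mat_module X) U ys \<subseteq> {v \<in> V. lin G n g v \<in> K}"
    using lin_U[OF X g] K(2) ys ysV
    by (intro gen_subset[OF mat_module[OF liftsD(1)[OF X]] submod_lin_vimage[OF X g K]]) (auto simp: U_def)
  thus ?thesis using v gen_ys by blast
qed

text \<open>
  The map induced from \<open>A\<^sup>n/U\<close> to \<open>G/pG\<close> is surjective iff the values at the basis \<open>ys\<close> generate,
  and surjectivity modulo \<open>p\<close> suffices by Nakayama.
\<close>

lemma surj_iff_gen:
  assumes g: "g \<in> homs_mod_p X"
  shows "lin G n g ` V = carrier G \<longleftrightarrow> gen G pG (map (lin G n g) ys) = carrier G"
proof
  note gd = homs_mod_pD[OF g]
  let ?K = "gen G pG (map (lin G n g) ys)"
  have c: "set (map (lin G n g) ys) \<subseteq> carrier G" using gd(2) by auto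
  have K: "submod ?K G" "pG \<subseteq> ?K" "set (map (lin G n g) ys) \<subseteq> ?K" "?K \<subseteq> carrier G"
    using submod_gen[OF G submod_pG c] gen_superset[OF G submod_pG c] set_subset_gen[OF G submod_pG c]
      gen_subset[OF G submod_carrier[OF G] pG_carrier c] by auto
  { assume "lin G n g ` V = carrier G"
    moreover have "lin G n g ` V \<subseteq> ?K" using V_subset_vimage[OF g K(1,2)] K(3) by auto
    ultimately show "?K = carrier G" using K(4) by blast }
  assume gen: "?K = carrier G"
  let ?I = "lin G n g ` V"
  \<comment> \<open>\<open>?S\<close> is the image plus \<open>pG\<close>; it is stable under \<open>t\<close>, although the image need not be.\<close>
  let ?S = "{x \<in> carrier G. \<exists>v\<in>V. x \<ominus>\<^bsub>G\<^esub> lin G n g v \<in> pG}"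
  have S: "submod ?S G"
  proof (rule submodI[OF G])
    show "\<zero>\<^bsub>G\<^esub> \<in> ?S"
      using diff_self[OF submod_pG, of "\<zero>\<^bsub>G\<^esub>"] lin_smult[OF G gd(1), of "0\<^sub>v n" 0] gD(7)[OF gd(2)[of "0\<^sub>v n"]]
      by (auto intro!: bexI[of _ "0\<^sub>v n"])
    fix x f assume x: "x \<in> ?S"
    then obtain v where v: "v \<in> V" "x \<in> carrier G" "x \<ominus>\<^bsub>G\<^esub> lin G n g v \<in> pG" by blast
    have fv: "poly_mat f X *\<^sub>v v \<in> V" using act_carrier[OF liftsD(1)[OF X] v(1)] .
    have "f \<odot>\<^bsub>G\<^esub> x \<ominus>\<^bsub>G\<^esub> f \<odot>\<^bsub>G\<^esub> lin G n g v \<in> pG" by (rule diff_smult[OF submod_pG v(3,2) gd(2)])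
    moreover have "f \<odot>\<^bsub>G\<^esub> lin G n g v \<ominus>\<^bsub>G\<^esub> lin G n g (poly_mat f X *\<^sub>v v) \<in> pG"
      by (rule diff_sym[OF submod_pG lin_act_cong[OF G submod_pG gd(1) liftsD(1)[OF X] gd(3) v(1)]
            gd(2) gD(2)[OF gd(2)]])
    ultimately have "f \<odot>\<^bsub>G\<^esub> x \<ominus>\<^bsub>G\<^esub> lin G n g (poly_mat f X *\<^sub>v v) \<in> pG"
      by (rule diff_trans[OF submod_pG _ _ gD(2)[OF v(2)] gD(2)[OF gd(2)] gd(2)])
    thus "f \<odot>\<^bsub>G\<^esub> x \<in> ?S" using fv gD(2)[OF v(2)] by blast
  next
    fix x y assume "x \<in> ?S" "y \<in> ?S"
    then obtain v w where v: "v \<in> V" "x \<in> carrier G" "x \<ominus>\<^bsub>G\<^esub> lin G n g v \<in> pG"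
      "w \<in> V" "y \<in> carrier G" "y \<ominus>\<^bsub>G\<^esub> lin G n g w \<in> pG" by blast
    have "(x \<oplus>\<^bsub>G\<^esub> y) \<ominus>\<^bsub>G\<^esub> lin G n g (v + w) \<in> pG"
      unfolding lin_add[OF G gd(1) v(1,4)] by (rule diff_add[OF submod_pG v(3,6) v(2) gd(2) v(5) gd(2)])
    thus "x \<oplus>\<^bsub>G\<^esub> y \<in> ?S" using v(1,2,4,5) by (intro CollectI conjI bexI[of _ "v + w"]) auto
  qed auto
  have "?K \<subseteq> ?S"
  proof (rule gen_subset[OF G S])
    show "pG \<subseteq> ?S"
    proof
      fix x assume x: "x \<in> pG"
      have "lin G n g (0\<^sub>v n) = \<zero>\<^bsub>G\<^esub>"
        using lin_smult[OF G gd(1), of "0\<^sub>v n" 0] gD(7)[OF gd(2)[of "0\<^sub>v n"]] by simp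
      hence "x \<ominus>\<^bsub>G\<^esub> lin G n g (0\<^sub>v n) \<in> pG"
        using submodD(8)[OF submod_pG x submodD(3)[OF submod_pG]] by simp
      thus "x \<in> ?S" using x pG_carrier by (intro CollectI conjI bexI[of _ "0\<^sub>v n"]) auto
    qed
    show "set (map (lin G n g) ys) \<subseteq> ?S"
      using ysV gd(2) diff_self[OF submod_pG gd(2)] by auto
  qed
  hence GS: "carrier G \<subseteq> ?S" using gen by simp
  have "carrier G \<subseteq> ?I"
  proof (rule nakayama[OF submod_carrier[OF G]])
    show "?I \<subseteq> carrier G" using gd(2) by auto
    show "x \<oplus>\<^bsub>G\<^esub> y \<in> ?I" if xy: "x \<in> ?I" "y \<in> ?I" for x y
    proof -
      obtain v w where "v \<in> V" "w \<in> V" "x = lin G n g v" "y = lin G n g w" using xy by blast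
      thus ?thesis using lin_add[OF G gd(1), of v w] by (auto intro!: image_eqI[of _ _ "v + w"])
    qed
    show "[:a:] \<odot>\<^bsub>G\<^esub> x \<in> ?I" if x: "x \<in> ?I" for a x
    proof -
      obtain v where "v \<in> V" "x = lin G n g v" using x by blast
      thus ?thesis using lin_smult[OF G gd(1), of v a] by (auto intro!: image_eqI[of _ _ "a \<cdot>\<^sub>v v"])
    qed
    fix x assume x: "x \<in> carrier G"
    then obtain v where v: "v \<in> V" "x \<ominus>\<^bsub>G\<^esub> lin G n g v \<in> pG" using GS by blast
    then obtain y where y: "y \<in> carrier G" "x \<ominus>\<^bsub>G\<^esub> lin G n g v = [:of_nat p:] \<odot>\<^bsub>G\<^esub> y" by (auto simp: pG_def)
    have "(x \<ominus>\<^bsub>G\<^esub> lin G n g v) \<oplus>\<^bsub>G\<^esub> lin G n g v = x"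
      using x gd(2)[of v] by (simp add: a_minus_def G.a_assoc G.l_neg)
    hence "x = lin G n g v \<oplus>\<^bsub>G\<^esub> (x \<ominus>\<^bsub>G\<^esub> lin G n g v)"
      using G.a_comm[OF G.minus_closed[OF x gd(2)] gd(2)[of v], of v] by simp
    thus "\<exists>i\<in>?I. \<exists>y\<in>carrier G. x = i \<oplus>\<^bsub>G\<^esub> [:of_nat p:] \<odot>\<^bsub>G\<^esub> y" using v(1) y by auto
  qed
  thus "lin G n g ` V = carrier G" using gd(2) by auto
qed

lemma homs_into_pG_iff:
  assumes g: "g \<in> homs_mod_p X"
  shows "set (map (lin G n g) ys) \<subseteq> pG \<longleftrightarrow> g \<in> {..<n} \<rightarrow>\<^sub>E pG"
proof
  note gd = homs_mod_pD[OF g]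
  { assume "set (map (lin G n g) ys) \<subseteq> pG"
    hence "lin G n g v \<in> pG" if "v \<in> V" for v
      using V_subset_vimage[OF g submod_pG subset_refl _ that] by auto
    hence "g j \<in> pG" if "j < n" for j
      using lin_unit[OF G gd(1) that] that by (metis unit_vec_carrier)
    moreover have "g \<in> {..<n} \<rightarrow>\<^sub>E carrier G" using g by (simp add: homs_mod_p_def)
    ultimately show "g \<in> {..<n} \<rightarrow>\<^sub>E pG" by (auto simp: PiE_def) }
  assume "g \<in> {..<n} \<rightarrow>\<^sub>E pG"
  thus "set (map (lin G n g) ys) \<subseteq> pG" using ysV by (auto intro!: lin_mem[OF G submod_pG])
qed

lemma PiE_pG_subset: "{..<n} \<rightarrow>\<^sub>E pG \<subseteq> homs_mod_p X"
proof
  fix g assume g: "g \<in> {..<n} \<rightarrow>\<^sub>E pG"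
  hence g': "\<And>j. j < n \<Longrightarrow> g j \<in> pG" by auto
  have l: "lin G n g v \<in> pG" if "v \<in> V" for v by (rule lin_mem[OF G submod_pG g' that])
  have "g \<in> {..<n} \<rightarrow>\<^sub>E carrier G" using g pG_carrier by (auto simp: PiE_def)
  moreover have "lin G n g (X *\<^sub>v v) \<ominus>\<^bsub>G\<^esub> [:0, 1:] \<odot>\<^bsub>G\<^esub> lin G n g v \<in> pG" if "v \<in> V" for v
    using l that liftsD(1)[OF X] by (intro submodD(8)[OF submod_pG] submodD(6)[OF submod_pG]) auto
  ultimately show "g \<in> homs_mod_p X" by (simp add: homs_mod_p_def)
qed

text \<open>
  The classes of \<open>ys\<close> form an \<open>\<F>\<^sub>q\<close>-basis of \<open>A\<^sup>n/U\<close>, so values in \<open>G/pG\<close> can be prescribed there.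
  Any choice of representatives for the values at the unit vectors then defines a tuple in \<open>G\<^sup>n\<close>.
\<close>

lemma ex_hom_with_values:
  assumes b: "length b = r" "set b \<subseteq> carrier G"
  obtains h where "h \<in> homs_mod_p X" "\<And>i. i < r \<Longrightarrow> lin G n h (ys ! i) \<ominus>\<^bsub>G\<^esub> b ! i \<in> pG"
proof -
  note X' = liftsD(1)[OF X] and simps = mat_module_simps[OF liftsD(1)[OF X]]
  note mm = mat_module[OF X']
  let ?D = "direct_sum (mat_module X) G"
  obtain \<Gamma> where \<Gamma>: "submod \<Gamma> ?D" "U \<times> pG \<subseteq> \<Gamma>" "\<Gamma> \<subseteq> carrier (mat_module X) \<times> carrier G"
    "fst ` \<Gamma> = carrier (mat_module X)" "\<And>z. (\<zero>\<^bsub>mat_module X\<^esub>, z) \<in> \<Gamma> \<Longrightarrow> z \<in> pG"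
    "\<And>i. i < length ys \<Longrightarrow> (ys ! i, b ! i) \<in> \<Gamma>"
  proof (rule ex_linear_relation[OF G mm _ submod_U[OF X] submod_pG submod_carrier[OF G] pG_carrier ind])
    show "finite (carrier (mat_module X))" by (simp add: simps finite_V)
    show "length b = length ys" using b len by simp
    show "\<And>y j. y \<in> carrier (mat_module X) \<Longrightarrow> j \<in> J \<Longrightarrow> j \<odot>\<^bsub>mat_module X\<^esub> y \<in> U"
      using J_U[OF X] by (simp add: simps)
    show "\<And>g j. g \<in> set b \<Longrightarrow> j \<in> J \<Longrightarrow> j \<odot>\<^bsub>G\<^esub> g \<in> pG" using J_pG b by blast
  qed (use b that in blast)+
  note GD = submodD[OF \<Gamma>(1)]
  have "\<forall>j. \<exists>x. j < n \<longrightarrow> (unit_vec n j, x) \<in> \<Gamma>"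
  proof (intro allI)
    fix j
    have "unit_vec n j \<in> fst ` \<Gamma>" unfolding \<Gamma>(4) by (simp add: simps)
    thus "\<exists>x. j < n \<longrightarrow> (unit_vec n j, x) \<in> \<Gamma>" by force
  qed
  then obtain h0 where h0: "\<And>j. j < n \<Longrightarrow> (unit_vec n j, h0 j) \<in> \<Gamma>" by metis
  define h where "h = restrict h0 {..<n}"
  have hc: "h \<in> {..<n} \<rightarrow>\<^sub>E carrier G" using h0 \<Gamma>(3) by (auto simp: h_def)
  hence hc': "h \<in> {..<n} \<rightarrow> carrier G" by auto
  note cl = lin_closed[OF G hc']
  have lin\<Gamma>: "(v, lin G n h v) \<in> \<Gamma>" if v: "v \<in> V" for v
  proof -
    have "v \<in> {v \<in> V. (v, lin G n h v) \<in> \<Gamma>}"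
    proof (rule vec_span_induct[OF _ _ _ _ v])
      have sm: "(a \<cdot>\<^sub>v v, lin G n h (a \<cdot>\<^sub>v v)) \<in> \<Gamma>" if "v \<in> V" "(v, lin G n h v) \<in> \<Gamma>" for a v
        using GD(6)[OF that(2), of "[:a:]"] lin_smult[OF G hc' that(1)] act_const[OF X' that(1)]
        by (simp add: direct_sum_def simps)
      show "a \<cdot>\<^sub>v v \<in> {v \<in> V. (v, lin G n h v) \<in> \<Gamma>}" if "v \<in> {v \<in> V. (v, lin G n h v) \<in> \<Gamma>}" for a v
        using that sm by simp
      have "lin G n h (0\<^sub>v n) = \<zero>\<^bsub>G\<^esub>"
        using lin_smult[OF G hc', of "0\<^sub>v n" 0] gD(7)[OF cl[of "0\<^sub>v n"]] by simp
      thus "0\<^sub>v n \<in> {v \<in> V. (v, lin G n h v) \<in> \<Gamma>}" using GD(3) by (simp add: direct_sum_def simps)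
      show "v + w \<in> {v \<in> V. (v, lin G n h v) \<in> \<Gamma>}"
        if "v \<in> {v \<in> V. (v, lin G n h v) \<in> \<Gamma>}" "w \<in> {v \<in> V. (v, lin G n h v) \<in> \<Gamma>}" for v w
        using that GD(5)[of "(v, lin G n h v)" "(w, lin G n h w)"]
        by (simp add: direct_sum_def simps lin_add[OF G hc'])
      show "unit_vec n j \<in> {v \<in> V. (v, lin G n h v) \<in> \<Gamma>}" if "j < n" for j
        using h0[OF that] lin_unit[OF G hc' that] that by (simp add: h_def)
    qed
    thus ?thesis by simp
  qed
  have funct: "z \<ominus>\<^bsub>G\<^esub> z' \<in> pG" if "(x, z) \<in> \<Gamma>" "(x, z') \<in> \<Gamma>" for x z z'
    by (rule relation_functional[OF \<Gamma>(1) mm G \<Gamma>(5) that])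
  show ?thesis
  proof
    have "lin G n h (X *\<^sub>v v) \<ominus>\<^bsub>G\<^esub> [:0, 1:] \<odot>\<^bsub>G\<^esub> lin G n h v \<in> pG" if v: "v \<in> V" for v
    proof (rule funct)
      show "(X *\<^sub>v v, lin G n h (X *\<^sub>v v)) \<in> \<Gamma>" using lin\<Gamma> v X' by auto
      show "(X *\<^sub>v v, [:0, 1:] \<odot>\<^bsub>G\<^esub> lin G n h v) \<in> \<Gamma>"
        using GD(6)[OF lin\<Gamma>[OF v], of "[:0, 1:]"] act_X[OF X' v] by (simp add: direct_sum_def simps)
    qed
    thus "h \<in> homs_mod_p X" using hc by (simp add: homs_mod_p_def)
    show "lin G n h (ys ! i) \<ominus>\<^bsub>G\<^esub> b ! i \<in> pG" if i: "i < r" for i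
    proof -
      have "ys ! i \<in> V" using i len ysV nth_mem[of i ys] by auto
      thus ?thesis using i len by (intro funct[OF lin\<Gamma> \<Gamma>(6)]) simp_all
    qed
  qed
qed

lemma translation_of_homs:
  assumes h: "h \<in> homs_mod_p X"
  shows "bij_betw (\<lambda>g. restrict (\<lambda>j. g j \<oplus>\<^bsub>G\<^esub> h j) {..<n}) (homs_mod_p X) (homs_mod_p X)"
proof -
  let ?t = "\<lambda>g. restrict (\<lambda>j. g j \<oplus>\<^bsub>G\<^esub> h j) {..<n}"
  note hd = homs_mod_pD[OF h]
  have "?t ` homs_mod_p X \<subseteq> homs_mod_p X"
  proof (rule image_subsetI)
    fix g assume g: "g \<in> homs_mod_p X"
    note gd = homs_mod_pD[OF g]
    have "?t g \<in> {..<n} \<rightarrow>\<^sub>E carrier G" using gd(1) hd(1) by auto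
    moreover have "lin G n (?t g) (X *\<^sub>v v) \<ominus>\<^bsub>G\<^esub> [:0, 1:] \<odot>\<^bsub>G\<^esub> lin G n (?t g) v \<in> pG" if v: "v \<in> V" for v
      unfolding lin_zip_add[OF G gd(1) hd(1)] gD(4)[OF gd(2) hd(2)]
      by (intro diff_add[OF submod_pG] gd(3) hd(3) v gd(2) hd(2) gD(2))
    ultimately show "?t g \<in> homs_mod_p X" by (simp add: homs_mod_p_def)
  qed
  moreover have "inj_on ?t (homs_mod_p X)"
  proof (rule inj_onI, rule ext)
    fix g g' j assume g: "g \<in> homs_mod_p X" "g' \<in> homs_mod_p X" and e: "?t g = ?t g'"
    have ge: "g \<in> {..<n} \<rightarrow>\<^sub>E carrier G" "g' \<in> {..<n} \<rightarrow>\<^sub>E carrier G" using g by (auto simp: homs_mod_p_def)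
    show "g j = g' j"
    proof (cases "j < n")
      case True
      have "g j \<oplus>\<^bsub>G\<^esub> h j = g' j \<oplus>\<^bsub>G\<^esub> h j" using fun_cong[OF e, of j] True by simp
      moreover have "g j \<in> carrier G" "g' j \<in> carrier G" "h j \<in> carrier G" using ge hd(1) True by auto
      ultimately show ?thesis by simp
    next
      case False
      thus ?thesis using PiE_arb[OF ge(1), of j] PiE_arb[OF ge(2), of j] by simp
    qed
  qed
  ultimately show ?thesis using endo_inj_surj[OF finite_homs_mod_p] by (auto simp: bij_betw_def)
qed

text \<open>
  Adding a homomorphism with the values \<open>b\<close> at \<open>ys\<close> translates the list of values by \<open>b\<close>.
\<close>

lemma homs_evaluation_uniform:
  assumes stable: "\<And>b c. length b = r \<Longrightarrow> length c = r \<Longrightarrow> set b \<subseteq> carrier G \<Longrightarrow> set c \<subseteq> carrier G \<Longrightarrow>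
        (\<And>i. i < r \<Longrightarrow> b ! i \<ominus>\<^bsub>G\<^esub> c ! i \<in> pG) \<Longrightarrow> b \<in> Z \<longleftrightarrow> c \<in> Z"
    and Z: "\<And>b. b \<in> Z \<Longrightarrow> length b = r \<and> set b \<subseteq> carrier G"
  shows "card (carrier G) ^ r * card {g \<in> homs_mod_p X. map (lin G n g) ys \<in> Z} = card (homs_mod_p X) * card Z"
proof (rule uniform_evaluation[where H = pG and M = G])
  show "abelian_group G" by (rule gD(1))
  show "finite (homs_mod_p X)" by (rule finite_homs_mod_p)
  show "length (map (lin G n g) ys) = r \<and> set (map (lin G n g) ys) \<subseteq> carrier G" if "g \<in> homs_mod_p X" for g
    using len homs_mod_pD(2)[OF that] by auto
  fix b assume b: "length b = r" "set b \<subseteq> carrier G"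
  obtain h where h: "h \<in> homs_mod_p X" "\<And>i. i < r \<Longrightarrow> lin G n h (ys ! i) \<ominus>\<^bsub>G\<^esub> b ! i \<in> pG"
    by (rule ex_hom_with_values[OF b]) blast
  note hd = homs_mod_pD[OF h(1)]
  let ?t = "\<lambda>g. restrict (\<lambda>j. g j \<oplus>\<^bsub>G\<^esub> h j) {..<n}"
  show "\<exists>\<tau>. bij_betw \<tau> (homs_mod_p X) (homs_mod_p X) \<and> (\<forall>g\<in>homs_mod_p X. \<forall>i<r.
      map (lin G n (\<tau> g)) ys ! i \<ominus>\<^bsub>G\<^esub> (map (lin G n g) ys ! i \<oplus>\<^bsub>G\<^esub> b ! i) \<in> pG)"
  proof (intro exI[of _ ?t] conjI ballI allI impI)
    show "bij_betw ?t (homs_mod_p X) (homs_mod_p X)" by (rule translation_of_homs[OF h(1)])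
    fix g i assume g: "g \<in> homs_mod_p X" and i: "i < r"
    note gd = homs_mod_pD[OF g]
    have bi: "b ! i \<in> carrier G" using b i nth_mem by blast
    have "(lin G n g (ys ! i) \<oplus>\<^bsub>G\<^esub> lin G n h (ys ! i)) \<ominus>\<^bsub>G\<^esub> (lin G n g (ys ! i) \<oplus>\<^bsub>G\<^esub> b ! i) \<in> pG"
      by (intro diff_add[OF submod_pG] diff_self[OF submod_pG] h(2) i gd(2) hd(2) bi)
    thus "map (lin G n (?t g)) ys ! i \<ominus>\<^bsub>G\<^esub> (map (lin G n g) ys ! i \<oplus>\<^bsub>G\<^esub> b ! i) \<in> pG"
      using i len by (simp add: lin_zip_add[OF G gd(1) hd(1)])
  qed
next
  show "\<And>x y. x \<in> carrier G \<Longrightarrow> y \<in> carrier G \<Longrightarrow> x \<oplus>\<^bsub>G\<^esub> y \<in> carrier G" by (rule G.a_closed)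
  show "\<And>x. x \<in> carrier G \<Longrightarrow> \<ominus>\<^bsub>G\<^esub> x \<in> carrier G" by (rule G.a_inv_closed)
  show "carrier G \<subseteq> carrier G" by (rule subset_refl)
  show "finite (carrier G)" by (rule finG)
  show "\<And>b. b \<in> Z \<Longrightarrow> length b = r \<and> set b \<subseteq> carrier G" by (rule Z)
  fix b c :: "'g list"
  assume "length b = r" "length c = r" "set b \<subseteq> carrier G" "set c \<subseteq> carrier G"
    "\<And>i. i < r \<Longrightarrow> b ! i \<ominus>\<^bsub>G\<^esub> c ! i \<in> pG"
  thus "b \<in> Z \<longleftrightarrow> c \<in> Z" by (rule stable)
qed

text \<open>
  Equidistribution is applied to two sets of lists.  The lists that generate \<open>G\<close> modulo \<open>pG\<close> belong
  to the surjective maps, and the lists in \<open>pG\<close> to the arbitrary tuples in \<open>pG\<close>, of which there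
  are \<open>|pG|\<^sup>n\<close>.  The unknown number of all homomorphisms cancels.
\<close>

lemma card_surjective_homs_aux:
  "real (card {g \<in> homs_mod_p X. lin G n g ` V = carrier G})
    = real (card pG) ^ n * (\<Prod>i<r. real q ^ r - real q ^ i)"
proof -
  let ?Z1 = "{b. length b = r \<and> set b \<subseteq> carrier G \<and> gen G pG b = carrier G}"
  let ?Z2 = "{b. length b = r \<and> set b \<subseteq> pG}"
  have finpG: "finite pG" using finG pG_carrier finite_subset by blast
  have 1: "card (carrier G) ^ r * card {g \<in> homs_mod_p X. map (lin G n g) ys \<in> ?Z1} = card (homs_mod_p X) * card ?Z1"
  proof (rule homs_evaluation_uniform)
    fix b c :: "'g list" assume bc: "length b = r" "length c = r" "set b \<subseteq> carrier G" "set c \<subseteq> carrier G"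
      "\<And>i. i < r \<Longrightarrow> b ! i \<ominus>\<^bsub>G\<^esub> c ! i \<in> pG"
    have "gen G pG b = gen G pG c" using bc by (intro gen_cong[OF submod_pG]) auto
    thus "b \<in> ?Z1 \<longleftrightarrow> c \<in> ?Z1" using bc by simp
  qed auto
  have 2: "card (carrier G) ^ r * card {g \<in> homs_mod_p X. map (lin G n g) ys \<in> ?Z2} = card (homs_mod_p X) * card ?Z2"
  proof (rule homs_evaluation_uniform)
    have *: "set c \<subseteq> pG" if bc: "length b = r" "length c = r" "set b \<subseteq> pG" "set c \<subseteq> carrier G"
      "\<And>i. i < r \<Longrightarrow> c ! i \<ominus>\<^bsub>G\<^esub> b ! i \<in> pG" for b c
    proof
      fix x assume "x \<in> set c"
      then obtain i where i: "i < r" "x = c ! i" using bc(2) by (auto simp: in_set_conv_nth)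
      have "b ! i \<in> set b" "c ! i \<in> set c" using bc(1,2) i(1) by simp_all
      hence "b ! i \<in> pG" "c ! i \<in> carrier G" using bc(3,4) by blast+
      thus "x \<in> pG" unfolding i(2) by (intro diff_mem[OF submod_pG bc(5)[OF i(1)] _ submod_pG subset_refl])
    qed
    fix b c :: "'g list" assume bc: "length b = r" "length c = r" "set b \<subseteq> carrier G" "set c \<subseteq> carrier G"
      "\<And>i. i < r \<Longrightarrow> b ! i \<ominus>\<^bsub>G\<^esub> c ! i \<in> pG"
    have "c ! i \<ominus>\<^bsub>G\<^esub> b ! i \<in> pG" if i: "i < r" for i
    proof -
      have "b ! i \<in> set b" "c ! i \<in> set c" using bc(1,2) i by simp_all
      hence "b ! i \<in> carrier G" "c ! i \<in> carrier G" using bc(3,4) by blast+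
      thus ?thesis by (rule diff_sym[OF submod_pG bc(5)[OF i]])
    qed
    thus "b \<in> ?Z2 \<longleftrightarrow> c \<in> ?Z2" using *[of b c] *[of c b] bc by auto
  qed (use pG_carrier in auto)
  have "{g \<in> homs_mod_p X. map (lin G n g) ys \<in> ?Z2} = {..<n} \<rightarrow>\<^sub>E pG"
    using homs_into_pG_iff PiE_pG_subset len by auto
  hence c2: "card {g \<in> homs_mod_p X. map (lin G n g) ys \<in> ?Z2} = card pG ^ n" by (simp add: card_PiE)
  have c1: "{g \<in> homs_mod_p X. map (lin G n g) ys \<in> ?Z1} = {g \<in> homs_mod_p X. lin G n g ` V = carrier G}"
    using surj_iff_gen len homs_mod_pD(2) by auto
  have cZ2: "card ?Z2 = card pG ^ r" using card_lists_length_eq[OF finpG, of r] by (simp add: conj_commute)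
  have cZ1: "real (card ?Z1) = real (card pG) ^ r * (\<Prod>i<r. real q ^ r - real q ^ i)"
    by (rule card_generating_lists[OF submod_pG submod_carrier[OF G] pG_carrier finG J_pG card_G'])
  have pos: "card pG > 0" "card (carrier G) > 0"
    using submodD(3)[OF submod_pG] finpG finG by (auto simp: card_gt_0_iff)
  define S where "S = real (card {g \<in> homs_mod_p X. lin G n g ` V = carrier G})"
  let ?c = "real (card (carrier G))" and ?g = "real (card pG)" and ?h = "real (card (homs_mod_p X))"
    and ?b = "\<Prod>i<r. real q ^ r - real q ^ i"
  have "real (card (carrier G) ^ r * card {g \<in> homs_mod_p X. map (lin G n g) ys \<in> ?Z1}) = real (card (homs_mod_p X) * card ?Z1)"
    using 1 by presburger
  hence e1: "?c ^ r * S = ?h * (?g ^ r * ?b)" unfolding c1 S_def of_nat_mult cZ1 by simp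
  have "real (card (carrier G) ^ r * card {g \<in> homs_mod_p X. map (lin G n g) ys \<in> ?Z2}) = real (card (homs_mod_p X) * card ?Z2)"
    using 2 by presburger
  hence e2: "?c ^ r * ?g ^ n = ?h * ?g ^ r" unfolding c2 cZ2 by simp
  have "?c ^ r * S = ?c ^ r * (?g ^ n * ?b)" using e1 e2 by (simp add: mult.assoc[symmetric])
  thus ?thesis using pos unfolding S_def by simp
qed

end

lemma card_surjective_homs:
  assumes "X \<in> lifts"
  shows "real (card {g \<in> homs_mod_p X. lin G n g ` V = carrier G})
    = real (card pG) ^ n * (\<Prod>i<r. real q ^ r - real q ^ i)"
proof -
  obtain ys where ys: "indep (mat_module X) U ys" "gen (mat_module X) U ys = V" "length ys = r" "set ys \<subseteq> V"
    using ex_basis_mod_U[OF assms] .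
  show ?thesis by (rule card_surjective_homs_aux[OF assms ys])
qed

end

section \<open>Independence of the powers of a matrix\<close>

lemma zip_concat_map:
  "length vs = length bs \<Longrightarrow>
    zip (concat (map (\<lambda>v. map (f v) xs) vs)) (concat (map (\<lambda>b. map (h b) xs) bs))
    = concat (map (\<lambda>(v, b). map (\<lambda>c. (f v c, h b c)) xs) (zip vs bs))"
  by (induction vs bs rule: list_induct2) (auto simp: zip_append zip_map_map map2_map_map zip_same_conv_map)

lemma poly_truncated_induct:
  fixes f :: "'a::comm_ring_1 poly"
  assumes "0 \<in> S" and add: "\<And>f g. f \<in> S \<Longrightarrow> g \<in> S \<Longrightarrow> f + g \<in> S"
    and mon: "\<And>a c. c < m \<Longrightarrow> Polynomial.smult a (monom 1 c) \<in> S"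
    and f: "\<And>i. i \<ge> m \<Longrightarrow> coeff f i = 0"
  shows "f \<in> S"
  using mon f
proof (induction m arbitrary: f)
  case 0
  hence "f = 0" by (auto simp: poly_eq_iff)
  thus ?case using assms(1) by simp
next
  case (Suc m)
  have "f - Polynomial.smult (coeff f m) (monom 1 m) \<in> S"
  proof (rule Suc.IH)
    fix i assume "m \<le> i"
    thus "coeff (f - Polynomial.smult (coeff f m) (monom 1 m)) i = 0"
      using Suc.prems(2)[of i] by (cases "i = m") auto
  qed (use Suc.prems in auto)
  from add[OF this Suc.prems(1)[of m "coeff f m"]] show ?case by simp
qed

lemma cring_module_vec: "cring_module (module_vec TYPE('a::comm_ring_1) n)"
proof (rule moduleI)
  show "cring (class_ring :: 'a ring)" by (rule class_cring.cring_axioms)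
  show "abelian_group (module_vec TYPE('a) n)"
  proof (rule abelian_groupI, unfold module_vec_simps)
    fix v :: "'a vec" assume v: "v \<in> carrier_vec n"
    show "\<exists>w\<in>carrier_vec n. w + v = 0\<^sub>v n" using v by (intro bexI[of _ "- v"]) auto
  qed auto
qed (auto simp: module_vec_simps add_smult_distrib_vec smult_add_distrib_vec smult_smult_assoc intro!: eq_vecI)

lemma mat_eq_unitI:
  fixes X Y :: "'a::comm_ring_1 mat"
  assumes X: "X \<in> carrier_mat n n" and Y: "Y \<in> carrier_mat n n"
    and e: "\<And>j. j < n \<Longrightarrow> X *\<^sub>v unit_vec n j = Y *\<^sub>v unit_vec n j"
  shows "X = Y"
proof (rule eq_matI)
  fix i j assume "i < dim_row Y" "j < dim_col Y"
  hence ij: "i < n" "j < n" using Y by auto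
  have "(X *\<^sub>v unit_vec n j) $ i = (Y *\<^sub>v unit_vec n j) $ i" using e ij by simp
  thus "X $$ (i, j) = Y $$ (i, j)" using X Y ij by (auto simp: scalar_prod_right_unit)
qed (use X Y in auto)

lemma submod_mat_vec:
  fixes X :: "'a::comm_ring_1 mat"
  assumes X: "X \<in> carrier_mat n n" and L: "submod L (mat_module X)"
  shows "submod L (module_vec TYPE('a) n)"
  using submod_matD[OF X L] by (intro submodI[OF cring_module_vec]) (auto simp: module_vec_simps)

lemma act_monom_Suc:
  fixes X :: "'a::comm_ring_1 mat"
  assumes X: "X \<in> carrier_mat n n" and v: "v \<in> carrier_vec n"
  shows "poly_mat (monom 1 (Suc c)) X *\<^sub>v v = X *\<^sub>v (poly_mat (monom 1 c) X *\<^sub>v v)"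
proof -
  have Xv: "X *\<^sub>v v \<in> carrier_vec n" using X v by auto
  show ?thesis unfolding monom_Suc act_pCons[OF X v] act_commute[OF X v]
    using v act_carrier[OF X Xv, of "monom 1 c"] by simp
qed

lemma act_monom_0:
  fixes X :: "'a::comm_ring_1 mat"
  assumes X: "X \<in> carrier_mat n n" and v: "v \<in> carrier_vec n"
  shows "poly_mat (monom 1 0) X *\<^sub>v v = v"
  using act_one[OF X v] by (simp add: monom_0 one_pCons)

context monic_lift
begin

text \<open>
  A relation would be a monic polynomial of degree less than \<open>d\<close> that maps \<open>v\<close> into \<open>L\<close>; it is not
  in \<open>J\<close>, as its reduction is not divisible by \<open>Q\<close>.
\<close>

lemma powers_indep_mod:
  fixes X :: "'a mod_ring mat"
  assumes X: "X \<in> carrier_mat n n" and L: "submod L (mat_module X)" and v: "v \<in> carrier_vec n" "v \<notin> L"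
    and J: "\<And>j. j \<in> J \<Longrightarrow> poly_mat j X *\<^sub>v v \<in> L" and m: "m \<le> d"
  shows "indep (module_vec TYPE('a mod_ring) n) L (map (\<lambda>c. poly_mat (monom 1 c) X *\<^sub>v v) [0..<m])"
  using m
proof (induction m)
  case (Suc m)
  let ?M = "module_vec TYPE('a mod_ring) n"
  let ?pw = "\<lambda>c. poly_mat (monom 1 c) X *\<^sub>v v"
  note LD = submod_matD[OF X L] and M = cring_module_vec[of n, where 'a = "'a mod_ring"]
  note L' = submod_mat_vec[OF X L]
  have pwc: "?pw c \<in> carrier_vec n" for c using act_carrier[OF X v(1)] .
  have "?pw m \<notin> gen ?M L (map ?pw [0..<m])"
  proof
    assume in_gen: "?pw m \<in> gen ?M L (map ?pw [0..<m])"
    let ?B = "{l + poly_mat f X *\<^sub>v v | l f. l \<in> L \<and> (\<forall>i\<ge>m. coeff f i = 0)}"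
    have B: "submod ?B ?M"
    proof (rule submodI[OF M], unfold module_vec_simps)
      show "?B \<subseteq> carrier_vec n" using LD(3) act_carrier[OF X v(1)] by auto
      have "0\<^sub>v n = 0\<^sub>v n + poly_mat 0 X *\<^sub>v v" using act_0[OF X v(1)] by simp
      thus "0\<^sub>v n \<in> ?B" using LD(2) by force
      fix x y assume "x \<in> ?B" "y \<in> ?B"
      then obtain l f l' f' where x: "x = l + poly_mat f X *\<^sub>v v" "l \<in> L" "\<forall>i\<ge>m. coeff f i = 0"
        and y: "y = l' + poly_mat f' X *\<^sub>v v" "l' \<in> L" "\<forall>i\<ge>m. coeff f' i = 0" by blast
      have "x + y = (l + l') + poly_mat (f + f') X *\<^sub>v v"
        unfolding x(1) y(1) act_add_poly[OF X v(1)]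
        using LD(3)[OF x(2)] LD(3)[OF y(2)] act_carrier[OF X v(1), of f] act_carrier[OF X v(1), of f']
        by (intro eq_vecI) auto
      moreover have "\<forall>i\<ge>m. coeff (f + f') i = 0" using x(3) y(3) by simp
      ultimately show "x + y \<in> ?B" using LD(4)[OF x(2) y(2)] by blast
    next
      fix x a assume "x \<in> ?B"
      then obtain l f where x: "x = l + poly_mat f X *\<^sub>v v" "l \<in> L" "\<forall>i\<ge>m. coeff f i = 0" by blast
      have "a \<cdot>\<^sub>v x = a \<cdot>\<^sub>v l + poly_mat (Polynomial.smult a f) X *\<^sub>v v"
        unfolding x(1) act_smult[OF X v(1)]
        using LD(3)[OF x(2)] act_carrier[OF X v(1), of f] by (simp add: smult_add_distrib_vec[of _ n])
      moreover have "\<forall>i\<ge>m. coeff (Polynomial.smult a f) i = 0" using x(3) by simp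
      ultimately show "a \<cdot>\<^sub>v x \<in> ?B" using LD(5)[OF x(2)] by blast
    qed
    have "gen ?M L (map ?pw [0..<m]) \<subseteq> ?B"
    proof (rule gen_subset[OF M B])
      show "L \<subseteq> ?B"
      proof
        fix l assume l: "l \<in> L"
        have "l = l + poly_mat 0 X *\<^sub>v v" using act_0[OF X v(1)] LD(3)[OF l] by simp
        thus "l \<in> ?B" using l by force
      qed
      show "set (map ?pw [0..<m]) \<subseteq> ?B"
      proof clarsimp
        fix c assume "c < m"
        moreover have "?pw c = 0\<^sub>v n + ?pw c" using pwc[of c] by simp
        ultimately show "\<exists>l f. ?pw c = l + poly_mat f X *\<^sub>v v \<and> l \<in> L \<and> (\<forall>i\<ge>m. coeff f i = 0)"
          using LD(2) by (intro exI[of _ "0\<^sub>v n"] exI[of _ "monom 1 c"]) auto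
      qed
    qed
    then obtain l f where lf: "?pw m = l + poly_mat f X *\<^sub>v v" "l \<in> L" "\<forall>i\<ge>m. coeff f i = 0" using in_gen by blast
    have fc: "poly_mat f X *\<^sub>v v \<in> carrier_vec n" "poly_mat (- f) X *\<^sub>v v = - (poly_mat f X *\<^sub>v v)"
      using act_carrier[OF X v(1), of f] act_smult[OF X v(1), of "-1" f] by (auto intro!: eq_vecI)
    have "poly_mat (monom 1 m + (- f)) X *\<^sub>v v = l"
      unfolding act_add_poly[OF X v(1)] lf(1) fc(2) using fc(1) LD(3)[OF lf(2)] by (intro eq_vecI) auto
    hence in_L: "poly_mat (monom 1 m - f) X *\<^sub>v v \<in> L" using lf(2) by simp
    have "monom 1 m - f \<notin> J"
    proof
      assume "monom 1 m - f \<in> J"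
      hence dvd: "Q dvd map_poly red (monom 1 m - f)" by (simp add: J_def)
      have cm: "coeff (map_poly red (monom 1 m - f)) m = 1" using lf(3) by (simp add: coeff_map_poly)
      hence nz: "map_poly red (monom 1 m - f) \<noteq> 0" by (metis coeff_0 zero_neq_one)
      have "degree (map_poly red (monom 1 m - f)) \<le> m"
        using lf(3) by (intro degree_le) (auto simp: coeff_map_poly)
      moreover have "d \<le> degree (map_poly red (monom 1 m - f))"
        using dvd_imp_degree_le[OF dvd nz] degree_Q by simp
      ultimately show False using Suc.prems by simp
    qed
    from smult_mem_imp_mem[OF L _ _ this] J in_L v show False by (simp add: mat_module_simps[OF X])
  qed
  thus ?case using Suc pwc by (simp add: indep_append module_vec_simps)
qed auto

text \<open>
  Since \<open>1, t, \<dots>, t\<^sup>d\<^sup>-\<^sup>1\<close> is a basis of \<open>\<F>\<^sub>q\<close> over \<open>\<F>\<^sub>p\<close>, independence over \<open>\<F>\<^sub>q\<close> turns into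
  independence over \<open>\<F>\<^sub>p\<close> of \<open>d\<close> times as many vectors.
\<close>

lemma powers_indep:
  fixes X :: "'a mod_ring mat"
  assumes X: "X \<in> carrier_mat n n" and L: "submod L (mat_module X)" and ind: "indep (mat_module X) L vs"
    and J: "\<And>j v. v \<in> set vs \<Longrightarrow> j \<in> J \<Longrightarrow> poly_mat j X *\<^sub>v v \<in> L"
  shows "indep (module_vec TYPE('a mod_ring) n) L
    (concat (map (\<lambda>v. map (\<lambda>c. poly_mat (monom 1 c) X *\<^sub>v v) [0..<d]) vs))"
  using L ind J
proof (induction vs arbitrary: L)
  case (Cons v vs)
  let ?M = "module_vec TYPE('a mod_ring) n"
  let ?pws = "map (\<lambda>c. poly_mat (monom 1 c) X *\<^sub>v v) [0..<d]"
  interpret sc: residue_system "{a. red a = 0}" "range lft" by (rule residue_scalars)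
  note mm = mat_module[OF X] and M = cring_module_vec[of n, where 'a = "'a mod_ring"]
  note simps = mat_module_simps[OF X] and LD = submod_matD[OF X Cons.prems(1)]
  note L' = submod_mat_vec[OF X Cons.prems(1)]
  have v: "v \<in> carrier_vec n" "v \<notin> L" using Cons.prems(2) by (auto simp: simps)
  note ad = submod_adjoin[OF mm Cons.prems(1), of v]
  have adj: "submod (adjoin (mat_module X) L v) (mat_module X)" using ad v by (simp add: simps)
  have sup: "L \<subseteq> adjoin (mat_module X) L v" using adjoin_superset[OF mm Cons.prems(1)] v by (simp add: simps)
  have ind1: "indep ?M L ?pws"
    using Cons.prems(3) by (intro powers_indep_mod[OF X Cons.prems(1) v]) auto
  have "gen ?M L ?pws = adjoin (mat_module X) L v"
  proof (rule card_subset_eq)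
    show "finite (adjoin (mat_module X) L v)"
      using submodD(2)[OF adj] finite_subset[OF _ finite_V[of n]] by (simp add: simps)
    have "poly_mat (monom 1 c) X *\<^sub>v v \<in> adjoin (mat_module X) L v" for c
      using submod_matD(7)[OF X adj] mem_adjoin[OF mm Cons.prems(1), of v] v by (simp add: simps)
    thus "gen ?M L ?pws \<subseteq> adjoin (mat_module X) L v"
      using sup by (intro gen_subset[OF M submod_mat_vec[OF X adj]]) auto
    have "card (gen ?M L ?pws) = card (range lft) ^ length ?pws * card L"
    proof (rule sc.card_gen[OF ind1 L'])
      show "finite (carrier ?M)" by (simp add: module_vec_simps finite_V)
      fix y a assume y: "y \<in> set ?pws" and a: "a \<in> {a. red a = 0}"
      obtain c where c: "y = poly_mat (monom 1 c) X *\<^sub>v v" using y by auto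
      obtain b where b: "a = of_nat p * b" using a red_eq_0_iff by auto
      have "monom b c * [:of_nat p:] \<in> J" using J_mult p_in_J by blast
      hence "poly_mat (monom b c * [:of_nat p:]) X *\<^sub>v v \<in> L" using Cons.prems(3)[of v] by simp
      also have "monom b c * [:of_nat p:] = Polynomial.smult a (monom 1 c)"
        by (simp add: b smult_monom mult.commute)
      finally show "a \<odot>\<^bsub>?M\<^esub> y \<in> L" unfolding act_smult[OF X v(1)] c by (simp add: module_vec_simps)
    qed
    also have "\<dots> = q * card L" by (simp add: card_residue_scalars card_T)
    also have "\<dots> = card (adjoin (mat_module X) L v)"
      using Cons.prems v finite_V[of n] by (intro card_adjoin[symmetric]) (auto simp: simps)
    finally show "card (gen ?M L ?pws) = card (adjoin (mat_module X) L v)" .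
  qed
  moreover have "indep ?M (adjoin (mat_module X) L v)
      (concat (map (\<lambda>v. map (\<lambda>c. poly_mat (monom 1 c) X *\<^sub>v v) [0..<d]) vs))"
    using Cons.prems sup by (intro Cons.IH adj) auto
  ultimately show ?case using ind1 by (simp add: indep_append)
qed auto

end

section \<open>The lifts that commute with a surjection\<close>

context
  fixes X :: "'a::comm_ring_1 mat" and n :: nat and L :: "'a vec set"
  assumes X: "X \<in> carrier_mat n n" and L: "submod L (mat_module X)"
begin

private lemmas LD = submod_matD[OF X L]

lemma vec_diff_trans:
  assumes "x - y \<in> L" "y - z \<in> L" "x \<in> carrier_vec n" "y \<in> carrier_vec n" "z \<in> carrier_vec n"
  shows "x - z \<in> L"
proof -
  have "(x - y) + (y - z) = x - z" using assms(3-) by (intro eq_vecI) auto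
  thus ?thesis using LD(4)[OF assms(1,2)] by simp
qed

lemma vec_diff_add:
  assumes "x - y \<in> L" "x' - y' \<in> L" "x \<in> carrier_vec n" "y \<in> carrier_vec n" "x' \<in> carrier_vec n" "y' \<in> carrier_vec n"
  shows "(x + x') - (y + y') \<in> L"
proof -
  have "(x - y) + (x' - y') = (x + x') - (y + y')" using assms(3-) by (intro eq_vecI) auto
  thus ?thesis using LD(4)[OF assms(1,2)] by simp
qed

lemma vec_diff_smult:
  assumes "x - y \<in> L" "x \<in> carrier_vec n" "y \<in> carrier_vec n" shows "a \<cdot>\<^sub>v x - a \<cdot>\<^sub>v y \<in> L"
proof -
  have "a \<cdot>\<^sub>v (x - y) = a \<cdot>\<^sub>v x - a \<cdot>\<^sub>v y" using assms(2-) by (intro eq_vecI) (auto simp: algebra_simps)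
  thus ?thesis using LD(5)[OF assms(1), of a] by simp
qed

lemma vec_diff_mult:
  assumes "x - y \<in> L" "x \<in> carrier_vec n" "y \<in> carrier_vec n" shows "X *\<^sub>v x - X *\<^sub>v y \<in> L"
  using LD(6)[OF assms(1)] mult_minus_distrib_mat_vec[OF X assms(2,3)] by simp

lemma vec_diff_mem: "x - y \<in> L \<Longrightarrow> y \<in> L \<Longrightarrow> x \<in> carrier_vec n \<Longrightarrow> x \<in> L"
proof -
  assume a: "x - y \<in> L" "y \<in> L" "x \<in> carrier_vec n"
  have "(x - y) + y = x" using a(3) LD(3)[OF a(2)] by (intro eq_vecI) auto
  thus "x \<in> L" using LD(4)[OF a(1,2)] by simp
qed

lemma vec_diff_self: "x \<in> carrier_vec n \<Longrightarrow> x - x \<in> L"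
  using LD(2) by simp

end

lemma lin_minus:
  assumes G: "cring_module G" and g: "g \<in> {..<n} \<rightarrow> carrier G"
    and v: "v \<in> carrier_vec n" "w \<in> carrier_vec n"
  shows "lin G n g (v - w) = lin G n g v \<ominus>\<^bsub>G\<^esub> lin G n g w"
proof -
  note gD = cring_moduleD[OF G]
  have "v - w = v + (- 1) \<cdot>\<^sub>v w" using v by (intro eq_vecI) auto
  moreover have "[:- 1:] = - (1 :: 'a poly)" by (simp add: one_pCons)
  ultimately show ?thesis using v gD(6,9)[OF lin_closed[OF G g]]
    by (simp add: lin_add[OF G g] lin_smult[OF G g] a_minus_def)
qed

lemma (in cokernel_count) redv_mult:
  assumes "X \<in> lifts" "v \<in> V" shows "redv (X *\<^sub>v v) = Xbar *\<^sub>v redv v"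
  using red.mult_mat_vec_hom[OF liftsD(1)[OF assms(1)] assms(2)] liftsD(2)[OF assms(1)] by simp

lemma (in cokernel_count) lifts_add:
  assumes X: "X \<in> lifts" and W: "W \<in> carrier_mat n n"
    and Wp: "\<And>j. j < n \<Longrightarrow> W *\<^sub>v unit_vec n j \<in> pvec n"
  shows "X + W \<in> lifts"
proof -
  note Xc = liftsD(1)[OF X]
  have XWc: "X + W \<in> carrier_mat n n" using Xc W by auto
  have "map_mat red (X + W) = Xbar"
  proof (rule mat_eq_unitI[OF _ Xbar])
    show "map_mat red (X + W) \<in> carrier_mat n n" using XWc by simp
    fix j assume j: "j < n"
    have e: "unit_vec n j \<in> V" by simp
    have re: "redv (unit_vec n j) = unit_vec n j" using j by (intro eq_vecI) (auto simp: unit_vec_def)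
    have c: "X *\<^sub>v unit_vec n j \<in> V" "W *\<^sub>v unit_vec n j \<in> V" using Xc W by auto
    have W0: "redv (W *\<^sub>v unit_vec n j) = 0\<^sub>v n" using Wp[OF j] redv_eq_0_iff[OF c(2)] by simp
    have "map_mat red (X + W) *\<^sub>v redv (unit_vec n j) = redv ((X + W) *\<^sub>v unit_vec n j)"
      by (rule red.mult_mat_vec_hom[OF XWc e, symmetric])
    also have "\<dots> = redv (X *\<^sub>v unit_vec n j) + 0\<^sub>v n"
      unfolding add_mult_distrib_mat_vec[OF Xc W e] redv_add[OF c] W0 ..
    also have "\<dots> = Xbar *\<^sub>v redv (unit_vec n j)" using redv_mult[OF X e] Xbar by simp
    finally show "map_mat red (X + W) *\<^sub>v unit_vec n j = Xbar *\<^sub>v unit_vec n j" unfolding re .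
  qed
  thus ?thesis using XWc by (simp add: lifts_def)
qed

text \<open>
  A surjection \<open>F\<^sub>g\<close> together with a lift \<open>X1\<close> with which it commutes exactly.  The assumption
  \<open>card_u\<close> says that \<open>p\<^sup>k\<^sup>-\<^sup>1 G\<close> has \<open>q\<^sup>u\<close> elements.
\<close>

locale commuting_lift = cokernel_count p k A F P Q n r G Xbar
  for p k :: nat and A :: "'a::nontriv itself" and F :: "'p::prime_card itself"
    and P :: "'a mod_ring poly" and Q :: "'p mod_ring poly" and n r :: nat
    and G :: "('a mod_ring poly, 'g) module" and Xbar :: "'p mod_ring mat" +
  fixes u :: nat and g :: "nat \<Rightarrow> 'g" and X1 :: "'a mod_ring mat"
  assumes card_u: "card ((\<lambda>x. [:of_nat p ^ (k - 1):] \<odot>\<^bsub>G\<^esub> x) ` carrier G) = q ^ u"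
    and g: "g \<in> {..<n} \<rightarrow> carrier G" and surj: "lin G n g ` V = carrier G"
    and X1: "X1 \<in> lifts"
    and comm1: "\<And>v. v \<in> V \<Longrightarrow> lin G n g (X1 *\<^sub>v v) = [:0, 1:] \<odot>\<^bsub>G\<^esub> lin G n g v"
begin

interpretation G: abelian_group G by (rule gD(1))

abbreviation Fg where "Fg \<equiv> lin G n g"

text \<open>
  \<open>N\<close> is the kernel of \<open>F\<^sub>g\<close>, and \<open>commuting\<close> is the set of lifts for which \<open>F\<^sub>g\<close> is \<open>A[t]\<close>-linear.
  Two of them differ by a matrix with columns in \<open>M\<close>, and whether \<open>P(X) A\<^sup>n = N\<close> is decided in \<open>M/pN\<close>.
\<close>

definition N where "N = {v \<in> V. Fg v = \<zero>\<^bsub>G\<^esub>}"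
definition M where "M = N \<inter> pvec n"
definition pN where "pN = (\<lambda>v. of_nat p \<cdot>\<^sub>v v) ` N"
definition commuting where "commuting = {X \<in> lifts. \<forall>v\<in>V. Fg (X *\<^sub>v v) = [:0, 1:] \<odot>\<^bsub>G\<^esub> Fg v}"

lemma commutingD: "X \<in> commuting \<Longrightarrow> X \<in> carrier_mat n n" "X \<in> commuting \<Longrightarrow> X \<in> lifts"
  "X \<in> commuting \<Longrightarrow> v \<in> V \<Longrightarrow> Fg (X *\<^sub>v v) = [:0, 1:] \<odot>\<^bsub>G\<^esub> Fg v"
  by (auto simp: commuting_def lifts_def)

lemma X1_commuting: "X1 \<in> commuting" using X1 comm1 by (simp add: commuting_def)

lemma Fg_closed: "Fg v \<in> carrier G" by (rule lin_closed[OF G g])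

lemmas Fg_add = lin_add[OF G g] and Fg_smult = lin_smult[OF G g] and Fg_minus = lin_minus[OF G g]

lemma Fg_act:
  assumes X: "X \<in> commuting" and v: "v \<in> V" shows "Fg (poly_mat f X *\<^sub>v v) = f \<odot>\<^bsub>G\<^esub> Fg v"
proof -
  have "Fg (poly_mat f X *\<^sub>v v) \<ominus>\<^bsub>G\<^esub> f \<odot>\<^bsub>G\<^esub> Fg v \<in> {\<zero>\<^bsub>G\<^esub>}"
  proof (rule lin_act_cong[OF G submod_zero[OF G] g commutingD(1)[OF X] _ v])
    fix v assume "v \<in> V"
    thus "Fg (X *\<^sub>v v) \<ominus>\<^bsub>G\<^esub> [:0, 1:] \<odot>\<^bsub>G\<^esub> Fg v \<in> {\<zero>\<^bsub>G\<^esub>}"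
      using commutingD(3)[OF X] diff_self[OF submod_zero[OF G] gD(2)[OF Fg_closed]] by simp
  qed
  thus ?thesis using diff_eq_zero[OF gD(1)] Fg_closed gD(2) by blast
qed

lemma N_carrier: "N \<subseteq> V" by (auto simp: N_def)

lemma N_closed: "0\<^sub>v n \<in> N" "v \<in> N \<Longrightarrow> w \<in> N \<Longrightarrow> v + w \<in> N" "v \<in> N \<Longrightarrow> a \<cdot>\<^sub>v v \<in> N"
proof -
  show sm: "v \<in> N \<Longrightarrow> a \<cdot>\<^sub>v v \<in> N" for v a using gD(8) by (auto simp: N_def Fg_smult)
  have "Fg (0\<^sub>v n) = \<zero>\<^bsub>G\<^esub>" using Fg_smult[of "0\<^sub>v n" 0] gD(7)[OF Fg_closed[of "0\<^sub>v n"]] by simp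
  thus "0\<^sub>v n \<in> N" by (simp add: N_def)
  show "v \<in> N \<Longrightarrow> w \<in> N \<Longrightarrow> v + w \<in> N" by (auto simp: N_def Fg_add)
qed

lemma submod_N: "X \<in> commuting \<Longrightarrow> submod N (mat_module X)"
  using commutingD(3)[of X] commutingD(1)[of X] gD(8) N_closed(1)
  by (intro submod_matI N_closed(2,3) N_carrier) (auto simp: N_def)

lemma submod_M:
  assumes X: "X \<in> commuting" shows "submod M (mat_module X)"
  using submod_matD[OF commutingD(1)[OF X] submod_N[OF X]] submod_matD[OF commutingD(1)[OF X] submod_pvec[OF commutingD(1)[OF X]]]
  by (intro submod_matI[OF commutingD(1)[OF X]]) (auto simp: M_def)

lemma submod_pN: "X \<in> commuting \<Longrightarrow> submod pN (mat_module X)"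
proof -
  assume X: "X \<in> commuting"
  have "pN = (\<lambda>x. [:of_nat p:] \<odot>\<^bsub>mat_module X\<^esub> x) ` N"
    unfolding pN_def using N_carrier pvec_act[OF commutingD(1)[OF X]] by (intro image_cong) auto
  thus ?thesis using submod_smult_image[where c = "[:of_nat p:]", OF submod_N[OF X]] by simp
qed

lemma M_subset: "M \<subseteq> N" "M \<subseteq> pvec n" "M \<subseteq> V" using pvec_carrier by (auto simp: M_def)

lemma pN_subset_M: "pN \<subseteq> M" using N_closed(3) N_carrier pvec_mem by (auto simp: pN_def M_def)

lemma pN_mem: "v \<in> N \<Longrightarrow> of_nat p \<cdot>\<^sub>v v \<in> pN" by (auto simp: pN_def)

lemma lifts_act_diff:
  assumes "X \<in> lifts" "Y \<in> lifts" "v \<in> V" shows "poly_mat f X *\<^sub>v v - poly_mat f Y *\<^sub>v v \<in> pvec n"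
proof -
  have "redv (poly_mat f X *\<^sub>v v) = redv (poly_mat f Y *\<^sub>v v)"
    using redv_act[OF liftsD(1) assms(3)] liftsD(2) assms(1,2) by simp
  thus ?thesis using redv_eq_iff act_carrier[OF liftsD(1)] assms by blast
qed

lemma commuting_diff:
  assumes X: "X \<in> commuting" and Y: "Y \<in> commuting" and v: "v \<in> V" shows "X *\<^sub>v v - Y *\<^sub>v v \<in> M"
proof -
  note c = mult_mat_vec_carrier[OF commutingD(1)[OF X] v] mult_mat_vec_carrier[OF commutingD(1)[OF Y] v]
  have "X *\<^sub>v v - Y *\<^sub>v v \<in> pvec n"
    using redv_mult commutingD(2) X Y v redv_eq_iff[OF c] by simp
  moreover have "Fg (X *\<^sub>v v - Y *\<^sub>v v) = \<zero>\<^bsub>G\<^esub>"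
    unfolding Fg_minus[OF c] commutingD(3)[OF X v] commutingD(3)[OF Y v]
    using diff_self[OF submod_zero[OF G] gD(2)[OF Fg_closed]] by simp
  ultimately show ?thesis using c by (simp add: M_def N_def)
qed

lemma mult_pvec_pN:
  assumes W: "W \<in> carrier_mat n n" and WM: "\<And>v. v \<in> V \<Longrightarrow> W *\<^sub>v v \<in> N" and b: "b \<in> pvec n"
  shows "W *\<^sub>v b \<in> pN"
proof -
  obtain w where w: "w \<in> V" "b = of_nat p \<cdot>\<^sub>v w" using b by (auto simp: pvec_def)
  have "W *\<^sub>v b = of_nat p \<cdot>\<^sub>v (W *\<^sub>v w)" unfolding w(2) using W w(1) by (intro mat_mult_smult_vec) auto
  thus ?thesis using pN_mem[OF WM[OF w(1)]] by simp
qed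

text \<open>
  The difference of two commuting lifts maps \<open>A\<^sup>n\<close> into \<open>N\<close>, hence \<open>p A\<^sup>n\<close> into \<open>pN\<close>.
\<close>

lemma commuting_diff_M:
  assumes X: "X \<in> commuting" and Y: "Y \<in> commuting" and v: "v \<in> M" shows "X *\<^sub>v v - Y *\<^sub>v v \<in> pN"
proof -
  note XY = commutingD(1)[OF X] commutingD(1)[OF Y]
  have eq: "(X - Y) *\<^sub>v w = X *\<^sub>v w - Y *\<^sub>v w" if "w \<in> V" for w
    by (rule minus_mult_distrib_mat_vec[OF XY that])
  have "(X - Y) *\<^sub>v v \<in> pN"
  proof (rule mult_pvec_pN)
    show "X - Y \<in> carrier_mat n n" using XY by auto
    show "v \<in> pvec n" using v M_subset by blast
    show "\<And>w. w \<in> V \<Longrightarrow> (X - Y) *\<^sub>v w \<in> N" using commuting_diff[OF X Y] eq M_subset by auto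
  qed
  thus ?thesis using eq[of v] v M_subset by auto
qed

lemma fin: "finite N" "finite M" "finite pN" "finite (pvec n)"
  using finite_subset[OF _ finite_V[of n]] N_carrier M_subset pN_subset_M pvec_carrier by auto

lemma card_pos: "card N > 0" "card M > 0" "card pN > 0" "card (pvec n) > 0"
proof -
  have "0\<^sub>v n \<in> pN" by (rule submod_matD(2)[OF commutingD(1)[OF X1_commuting] submod_pN[OF X1_commuting]])
  hence "0\<^sub>v n \<in> N" "0\<^sub>v n \<in> M" "0\<^sub>v n \<in> pN" "0\<^sub>v n \<in> pvec n" using pN_subset_M M_subset by auto
  thus "card N > 0" "card M > 0" "card pN > 0" "card (pvec n) > 0" using fin by (auto simp: card_gt_0_iff)
qed

lemmas simps = mat_module_simps[OF commutingD(1)[OF X1_commuting]] mat_module_simps[OF Xbar]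

lemma card_hom_mat:
  assumes L: "submod L (mat_module X1)" and H: "abelian_group H" and f: "\<And>v. v \<in> L \<Longrightarrow> f v \<in> carrier H"
    and add: "\<And>v w. v \<in> L \<Longrightarrow> w \<in> L \<Longrightarrow> f (v + w) = f v \<oplus>\<^bsub>H\<^esub> f w"
  shows "card L = card (f ` L) * card {v \<in> L. f v = \<zero>\<^bsub>H\<^esub>}"
  using assms by (intro card_hom_image_kernel[OF L]) (auto simp: simps finite_V)

lemma submod_V: "submod V (mat_module X1)"
  using submod_carrier[OF mat_module[OF commutingD(1)[OF X1_commuting]]] by (simp add: simps)

lemma card_V_G: "card V = card (carrier G) * card N"
  using card_hom_mat[OF submod_V gD(1), of Fg] Fg_closed Fg_add surj by (simp add: N_def)

lemma Fg_pvec: "Fg ` pvec n = pG"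
proof -
  have "Fg ` pvec n = (\<lambda>v. [:of_nat p:] \<odot>\<^bsub>G\<^esub> Fg v) ` V"
    unfolding pvec_def image_image using Fg_smult by (intro image_cong) auto
  also have "\<dots> = pG" unfolding pG_def surj[symmetric] image_image ..
  finally show ?thesis .
qed

lemma card_pvec_M: "card (pvec n) = card pG * card M"
proof -
  have "card (pvec n) = card (Fg ` pvec n) * card {v \<in> pvec n. Fg v = \<zero>\<^bsub>G\<^esub>}"
    using pvec_carrier Fg_closed Fg_add
    by (intro card_hom_mat[OF submod_pvec[OF commutingD(1)[OF X1_commuting]] gD(1)]) (auto simp: subset_iff)
  moreover have "{v \<in> pvec n. Fg v = \<zero>\<^bsub>G\<^esub>} = M" using pvec_carrier by (auto simp: M_def N_def)
  ultimately show ?thesis by (simp add: Fg_pvec)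
qed

lemma card_N_M: "card N = card (redv ` N) * card M"
proof -
  have "card N = card (redv ` N) * card {v \<in> N. redv v = \<zero>\<^bsub>mat_module Xbar\<^esub>}"
    using N_carrier redv_add[of _ n]
    by (intro card_hom_mat[OF submod_N[OF X1_commuting] cring_moduleD(1)[OF mat_module[OF Xbar]]]) (auto simp: simps subset_iff)
  moreover have "{v \<in> N. redv v = 0\<^sub>v n} = M" using redv_eq_0_iff N_carrier by (auto simp: M_def)
  ultimately show ?thesis by (simp add: simps)
qed

lemma act_P_mem_N: "X \<in> commuting \<Longrightarrow> v \<in> V \<Longrightarrow> poly_mat P X *\<^sub>v v \<in> N"
  using Fg_act[of X v P] PG[OF Fg_closed[of v]] act_carrier[OF commutingD(1)] by (simp add: N_def)

lemma card_Ubar_pos: "card Ubar > 0"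
proof -
  have "finite Ubar" unfolding Ubar_def
    using finite_card_carrier_vec[of n, where 'a = "'p mod_ring"] by blast
  thus "card Ubar > 0" using Ubar_closed(1) by (auto simp: card_gt_0_iff)
qed

text \<open>
  The kernel \<open>N\<close> contains \<open>P(X1) A\<^sup>n\<close>, which gives one inclusion; for the other one, the size of the
  reduction of \<open>N\<close> follows from \<open>A\<^sup>n/N \<simeq> G\<close> and \<open>p A\<^sup>n/M \<simeq> pG\<close>.
\<close>

lemma redv_N: "redv ` N = Ubar"
proof (rule card_subset_eq[symmetric])
  show sub: "Ubar \<subseteq> redv ` N"
  proof
    fix w assume "w \<in> Ubar"
    then obtain xb where xb: "xb \<in> carrier_vec n" "w = poly_mat Q Xbar *\<^sub>v xb" by (auto simp: Ubar_def)
    obtain x where x: "x \<in> V" "redv x = xb" using redv_surj[OF xb(1)] by blast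
    have "redv (poly_mat P X1 *\<^sub>v x) = w"
      unfolding redv_act[OF liftsD(1)[OF X1] x(1)] liftsD(2)[OF X1] x(2) xb(2) Q_def ..
    thus "w \<in> redv ` N" using act_P_mem_N[OF X1_commuting x(1)] by blast
  qed
  show "finite (redv ` N)" using fin by simp
  have "card (carrier G) * (card (redv ` N) * card M) = p ^ n * (card pG * card M)"
    using card_V_pvec[of n] unfolding card_V_G card_N_M card_pvec_M .
  hence "q ^ r * card (redv ` N) * (card pG * card M) = q ^ r * card Ubar * (card pG * card M)"
    unfolding card_G' using card_cok by (simp add: Ubar_def mult_ac)
  moreover have "card pG * card M > 0" using card_pvec_M card_pos by simp
  moreover have "q ^ r > 0" using q_gt_1 by simp
  ultimately show "card Ubar = card (redv ` N)" by auto
qed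

lemma p_kernel_V: "{v \<in> V. of_nat p \<cdot>\<^sub>v v = 0\<^sub>v n} = (\<lambda>v. of_nat p ^ (k - 1) \<cdot>\<^sub>v v) ` V"
  and card_p_kernel_V: "card {v \<in> V. of_nat p \<cdot>\<^sub>v v = 0\<^sub>v n} = p ^ n"
proof -
  let ?K = "{v \<in> V. of_nat p \<cdot>\<^sub>v v = 0\<^sub>v n}" and ?I = "(\<lambda>v. of_nat p ^ (k - 1) \<cdot>\<^sub>v v) ` V"
  note ab = cring_moduleD(1)[OF mat_module[OF commutingD(1)[OF X1_commuting]]]
  have c1: "card V = card (pvec n) * card ?K"
    using card_hom_mat[OF submod_V ab, of "\<lambda>v. of_nat p \<cdot>\<^sub>v v"]
    by (simp add: simps pvec_def smult_add_distrib_vec[of _ n])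
  thus cK: "card ?K = p ^ n" using card_V_pvec[of n] card_pos(4) by simp
  have pk: "(of_nat p ^ k :: 'a mod_ring) = 0" by (metis card_a of_nat_card_eq_0 of_nat_power)
  have pk1: "(of_nat p * of_nat p ^ (k - 1) :: 'a mod_ring) = 0"
    using pk k_pos by (metis power_Suc Suc_pred' less_eq_Suc_le One_nat_def)
  have sub: "?I \<subseteq> ?K" using pk1 by (auto simp: smult_smult_assoc)
  have c2: "card V = card ?I * card {v \<in> V. of_nat p ^ (k - 1) \<cdot>\<^sub>v v = 0\<^sub>v n}"
    using card_hom_mat[OF submod_V ab, of "\<lambda>v. of_nat p ^ (k - 1) \<cdot>\<^sub>v v"]
    by (simp add: simps smult_add_distrib_vec[of _ n])
  have "{v \<in> V. of_nat p ^ (k - 1) \<cdot>\<^sub>v v = 0\<^sub>v n} \<subseteq> pvec n"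
  proof clarify
    fix v assume v: "v \<in> V" "of_nat p ^ (k - 1) \<cdot>\<^sub>v v = 0\<^sub>v n"
    have "redv v = 0\<^sub>v n"
    proof (rule eq_vecI)
      fix i assume "i < dim_vec (0\<^sub>v n :: 'p mod_ring vec)"
      hence i: "i < n" by simp
      have "(of_nat p ^ (k - 1) \<cdot>\<^sub>v v) $ i = 0" using v(2) i by simp
      hence z: "of_nat p ^ (k - 1) * v $ i = 0" using i v(1) by simp
      obtain x where x: "v $ i = of_int x" using ex_of_int by blast
      have "(of_int (int p ^ (k - 1) * x) :: 'a mod_ring) = of_int 0" using z x by simp
      hence "int p ^ k dvd int p ^ (k - 1) * x" unfolding of_int_eq_mod_ring_iff card_a by simp
      moreover have "int p ^ k = int p ^ (k - 1) * int p" using k_pos by (cases k) auto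
      ultimately have "int p dvd x" using p_gt_0 by simp
      hence "(of_int x :: 'p mod_ring) = of_int 0" unfolding of_int_eq_mod_ring_iff card_p by simp
      hence "red (v $ i) = 0" unfolding x red_of_int by simp
      thus "redv v $ i = 0\<^sub>v n $ i" using i v(1) by simp
    qed (use v in simp)
    thus "v \<in> pvec n" using redv_eq_0_iff v(1) by blast
  qed
  hence le: "card {v \<in> V. of_nat p ^ (k - 1) \<cdot>\<^sub>v v = 0\<^sub>v n} \<le> card (pvec n)" using fin by (intro card_mono) auto
  have "card (pvec n) * p ^ n = card ?I * card {v \<in> V. of_nat p ^ (k - 1) \<cdot>\<^sub>v v = 0\<^sub>v n}"
    by (rule trans[OF sym[OF c1[unfolded cK]] c2])
  also have "\<dots> \<le> card ?I * card (pvec n)" by (rule mult_le_mono2[OF le])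
  finally have "card (pvec n) * card ?K \<le> card (pvec n) * card ?I" unfolding cK by (simp only: mult.commute)
  hence "card ?K \<le> card ?I" using card_pos(4) by (simp only: mult_le_cancel1)
  thus "?K = ?I" using sub finite_V[of n] by (intro card_seteq[symmetric]) auto
qed

text \<open>
  Multiplication by \<open>p\<close> shows that \<open>N/pN\<close> is as large as the \<open>p\<close>-torsion of \<open>N\<close>.  The \<open>p\<close>-torsion of
  \<open>A\<^sup>n\<close> is \<open>p\<^sup>k\<^sup>-\<^sup>1 A\<^sup>n\<close>, which \<open>F\<^sub>g\<close> maps onto \<open>p\<^sup>k\<^sup>-\<^sup>1 G\<close>, and the kernel of this map is the
  \<open>p\<close>-torsion of \<open>N\<close>.
\<close>

lemma card_M_pN: "card M * q ^ u = card pN * q ^ r"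
proof -
  let ?K = "{v \<in> V. of_nat p \<cdot>\<^sub>v v = 0\<^sub>v n}" and ?NK = "{v \<in> N. of_nat p \<cdot>\<^sub>v v = 0\<^sub>v n}"
  note ab = cring_moduleD(1)[OF mat_module[OF commutingD(1)[OF X1_commuting]]]
  have 1: "card N = card pN * card ?NK"
    using card_hom_mat[OF submod_N[OF X1_commuting] ab, of "\<lambda>v. of_nat p \<cdot>\<^sub>v v"] N_carrier
    by (auto simp add: simps pN_def smult_add_distrib_vec[of _ n] subset_iff)
  have X: "X1 \<in> carrier_mat n n" by (rule commutingD(1)[OF X1_commuting])
  have K: "submod ?K (mat_module X1)"
  proof (rule submod_matI[OF X])
    fix v a assume v: "v \<in> ?K"
    have "of_nat p \<cdot>\<^sub>v (a \<cdot>\<^sub>v v) = a \<cdot>\<^sub>v (of_nat p \<cdot>\<^sub>v v)" by (simp add: smult_smult_assoc mult.commute)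
    moreover have "a \<cdot>\<^sub>v 0\<^sub>v n = 0\<^sub>v n" by (rule eq_vecI) simp_all
    ultimately show "a \<cdot>\<^sub>v v \<in> ?K" using v by simp
    have "of_nat p \<cdot>\<^sub>v (X1 *\<^sub>v v) = X1 *\<^sub>v (of_nat p \<cdot>\<^sub>v v)"
      using v X by (intro mat_mult_smult_vec[symmetric]) auto
    also have "\<dots> = X1 *\<^sub>v (0 \<cdot>\<^sub>v 0\<^sub>v n)" using v by simp
    also have "\<dots> = 0 \<cdot>\<^sub>v (X1 *\<^sub>v 0\<^sub>v n)" using X by (intro mat_mult_smult_vec) auto
    also have "\<dots> = 0\<^sub>v n" using X by simp
    finally show "X1 *\<^sub>v v \<in> ?K" using v X by auto
  qed (auto simp: smult_add_distrib_vec[of _ n])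
  have "card ?K = card (Fg ` ?K) * card {v \<in> ?K. Fg v = \<zero>\<^bsub>G\<^esub>}"
    using Fg_closed Fg_add by (intro card_hom_mat[OF K gD(1)]) auto
  moreover have "Fg ` ?K = (\<lambda>x. [:of_nat p ^ (k - 1):] \<odot>\<^bsub>G\<^esub> x) ` carrier G"
    unfolding p_kernel_V image_image surj[symmetric] using Fg_smult by (intro image_cong) auto
  moreover have "{v \<in> ?K. Fg v = \<zero>\<^bsub>G\<^esub>} = ?NK" by (auto simp: N_def)
  ultimately have 2: "p ^ n = q ^ u * card ?NK" by (simp only: card_p_kernel_V card_u)
  have "card M * q ^ u * (card Ubar * card ?NK) = card N * p ^ n"
    unfolding 2 card_N_M redv_N by simp
  also have "\<dots> = card pN * card ?NK * (q ^ r * card Ubar)" unfolding 1 using card_cok by (simp add: Ubar_def)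
  finally have "(card M * q ^ u) * (card Ubar * card ?NK) = (card pN * q ^ r) * (card Ubar * card ?NK)"
    by (simp add: mult_ac)
  moreover have "card Ubar * card ?NK > 0" using card_Ubar_pos 1 card_pos(1) by simp
  ultimately show ?thesis unfolding mult_cancel2 by auto
qed

lemma u_le_r: "u \<le> r" and card_M: "card M = q ^ (r - u) * card pN"
proof -
  have "card pN \<le> card M" using pN_subset_M fin by (intro card_mono)
  hence "card pN * q ^ u \<le> card pN * q ^ r" unfolding card_M_pN[symmetric] by (rule mult_le_mono1)
  hence "q ^ u \<le> q ^ r" using card_pos by simp
  thus ur: "u \<le> r" using q_gt_1 by (simp add: power_increasing_iff)
  have "q ^ r = q ^ (r - u) * q ^ u" using ur by (simp add: power_add[symmetric])
  hence "card M * q ^ u = q ^ (r - u) * card pN * q ^ u" using card_M_pN by (simp only: mult_ac)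
  thus "card M = q ^ (r - u) * card pN" using q_gt_1 by simp
qed

end

section \<open>Commuting lifts with prescribed kernel\<close>

lemma act_zero: "X \<in> carrier_mat n n \<Longrightarrow> poly_mat f X *\<^sub>v 0\<^sub>v n = 0\<^sub>v n"
  using act_smult_vec[of X n "0\<^sub>v n" f 0] dim_poly_mat[of X n f] by simp

lemma smult_zero_v [simp]: "(a :: 'a::comm_ring_1) \<cdot>\<^sub>v 0\<^sub>v n = 0\<^sub>v n"
  by (rule eq_vecI) simp_all

lemma vec_add_diff_cancel:
  fixes x y z :: "'a::comm_ring_1 vec"
  assumes "x \<in> carrier_vec n" "y \<in> carrier_vec n" "z \<in> carrier_vec n"
  shows "(x + y) - x = y" and "x + y = (x + z) + (y - z)"
  using assms by (auto intro!: eq_vecI)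

context commuting_lift
begin

lemma X1c: "X1 \<in> carrier_mat n n" by (rule commutingD(1)[OF X1_commuting])

text \<open>
  The vectors that \<open>P(X)\<close> maps into \<open>p A\<^sup>n\<close>, for any lift \<open>X\<close> (see \<open>Vk_iff\<close>).
\<close>

definition Vk where "Vk = {v \<in> V. poly_mat Q Xbar *\<^sub>v redv v = 0\<^sub>v n}"

lemma Vk_iff:
  assumes X: "X \<in> lifts" and v: "v \<in> V" shows "v \<in> Vk \<longleftrightarrow> poly_mat P X *\<^sub>v v \<in> pvec n"
proof -
  have "redv (poly_mat P X *\<^sub>v v) = poly_mat Q Xbar *\<^sub>v redv v"
    unfolding redv_act[OF liftsD(1)[OF X] v] liftsD(2)[OF X] Q_def ..
  thus ?thesis using redv_eq_0_iff[OF act_carrier[OF liftsD(1)[OF X] v, of P]] v by (simp add: Vk_def)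
qed

lemma submod_Vk: "submod Vk (mat_module X1)"
proof (rule submod_matI[OF X1c])
  note z = act_zero[OF Xbar, of Q]
  have "redv (0\<^sub>v n) = 0\<^sub>v n" by (intro eq_vecI) auto
  thus "0\<^sub>v n \<in> Vk" using z by (simp add: Vk_def)
  fix v a assume v: "v \<in> Vk"
  hence vV: "v \<in> V" "redv v \<in> carrier_vec n" by (auto simp: Vk_def)
  show "a \<cdot>\<^sub>v v \<in> Vk" using v act_smult_vec[OF Xbar vV(2)] by (simp add: Vk_def redv_smult)
  have "poly_mat Q Xbar *\<^sub>v (Xbar *\<^sub>v redv v) = Xbar *\<^sub>v 0\<^sub>v n"
    using v act_commute[OF Xbar vV(2), of Q] by (simp add: Vk_def)
  thus "X1 *\<^sub>v v \<in> Vk" using X1c Xbar vV by (auto simp: Vk_def redv_mult[OF X1])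
  fix w assume w: "w \<in> Vk"
  show "v + w \<in> Vk" using v w act_add_vec[OF Xbar, of "redv v" "redv w" Q] by (auto simp: Vk_def redv_add)
qed (auto simp: Vk_def)

lemma pvec_Vk: "pvec n \<subseteq> Vk"
proof
  fix v assume v: "v \<in> pvec n"
  hence vV: "v \<in> V" using pvec_carrier by blast
  show "v \<in> Vk" using Vk_iff[OF X1 vV] submod_matD(7)[OF X1c submod_pvec[OF X1c] v] by simp
qed

lemma J_Vk:
  assumes j: "j \<in> J" and v: "v \<in> Vk" shows "poly_mat j X1 *\<^sub>v v \<in> pvec n"
proof -
  have "Q dvd map_poly red j" using j by (simp add: J_def)
  then obtain h where "map_poly red j = Q * h" by (elim dvdE)
  hence h: "map_poly red j = h * Q" by (simp only: mult.commute)
  have vV: "v \<in> V" "redv v \<in> carrier_vec n" using v by (auto simp: Vk_def)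
  have "redv (poly_mat j X1 *\<^sub>v v) = poly_mat h Xbar *\<^sub>v (poly_mat Q Xbar *\<^sub>v redv v)"
    unfolding redv_act[OF X1c vV(1)] liftsD(2)[OF X1] h by (rule act_mult[OF Xbar vV(2)])
  also have "\<dots> = 0\<^sub>v n" using v act_zero[OF Xbar, of h] by (simp add: Vk_def)
  finally show ?thesis using redv_eq_0_iff[OF act_carrier[OF X1c vV(1)]] by blast
qed

lemma card_Vk: "card Vk = q ^ r * card (pvec n)"
proof -
  let ?f = "\<lambda>v. poly_mat Q Xbar *\<^sub>v redv v"
  have im: "?f ` V = Ubar"
  proof -
    have "redv ` V = carrier_vec n" using redv_surj by force
    thus ?thesis unfolding Ubar_def by (metis image_image)
  qed
  have "card V = card (?f ` V) * card {v \<in> V. ?f v = \<zero>\<^bsub>mat_module Xbar\<^esub>}"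
    using act_carrier[OF Xbar] act_add_vec[OF Xbar]
    by (intro card_hom_mat[OF submod_V cring_moduleD(1)[OF mat_module[OF Xbar]]]) (auto simp: simps redv_add)
  also have "{v \<in> V. ?f v = \<zero>\<^bsub>mat_module Xbar\<^esub>} = Vk" by (simp add: Vk_def simps)
  finally have "card Ubar * card Vk = card V" unfolding im by (rule sym)
  also have "\<dots> = p ^ n * card (pvec n)" by (rule card_V_pvec)
  also have "p ^ n = q ^ r * card Ubar" using card_cok by (simp add: Ubar_def)
  finally have "card Ubar * card Vk = card Ubar * (q ^ r * card (pvec n))" by (simp only: mult_ac)
  thus ?thesis using card_Ubar_pos by simp
qed

lemma ex_basis_Vk:
  obtains vs where "indep (mat_module X1) (pvec n) vs" "gen (mat_module X1) (pvec n) vs = Vk"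
    "length vs = r" "set vs \<subseteq> Vk"
proof -
  note pv = submod_pvec[OF X1c]
  obtain vs where vs: "set vs \<subseteq> Vk" "indep (mat_module X1) (pvec n) vs" "gen (mat_module X1) (pvec n) vs = Vk"
    using ex_indep_gen[OF pv submod_Vk pvec_Vk] finite_V[of n] by (auto simp: simps)
  have "card (gen (mat_module X1) (pvec n) vs) = q ^ length vs * card (pvec n)"
    using vs J_Vk by (intro card_gen pv) (auto simp: simps finite_V)
  hence "q ^ length vs = q ^ r" using card_Vk vs(3) card_pos(4) by simp
  hence "length vs = r" using q_gt_1 by (simp add: power_inject_exp)
  thus ?thesis using that vs by blast
qed

text \<open>
  By \<open>powers_indep\<close> the vectors \<open>X1\<^sup>c v\<close> with \<open>c < d\<close> and \<open>v\<close> in \<open>vs\<close> are independent over \<open>\<F>\<^sub>p\<close> modulo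
  \<open>p A\<^sup>n\<close>, so a linear map \<open>A\<^sup>n \<rightarrow> M/pN\<close> can be prescribed on them.  The columns of \<open>W\<close> represent its
  values at the unit vectors.
\<close>

lemma ex_matrix_with_values:
  assumes ind: "indep (mat_module X1) (pvec n) vs" and vsV: "set vs \<subseteq> Vk"
    and b: "length b = length vs" "set b \<subseteq> M"
  obtains W where "W \<in> carrier_mat n n" "\<And>v. v \<in> V \<Longrightarrow> W *\<^sub>v v \<in> M"
    "\<And>i c. i < length vs \<Longrightarrow> Suc c < d \<Longrightarrow> W *\<^sub>v (poly_mat (monom 1 c) X1 *\<^sub>v (vs ! i)) \<in> pN"
    "\<And>i. i < length vs \<Longrightarrow> W *\<^sub>v (poly_mat (monom 1 (d - 1)) X1 *\<^sub>v (vs ! i)) - b ! i \<in> pN"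
proof -
  interpret sc: residue_system "{a. red a = 0}" "range lft" by (rule residue_scalars)
  let ?M0 = "module_vec TYPE('a mod_ring) n"
  note M0 = cring_module_vec[of n, where 'a = "'a mod_ring"]
  have pv: "submod (pvec n) ?M0" by (rule submod_mat_vec[OF X1c submod_pvec[OF X1c]])
  have sM: "submod M ?M0" by (rule submod_mat_vec[OF X1c submod_M[OF X1_commuting]])
  have spN: "submod pN ?M0" by (rule submod_mat_vec[OF X1c submod_pN[OF X1_commuting]])
  let ?pw = "\<lambda>v c. poly_mat (monom 1 c) X1 *\<^sub>v v"
  let ?h = "\<lambda>b c. if c = d - 1 then b else 0\<^sub>v n"
  let ?ys = "concat (map (\<lambda>v. map (?pw v) [0..<d]) vs)"
  let ?gs = "concat (map (\<lambda>b. map (?h b) [0..<d]) b)"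
  have ind': "indep ?M0 (pvec n) ?ys"
    using J_Vk vsV by (intro powers_indep[OF X1c submod_pvec[OF X1c] ind]) auto
  have zip: "zip ?ys ?gs = concat (map (\<lambda>(v, b). map (\<lambda>c. (?pw v c, ?h b c)) [0..<d]) (zip vs b))"
    by (rule zip_concat_map) (use b in simp)
  have len: "length ?gs = length ?ys" using b(1) by (simp add: length_concat o_def sum_list_triv)
  have gsM: "set ?gs \<subseteq> M" using b(2) submod_matD(2)[OF X1c submod_M[OF X1_commuting]] by auto
  obtain \<Gamma> where \<Gamma>: "submod \<Gamma> (direct_sum ?M0 ?M0)" "pvec n \<times> pN \<subseteq> \<Gamma>" "\<Gamma> \<subseteq> carrier ?M0 \<times> M"
    "fst ` \<Gamma> = carrier ?M0" "\<And>z. (\<zero>\<^bsub>?M0\<^esub>, z) \<in> \<Gamma> \<Longrightarrow> z \<in> pN"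
    "\<And>i. i < length ?ys \<Longrightarrow> (?ys ! i, ?gs ! i) \<in> \<Gamma>"
  proof (rule sc.ex_linear_relation[OF M0 M0 _ pv spN sM pN_subset_M ind' len])
    show "finite (carrier ?M0)" by (simp add: module_vec_simps finite_V)
    show "a \<odot>\<^bsub>?M0\<^esub> y \<in> pvec n" if ya: "y \<in> carrier ?M0" "a \<in> {a. red a = 0}" for y a
    proof -
      obtain c where "a = of_nat p * c" using iffD1[OF red_eq_0_iff, of a] ya by blast
      thus ?thesis using pvec_mem[of "c \<cdot>\<^sub>v y" n] ya by (simp add: module_vec_simps smult_smult_assoc)
    qed
    show "a \<odot>\<^bsub>?M0\<^esub> y \<in> pN" if y: "y \<in> set ?gs" "a \<in> {a. red a = 0}" for y a
    proof -
      obtain c where "a = of_nat p * c" using iffD1[OF red_eq_0_iff, of a] y by blast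
      moreover have "c \<cdot>\<^sub>v y \<in> N" using y gsM M_subset N_closed(3) by blast
      ultimately show ?thesis using pN_mem[of "c \<cdot>\<^sub>v y"] by (simp add: module_vec_simps smult_smult_assoc)
    qed
    show "set ?gs \<subseteq> M" by (rule gsM)
  qed (use that in blast)+
  note GD = submodD[OF \<Gamma>(1)]
  have zip\<Gamma>: "x \<in> \<Gamma>" if "x \<in> set (zip ?ys ?gs)" for x
    using that \<Gamma>(6) len by (auto simp: set_zip)
  have ex: "\<forall>j. \<exists>x. j < n \<longrightarrow> (unit_vec n j, x) \<in> \<Gamma>"
  proof (intro allI)
    fix j
    have "unit_vec n j \<in> fst ` \<Gamma>" unfolding \<Gamma>(4) by (simp add: module_vec_simps)
    thus "\<exists>x. j < n \<longrightarrow> (unit_vec n j, x) \<in> \<Gamma>" by force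
  qed
  then obtain c where c: "\<And>j. j < n \<Longrightarrow> (unit_vec n j, c j) \<in> \<Gamma>" by metis
  have cV: "c j \<in> V" if "j < n" for j using c[OF that] \<Gamma>(3) M_subset by auto
  define W where "W = mat_of_columns n c"
  have W: "W \<in> carrier_mat n n" by (simp add: W_def)
  have W\<Gamma>: "(v, W *\<^sub>v v) \<in> \<Gamma>" if v: "v \<in> V" for v
  proof -
    have "v \<in> {v \<in> V. (v, W *\<^sub>v v) \<in> \<Gamma>}"
    proof (rule vec_span_induct[OF _ _ _ _ v])
      show "a \<cdot>\<^sub>v v \<in> {v \<in> V. (v, W *\<^sub>v v) \<in> \<Gamma>}" if vv: "v \<in> {v \<in> V. (v, W *\<^sub>v v) \<in> \<Gamma>}" for a v
      proof -
        have "W *\<^sub>v (a \<cdot>\<^sub>v v) = a \<cdot>\<^sub>v (W *\<^sub>v v)" using W vv by (intro mat_mult_smult_vec) auto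
        thus ?thesis using GD(6)[of "(v, W *\<^sub>v v)" a] vv by (simp add: direct_sum_def module_vec_simps)
      qed
      have "W *\<^sub>v (0 \<cdot>\<^sub>v 0\<^sub>v n) = 0 \<cdot>\<^sub>v (W *\<^sub>v 0\<^sub>v n)" using W by (intro mat_mult_smult_vec) auto
      hence "W *\<^sub>v 0\<^sub>v n = 0\<^sub>v n" using W by simp
      thus "0\<^sub>v n \<in> {v \<in> V. (v, W *\<^sub>v v) \<in> \<Gamma>}" using GD(3) by (simp add: direct_sum_def module_vec_simps)
      show "v + w \<in> {v \<in> V. (v, W *\<^sub>v v) \<in> \<Gamma>}"
        if "v \<in> {v \<in> V. (v, W *\<^sub>v v) \<in> \<Gamma>}" "w \<in> {v \<in> V. (v, W *\<^sub>v v) \<in> \<Gamma>}" for v w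
        using that GD(5)[of "(v, W *\<^sub>v v)" "(w, W *\<^sub>v w)"]
        by (simp add: direct_sum_def module_vec_simps mult_add_distrib_mat_vec[OF W])
      show "unit_vec n j \<in> {v \<in> V. (v, W *\<^sub>v v) \<in> \<Gamma>}" if "j < n" for j
        using c[OF that] mat_of_columns_unit[of j n c, OF that cV[OF that]] by (simp add: W_def)
    qed
    thus ?thesis by simp
  qed
  have funct: "W *\<^sub>v y - z \<in> pN" if yz: "(y, z) \<in> \<Gamma>" for y z
  proof -
    have y: "y \<in> V" "z \<in> V" using yz \<Gamma>(3) M_subset by (auto simp: module_vec_simps)
    have "(y, W *\<^sub>v y) \<in> \<Gamma>" by (rule W\<Gamma>[OF y(1)])
    moreover have "((-1) \<cdot>\<^sub>v y, (-1) \<cdot>\<^sub>v z) \<in> \<Gamma>" using GD(6)[OF yz, of "-1"] by (simp add: direct_sum_def module_vec_simps)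
    ultimately have "(y + (-1) \<cdot>\<^sub>v y, W *\<^sub>v y + (-1) \<cdot>\<^sub>v z) \<in> \<Gamma>"
      using GD(5) by (force simp: direct_sum_def module_vec_simps)
    moreover have "y + (-1) \<cdot>\<^sub>v y = 0\<^sub>v n" "W *\<^sub>v y + (-1) \<cdot>\<^sub>v z = W *\<^sub>v y - z"
      using y W by (auto intro!: eq_vecI)
    ultimately show ?thesis using \<Gamma>(5) by (simp add: module_vec_simps)
  qed
  have val: "W *\<^sub>v (?pw (vs ! i) c) - ?h (b ! i) c \<in> pN" if ic: "i < length vs" "c < d" for i c
  proof (rule funct[OF zip\<Gamma>])
    have "(vs ! i, b ! i) \<in> set (zip vs b)" using ic b(1) by (auto simp: set_zip)
    thus "(?pw (vs ! i) c, ?h (b ! i) c) \<in> set (zip ?ys ?gs)" unfolding zip using ic(2) by force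
  qed
  show ?thesis
  proof
    show "W \<in> carrier_mat n n" by (rule W)
    show "\<And>v. v \<in> V \<Longrightarrow> W *\<^sub>v v \<in> M" using W\<Gamma> \<Gamma>(3) by blast
    show "W *\<^sub>v (?pw (vs ! i) (d - 1)) - b ! i \<in> pN" if "i < length vs" for i
      using val[OF that, of "d - 1"] d_pos by simp
    fix i c assume i: "i < length vs" "Suc c < d"
    have "vs ! i \<in> V" using i vsV nth_mem[of i vs] unfolding Vk_def by blast
    hence "W *\<^sub>v (?pw (vs ! i) c) \<in> V" using W act_carrier[OF X1c] by auto
    moreover have "W *\<^sub>v (?pw (vs ! i) c) - 0\<^sub>v n \<in> pN" using val[OF i(1), of c] i(2) less_imp_neq[of "Suc c" d] by (simp split: if_splits)
    ultimately show "W *\<^sub>v (?pw (vs ! i) c) \<in> pN" by simp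
  qed
qed

text \<open>
  By induction \<open>(X + W)\<^sup>c v = X\<^sup>c v\<close> modulo \<open>pN\<close> for \<open>c < d\<close>, since \<open>W\<close> maps \<open>p A\<^sup>n\<close> into \<open>pN\<close> and
  therefore only sees the powers of \<open>X1\<close>.  At \<open>c = d\<close> the value \<open>b\<close> appears, with coefficient \<open>1\<close> as
  \<open>P\<close> is monic.
\<close>

lemma perturbation:
  assumes X: "X \<in> commuting" and W: "W \<in> carrier_mat n n" and WM: "\<And>v. v \<in> V \<Longrightarrow> W *\<^sub>v v \<in> M"
    and v: "v \<in> V" and b: "b \<in> M"
    and low: "\<And>c. Suc c < d \<Longrightarrow> W *\<^sub>v (poly_mat (monom 1 c) X1 *\<^sub>v v) \<in> pN"
    and top: "W *\<^sub>v (poly_mat (monom 1 (d - 1)) X1 *\<^sub>v v) - b \<in> pN"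
    and XW: "X + W \<in> commuting"
  shows "poly_mat P (X + W) *\<^sub>v v - (poly_mat P X *\<^sub>v v + b) \<in> pN"
proof -
  note Xc = commutingD(1)[OF X] and XWc = commutingD(1)[OF XW]
  note pNX = submod_pN[OF X]
  let ?x = "\<lambda>c. poly_mat (monom 1 c) X *\<^sub>v v" and ?y = "\<lambda>c. poly_mat (monom 1 c) (X + W) *\<^sub>v v"
  have xV: "?x c \<in> V" and yV: "?y c \<in> V" for c using act_carrier[OF Xc v] act_carrier[OF XWc v] by auto
  have bV: "b \<in> V" using b M_subset by blast
  have WV: "W *\<^sub>v w \<in> V" if "w \<in> V" for w using W that by auto
  have Wy: "W *\<^sub>v ?y c - W *\<^sub>v (poly_mat (monom 1 c) X1 *\<^sub>v v) \<in> pN" for c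
  proof -
    have "?y c - poly_mat (monom 1 c) X1 *\<^sub>v v \<in> pvec n"
      by (rule lifts_act_diff[OF commutingD(2)[OF XW] X1 v])
    hence "W *\<^sub>v (?y c - poly_mat (monom 1 c) X1 *\<^sub>v v) \<in> pN"
      using WM M_subset by (intro mult_pvec_pN[OF W]) auto
    thus ?thesis using mult_minus_distrib_mat_vec[OF W yV act_carrier[OF X1c v]] by simp
  qed
  have step: "?y (Suc c) - (?x (Suc c) + z) \<in> pN"
    if IH: "?y c - ?x c \<in> pN" and z: "W *\<^sub>v (poly_mat (monom 1 c) X1 *\<^sub>v v) - z \<in> pN" "z \<in> V" for c z
  proof -
    have Wz: "W *\<^sub>v ?y c - z \<in> pN"
      by (rule vec_diff_trans[OF Xc pNX Wy z(1)]) (use WV yV act_carrier[OF X1c v] z in auto)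
    have "(X *\<^sub>v ?y c + W *\<^sub>v ?y c) - (X *\<^sub>v ?x c + z) \<in> pN"
      by (rule vec_diff_add[OF Xc pNX vec_diff_mult[OF Xc pNX IH yV xV] Wz]) (use WV yV xV z Xc in auto)
    moreover have "?y (Suc c) = X *\<^sub>v ?y c + W *\<^sub>v ?y c"
      unfolding act_monom_Suc[OF XWc v] by (rule add_mult_distrib_mat_vec[OF Xc W yV])
    moreover have "?x (Suc c) = X *\<^sub>v ?x c" by (rule act_monom_Suc[OF Xc v])
    ultimately show ?thesis by simp
  qed
  have pw: "?y c - ?x c \<in> pN" if "c < d" for c
    using that
  proof (induction c)
    case 0
    show ?case using act_monom_0[OF Xc v] act_monom_0[OF XWc v] vec_diff_self[OF Xc pNX v] by simp
  next
    case (Suc c)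
    have w: "W *\<^sub>v (poly_mat (monom 1 c) X1 *\<^sub>v v) \<in> V" using WV act_carrier[OF X1c v] by blast
    have "W *\<^sub>v (poly_mat (monom 1 c) X1 *\<^sub>v v) - 0\<^sub>v n \<in> pN" using low[OF Suc.prems] w by simp
    from step[OF Suc.IH this] Suc.prems have "?y (Suc c) - (?x (Suc c) + 0\<^sub>v n) \<in> pN" by simp
    thus ?case using xV[of "Suc c"] by simp
  qed
  have pd: "?y d - (?x d + b) \<in> pN"
    using step[OF pw[of "d - 1"] top bV] d_pos by simp
  define R where "R = P - monom 1 d"
  have R: "poly_mat R (X + W) *\<^sub>v v - poly_mat R X *\<^sub>v v \<in> pN"
  proof -
    have "R \<in> {f. poly_mat f (X + W) *\<^sub>v v - poly_mat f X *\<^sub>v v \<in> pN}"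
    proof (rule poly_truncated_induct[where m = d])
      show "0 \<in> {f. poly_mat f (X + W) *\<^sub>v v - poly_mat f X *\<^sub>v v \<in> pN}"
        using act_0[OF Xc v] act_0[OF XWc v] submod_matD(2)[OF Xc pNX] by simp
      show "f + h \<in> {f. poly_mat f (X + W) *\<^sub>v v - poly_mat f X *\<^sub>v v \<in> pN}"
        if "f \<in> {f. poly_mat f (X + W) *\<^sub>v v - poly_mat f X *\<^sub>v v \<in> pN}"
          "h \<in> {f. poly_mat f (X + W) *\<^sub>v v - poly_mat f X *\<^sub>v v \<in> pN}" for f h
        using that vec_diff_add[OF Xc pNX, of "poly_mat f (X + W) *\<^sub>v v" _ "poly_mat h (X + W) *\<^sub>v v"]
          act_carrier[OF Xc v] act_carrier[OF XWc v]
        by (simp add: act_add_poly[OF Xc v] act_add_poly[OF XWc v])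
      show "Polynomial.smult a (monom 1 c) \<in> {f. poly_mat f (X + W) *\<^sub>v v - poly_mat f X *\<^sub>v v \<in> pN}"
        if "c < d" for a c
        using vec_diff_smult[OF Xc pNX pw[OF that] yV xV, of a]
        by (simp add: act_smult[OF Xc v] act_smult[OF XWc v] del: smult_monom)
      show "coeff R i = 0" if "i \<ge> d" for i
        using that monic coeff_eq_0[of P i] by (cases "i = d") (auto simp: R_def)
    qed
    thus ?thesis by simp
  qed
  have P: "P = monom 1 d + R" by (simp add: R_def)
  have c: "poly_mat R (X + W) *\<^sub>v v \<in> V" "poly_mat R X *\<^sub>v v \<in> V"
    using act_carrier[OF Xc v] act_carrier[OF XWc v] by auto
  have "(?y d + poly_mat R (X + W) *\<^sub>v v) - ((?x d + b) + poly_mat R X *\<^sub>v v) \<in> pN"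
    by (rule vec_diff_add[OF Xc pNX pd R]) (use xV yV bV c in auto)
  moreover have "(?x d + b) + poly_mat R X *\<^sub>v v = (?x d + poly_mat R X *\<^sub>v v) + b"
    unfolding assoc_add_vec[OF xV bV c(2)] assoc_add_vec[OF xV c(2) bV] comm_add_vec[OF bV c(2)] ..
  moreover have "poly_mat P (X + W) *\<^sub>v v = ?y d + poly_mat R (X + W) *\<^sub>v v"
    by (subst P) (rule act_add_poly[OF XWc v])
  moreover have "poly_mat P X *\<^sub>v v = ?x d + poly_mat R X *\<^sub>v v"
    by (subst P) (rule act_add_poly[OF Xc v])
  ultimately show ?thesis by simp
qed

lemma mat_col_mem:
  assumes W: "W \<in> carrier_mat n n" and e: "\<And>j. j < n \<Longrightarrow> W *\<^sub>v unit_vec n j \<in> M" and v: "v \<in> V"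
  shows "W *\<^sub>v v \<in> M"
proof -
  note MD = submod_matD[OF X1c submod_M[OF X1_commuting]]
  have "v \<in> {v \<in> V. W *\<^sub>v v \<in> M}"
  proof (rule vec_span_induct[OF _ _ _ _ v])
    have "W *\<^sub>v (0 \<cdot>\<^sub>v 0\<^sub>v n) = 0 \<cdot>\<^sub>v (W *\<^sub>v 0\<^sub>v n)" using W by (intro mat_mult_smult_vec) auto
    hence "W *\<^sub>v 0\<^sub>v n = 0\<^sub>v n" using W by simp
    thus "0\<^sub>v n \<in> {v \<in> V. W *\<^sub>v v \<in> M}" using MD(2) by simp
    show "v + w \<in> {v \<in> V. W *\<^sub>v v \<in> M}"
      if "v \<in> {v \<in> V. W *\<^sub>v v \<in> M}" "w \<in> {v \<in> V. W *\<^sub>v v \<in> M}" for v w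
      using that MD(4) by (simp add: mult_add_distrib_mat_vec[OF W])
    show "a \<cdot>\<^sub>v v \<in> {v \<in> V. W *\<^sub>v v \<in> M}" if vv: "v \<in> {v \<in> V. W *\<^sub>v v \<in> M}" for a v
    proof -
      have "W *\<^sub>v (a \<cdot>\<^sub>v v) = a \<cdot>\<^sub>v (W *\<^sub>v v)" using W vv by (intro mat_mult_smult_vec) auto
      thus ?thesis using vv MD(5) by simp
    qed
  qed (use e in auto)
  thus ?thesis by simp
qed

lemma commuting_add:
  assumes X: "X \<in> commuting" and W: "W \<in> carrier_mat n n" and WM: "\<And>v. v \<in> V \<Longrightarrow> W *\<^sub>v v \<in> M"
  shows "X + W \<in> commuting"
proof -
  note Xc = commutingD(1)[OF X]
  have XWc: "X + W \<in> carrier_mat n n" using Xc W by auto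
  have eq: "(X + W) *\<^sub>v v = X *\<^sub>v v + W *\<^sub>v v" if "v \<in> V" for v
    by (rule add_mult_distrib_mat_vec[OF Xc W that])
  have "X + W \<in> lifts" using WM M_subset by (intro lifts_add[OF commutingD(2)[OF X] W]) auto
  moreover have "Fg ((X + W) *\<^sub>v v) = [:0, 1:] \<odot>\<^bsub>G\<^esub> Fg v" if v: "v \<in> V" for v
  proof -
    have c: "X *\<^sub>v v \<in> V" "W *\<^sub>v v \<in> V" using Xc W v by auto
    have "Fg (W *\<^sub>v v) = \<zero>\<^bsub>G\<^esub>" using WM[OF v] M_subset(1) by (auto simp: N_def)
    thus ?thesis unfolding eq[OF v] Fg_add[OF c] commutingD(3)[OF X v]
      using cring_moduleD(2)[OF G Fg_closed] abelian_monoid.r_zero[OF abelian_group.axioms(1)[OF gD(1)]] by simp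
  qed
  ultimately show ?thesis by (simp add: commuting_def)
qed

lemma finite_commuting: "finite commuting"
  by (rule finite_subset[of _ "carrier_mat n n"]) (auto simp: finite_card_carrier_mat commutingD(1))

lemma card_commuting: "card commuting = card M ^ n"
proof -
  let ?f = "\<lambda>c. X1 + mat_of_columns n c"
  have e: "mat_of_columns n c *\<^sub>v unit_vec n j = c j" if "c \<in> {..<n} \<rightarrow>\<^sub>E M" "j < n" for c j
    using that M_subset by (intro mat_of_columns_unit) auto
  have e': "?f c *\<^sub>v unit_vec n j = X1 *\<^sub>v unit_vec n j + c j" if "c \<in> {..<n} \<rightarrow>\<^sub>E M" "j < n" for c j
    using e[OF that] add_mult_distrib_mat_vec[OF X1c mat_of_columns_carrier, of "unit_vec n j" c] by simp
  have "bij_betw ?f ({..<n} \<rightarrow>\<^sub>E M) commuting"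
  proof (rule bij_betw_imageI)
    show "inj_on ?f ({..<n} \<rightarrow>\<^sub>E M)"
    proof (rule inj_onI, rule ext)
      fix c c' j assume c: "c \<in> {..<n} \<rightarrow>\<^sub>E M" "c' \<in> {..<n} \<rightarrow>\<^sub>E M" and eq: "?f c = ?f c'"
      show "c j = c' j"
      proof (cases "j < n")
        case True
        have cc: "c j \<in> V" "c' j \<in> V" "X1 *\<^sub>v unit_vec n j \<in> V" using c True M_subset X1c by auto
        have x: "X1 *\<^sub>v unit_vec n j + c j = X1 *\<^sub>v unit_vec n j + c' j"
          using e'[OF c(1) True] e'[OF c(2) True] eq by simp
        have "c j = (X1 *\<^sub>v unit_vec n j + c j) - X1 *\<^sub>v unit_vec n j"
          by (rule vec_add_diff_cancel(1)[OF cc(3,1,1), symmetric])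
        also have "\<dots> = c' j" unfolding x by (rule vec_add_diff_cancel(1)[OF cc(3,2,2)])
        finally show ?thesis .
      next
        case False
        thus ?thesis using PiE_arb[OF c(1), of j] PiE_arb[OF c(2), of j] by simp
      qed
    qed
    show "?f ` ({..<n} \<rightarrow>\<^sub>E M) = commuting"
    proof (intro equalityI subsetI)
      fix X assume "X \<in> ?f ` ({..<n} \<rightarrow>\<^sub>E M)"
      then obtain c where c: "c \<in> {..<n} \<rightarrow>\<^sub>E M" "X = ?f c" by blast
      have "mat_of_columns n c *\<^sub>v v \<in> M" if "v \<in> V" for v
        by (rule mat_col_mem[OF mat_of_columns_carrier _ that]) (use e[OF c(1)] c(1) in auto)
      thus "X \<in> commuting" unfolding c(2) by (intro commuting_add[OF X1_commuting mat_of_columns_carrier])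
    next
      fix X assume X: "X \<in> commuting"
      define c where "c = restrict (\<lambda>j. X *\<^sub>v unit_vec n j - X1 *\<^sub>v unit_vec n j) {..<n}"
      have c: "c \<in> {..<n} \<rightarrow>\<^sub>E M" using commuting_diff[OF X X1_commuting] by (auto simp: c_def)
      have "X = ?f c"
      proof (rule mat_eq_unitI[OF commutingD(1)[OF X]])
        show "?f c \<in> carrier_mat n n" using X1c by simp
        fix j assume j: "j < n"
        have "X *\<^sub>v unit_vec n j = X1 *\<^sub>v unit_vec n j + (X *\<^sub>v unit_vec n j - X1 *\<^sub>v unit_vec n j)"
          using X1c commutingD(1)[OF X] by (intro eq_vecI) auto
        thus "X *\<^sub>v unit_vec n j = ?f c *\<^sub>v unit_vec n j" unfolding e'[OF c j] using j by (simp add: c_def)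
      qed
      thus "X \<in> ?f ` ({..<n} \<rightarrow>\<^sub>E M)" using c by blast
    qed
  qed
  from bij_betw_same_card[OF this] show ?thesis by (simp add: card_PiE)
qed

text \<open>
  By \<open>redv_N\<close> and \<open>U_decompose\<close> one has \<open>N = P(X) A\<^sup>n + M\<close>, so by Nakayama equality holds iff every
  element of \<open>M\<close> is in \<open>P(X) A\<^sup>n\<close> modulo \<open>pN\<close>.  If \<open>P(X) a\<close> is in \<open>M\<close>, then \<open>a\<close> is in \<open>Vk\<close>, which is
  generated by \<open>vs\<close> and \<open>p A\<^sup>n\<close>, and \<open>P(X)\<close> maps \<open>p A\<^sup>n\<close> into \<open>pN\<close>.
\<close>

lemma kernel_iff_gen:
  assumes ind: "indep (mat_module X1) (pvec n) vs" and gen_vs: "gen (mat_module X1) (pvec n) vs = Vk"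
    and X: "X \<in> commuting"
  shows "(\<lambda>v. poly_mat P X *\<^sub>v v) ` V = N
    \<longleftrightarrow> gen (mat_module X1) pN (map (\<lambda>v. poly_mat P X *\<^sub>v v) vs) = M"
proof -
  let ?P = "\<lambda>v. poly_mat P X *\<^sub>v v" and ?vs = "map (\<lambda>v. poly_mat P X *\<^sub>v v) vs"
  let ?K = "gen (mat_module X1) pN ?vs"
  note Xc = commutingD(1)[OF X] and mm = mat_module[OF X1c]
  note sM = submod_M[OF X1_commuting] and spN = submod_pN[OF X1_commuting] and spv = submod_pvec[OF X1c]
  note MD = submod_matD[OF X1c sM]
  have vsV: "set vs \<subseteq> V" using indep_carrier[OF ind] by (simp add: simps)
  have vsk: "set vs \<subseteq> Vk" using set_subset_gen[OF mm spv, of vs] vsV gen_vs by (simp add: simps)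
  have PM: "?P v \<in> M" if "v \<in> Vk" for v
    using Vk_iff[OF commutingD(2)[OF X], of v] act_P_mem_N[OF X, of v] that by (auto simp: M_def Vk_def)
  have vsM: "set ?vs \<subseteq> M" using vsk PM by auto
  hence vsc: "set ?vs \<subseteq> carrier (mat_module X1)" using M_subset(3) by (auto simp: simps)
  have K: "submod ?K (mat_module X1)" "pN \<subseteq> ?K" "set ?vs \<subseteq> ?K" "?K \<subseteq> M"
    using submod_gen[OF mm spN vsc] gen_superset[OF mm spN vsc] set_subset_gen[OF mm spN vsc]
      gen_subset[OF mm sM pN_subset_M vsM] by auto
  note KD = submod_matD[OF X1c K(1)]
  have Padd: "?P (v + w) = ?P v + ?P w" if "v \<in> V" "w \<in> V" for v w using act_add_vec[OF Xc that] .
  have Psm: "?P (a \<cdot>\<^sub>v v) = a \<cdot>\<^sub>v ?P v" if "v \<in> V" for a v using act_smult_vec[OF Xc that] .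
  have PV: "?P v \<in> V" if "v \<in> V" for v using act_carrier[OF Xc that] .
  have P0: "?P (0\<^sub>v n) = 0\<^sub>v n" by (rule act_zero[OF Xc])
  have Ppvec: "?P b \<in> pN" if "b \<in> pvec n" for b
    using act_P_mem_N[OF X] that by (intro mult_pvec_pN poly_mat_carrier[OF Xc]) auto
  show ?thesis
  proof
    assume im: "?P ` V = N"
    have S: "submod {a \<in> Vk. ?P a \<in> ?K} (mat_module X1)"
    proof (rule submod_matI[OF X1c])
      note VkD = submod_matD[OF X1c submod_Vk]
      show "{a \<in> Vk. ?P a \<in> ?K} \<subseteq> V" by (auto simp: Vk_def)
      show "0\<^sub>v n \<in> {a \<in> Vk. ?P a \<in> ?K}" using VkD(2) KD(2) P0 by simp
      fix v assume v: "v \<in> {a \<in> Vk. ?P a \<in> ?K}"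
      hence vV: "v \<in> V" by (simp add: Vk_def)
      show "a \<cdot>\<^sub>v v \<in> {a \<in> Vk. ?P a \<in> ?K}" for a using v VkD(5) KD(5) Psm[OF vV] by simp
      show "v + w \<in> {a \<in> Vk. ?P a \<in> ?K}" if "w \<in> {a \<in> Vk. ?P a \<in> ?K}" for w
        using v that VkD(4) KD(4) Padd[OF vV, of w] by (simp add: Vk_def)
      have X1v: "X1 *\<^sub>v v \<in> V" "X *\<^sub>v v \<in> V" using X1c Xc vV by auto
      have pM: "?P v \<in> M" using PM v by simp
      have c: "X1 *\<^sub>v ?P v \<in> V" "X *\<^sub>v ?P v \<in> V" "?P (X1 *\<^sub>v v) \<in> V"
        using X1c Xc PV vV X1v by auto
      have d1: "?P (X1 *\<^sub>v v) - ?P (X *\<^sub>v v) \<in> pN"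
      proof -
        have "?P (X1 *\<^sub>v v - X *\<^sub>v v) \<in> pN" using commuting_diff[OF X1_commuting X vV] M_subset(2) by (intro Ppvec) auto
        thus ?thesis using mult_minus_distrib_mat_vec[OF poly_mat_carrier[OF Xc] X1v] by simp
      qed
      have d2: "?P (X *\<^sub>v v) - X1 *\<^sub>v ?P v \<in> pN"
        using commuting_diff_M[OF X X1_commuting pM] act_commute[OF Xc vV] by simp
      have "?P (X1 *\<^sub>v v) - X1 *\<^sub>v ?P v \<in> pN"
        by (rule vec_diff_trans[OF X1c spN d1 d2 c(3) PV[OF X1v(2)] c(1)])
      hence "?P (X1 *\<^sub>v v) \<in> ?K" using vec_diff_mem[OF X1c K(1) _ _ c(3)] K(2) KD(6)[of "?P v"] v by auto
      thus "X1 *\<^sub>v v \<in> {a \<in> Vk. ?P a \<in> ?K}" using VkD(6) v by simp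
    qed
    have "gen (mat_module X1) (pvec n) vs \<subseteq> {a \<in> Vk. ?P a \<in> ?K}"
      using pvec_Vk Ppvec K(2,3) vsk by (intro gen_subset[OF mm S]) auto
    hence Vk: "\<And>a. a \<in> Vk \<Longrightarrow> ?P a \<in> ?K" using gen_vs by blast
    have "M \<subseteq> ?K"
    proof
      fix m assume m: "m \<in> M"
      hence "m \<in> ?P ` V" using im M_subset(1) by blast
      then obtain a where a: "a \<in> V" "m = ?P a" by blast
      hence "a \<in> Vk" using Vk_iff[OF commutingD(2)[OF X] a(1)] m M_subset(2) by auto
      thus "m \<in> ?K" using Vk a by blast
    qed
    thus "?K = M" using K(4) by blast
  next
    assume gen: "?K = M"
    \<comment> \<open>The image of \<open>P(X)\<close> plus \<open>pN\<close>; inside \<open>M\<close> it is stable under \<open>X1\<close>, as \<open>X - X1\<close> maps \<open>M\<close> into \<open>pN\<close>.\<close>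
    let ?Y = "{y \<in> V. \<exists>a\<in>V. y - ?P a \<in> pN}"
    have S: "submod (?Y \<inter> M) (mat_module X1)"
    proof (rule submod_matI[OF X1c])
      have "0\<^sub>v n - ?P (0\<^sub>v n) \<in> pN" using P0 submod_matD(2)[OF X1c spN] by simp
      moreover have "0\<^sub>v n \<in> V" by simp
      ultimately show "0\<^sub>v n \<in> ?Y \<inter> M" using MD(2) by blast
      fix y assume y: "y \<in> ?Y \<inter> M"
      then obtain a where a: "a \<in> V" "y - ?P a \<in> pN" "y \<in> V" "y \<in> M" by blast
      show "s \<cdot>\<^sub>v y \<in> ?Y \<inter> M" for s
        using vec_diff_smult[OF X1c spN a(2,3) PV[OF a(1)], of s] Psm[OF a(1), of s] MD(5)[OF a(4), of s] a(1,3)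
        by (auto intro!: bexI[of _ "s \<cdot>\<^sub>v a"])
      show "y + w \<in> ?Y \<inter> M" if w: "w \<in> ?Y \<inter> M" for w
      proof -
        obtain b where b: "b \<in> V" "w - ?P b \<in> pN" "w \<in> V" "w \<in> M" using w by blast
        have "(y + w) - (?P a + ?P b) \<in> pN"
          by (rule vec_diff_add[OF X1c spN a(2) b(2) a(3) PV[OF a(1)] b(3) PV[OF b(1)]])
        thus ?thesis using Padd[OF a(1) b(1)] MD(4)[OF a(4) b(4)] a b by (auto intro!: bexI[of _ "a + b"])
      qed
      have c: "X1 *\<^sub>v y \<in> V" "X *\<^sub>v y \<in> V" "X *\<^sub>v a \<in> V" using X1c Xc a by auto
      have "X1 *\<^sub>v y - X *\<^sub>v y \<in> pN" by (rule commuting_diff_M[OF X1_commuting X a(4)])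
      moreover have "X *\<^sub>v y - ?P (X *\<^sub>v a) \<in> pN"
        using vec_diff_mult[OF Xc submod_pN[OF X] a(2,3) PV[OF a(1)]] act_commute[OF Xc a(1)] by simp
      ultimately have "X1 *\<^sub>v y - ?P (X *\<^sub>v a) \<in> pN"
        by (rule vec_diff_trans[OF X1c spN _ _ c(1,2) PV[OF c(3)]])
      thus "X1 *\<^sub>v y \<in> ?Y \<inter> M" using c MD(6)[OF a(4)] by blast
    qed (use M_subset in auto)
    have "?K \<subseteq> ?Y \<inter> M"
    proof (rule gen_subset[OF mm S])
      show "pN \<subseteq> ?Y \<inter> M"
      proof
        fix y assume y: "y \<in> pN"
        have "y \<in> M" "y \<in> V" using y pN_subset_M M_subset by auto
        moreover have "y - ?P (0\<^sub>v n) \<in> pN" unfolding P0 using y \<open>y \<in> V\<close> by simp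
        moreover have "0\<^sub>v n \<in> V" by simp
        ultimately show "y \<in> ?Y \<inter> M" by blast
      qed
      show "set ?vs \<subseteq> ?Y \<inter> M"
        using vsV vsM vec_diff_self[OF X1c spN PV] PV by (auto simp: subset_iff)
    qed
    hence MY: "M \<subseteq> ?Y" using gen by blast
    have "N \<subseteq> ?P ` V"
    proof (rule nakayama[OF submod_N[OF X1_commuting]])
      show "?P ` V \<subseteq> N" using act_P_mem_N[OF X] by auto
      show "x \<oplus>\<^bsub>mat_module X1\<^esub> y \<in> ?P ` V" if xy: "x \<in> ?P ` V" "y \<in> ?P ` V" for x y
      proof -
        obtain a b where "a \<in> V" "b \<in> V" "x = ?P a" "y = ?P b" using xy by blast
        thus ?thesis using Padd[of a b] by (auto simp: simps intro!: image_eqI[of _ _ "a + b"])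
      qed
      show "[:s:] \<odot>\<^bsub>mat_module X1\<^esub> x \<in> ?P ` V" if x: "x \<in> ?P ` V" for s x
      proof -
        obtain a where a: "a \<in> V" "x = ?P a" using x by blast
        have "[:s:] \<odot>\<^bsub>mat_module X1\<^esub> x = ?P (s \<cdot>\<^sub>v a)"
          unfolding a(2) Psm[OF a(1)] simps using act_const[OF X1c PV[OF a(1)]] by simp
        thus ?thesis using a(1) by auto
      qed
      fix z assume z: "z \<in> N"
      hence zV: "z \<in> V" using N_carrier by blast
      have "redv z \<in> Ubar" using redv_N z by blast
      hence "z \<in> U" using zV by (simp add: U_def)
      then obtain w b where wb: "w \<in> V" "b \<in> pvec n" "z = ?P w + b" using U_decompose[OF commutingD(2)[OF X]] by blast
      have bV: "b \<in> V" using wb(2) pvec_carrier by blast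
      have "z - ?P w = b" unfolding wb(3) by (rule vec_add_diff_cancel(1)[OF PV[OF wb(1)] bV bV])
      moreover have "z - ?P w \<in> N"
        by (rule submod_matD(8)[OF X1c submod_N[OF X1_commuting] z act_P_mem_N[OF X wb(1)]])
      ultimately have "b \<in> M" using wb(2) by (simp add: M_def)
      then obtain a where a: "a \<in> V" "b - ?P a \<in> pN" using MY by blast
      then obtain y where y: "y \<in> N" "b - ?P a = of_nat p \<cdot>\<^sub>v y" by (auto simp: pN_def)
      have yV: "y \<in> V" using y(1) N_carrier by blast
      have "z = ?P (w + a) + (b - ?P a)"
        unfolding wb(3) Padd[OF wb(1) a(1)] by (rule vec_add_diff_cancel(2)[OF PV[OF wb(1)] bV PV[OF a(1)]])
      also have "b - ?P a = [:of_nat p:] \<odot>\<^bsub>mat_module X1\<^esub> y" unfolding y(2) pvec_act[OF X1c yV] ..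
      finally have zeq: "z = ?P (w + a) \<oplus>\<^bsub>mat_module X1\<^esub> [:of_nat p:] \<odot>\<^bsub>mat_module X1\<^esub> y" by (simp add: simps)
      show "\<exists>i\<in>?P ` V. \<exists>y\<in>N. z = i \<oplus>\<^bsub>mat_module X1\<^esub> [:of_nat p:] \<odot>\<^bsub>mat_module X1\<^esub> y"
        using zeq y(1) imageI[OF add_carrier_vec[OF wb(1) a(1)], of ?P] by blast
    qed
    thus "?P ` V = N" using act_P_mem_N[OF X] by auto
  qed
qed

lemma card_good_lifts_aux:
  "card M ^ r * card {X \<in> commuting. (\<lambda>v. poly_mat P X *\<^sub>v v) ` V = N}
    = card M ^ n * card {b. length b = r \<and> set b \<subseteq> M \<and> gen (mat_module X1) pN b = M}"
proof -
  note mm = mat_module[OF X1c] and sM = submod_M[OF X1_commuting] and spN = submod_pN[OF X1_commuting]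
  note MD = submodD[OF sM]
  obtain vs where vs: "indep (mat_module X1) (pvec n) vs" "gen (mat_module X1) (pvec n) vs = Vk"
    "length vs = r" "set vs \<subseteq> Vk" using ex_basis_Vk .
  have vsV: "set vs \<subseteq> V" using vs(4) by (auto simp: Vk_def)
  let ?Z = "{b. length b = r \<and> set b \<subseteq> M \<and> gen (mat_module X1) pN b = M}"
  let ?E = "\<lambda>X. map (\<lambda>v. poly_mat P X *\<^sub>v v) vs"
  have MV: "x \<in> carrier (mat_module X1)" if "x \<in> M" for x using that M_subset by (auto simp: simps)
  have "card M ^ r * card {X \<in> commuting. ?E X \<in> ?Z} = card commuting * card ?Z"
  proof (rule uniform_evaluation[where H = pN and M = "mat_module X1"])
    show "abelian_group (mat_module X1)" by (rule cring_moduleD(1)[OF mm])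
    show "\<And>x y. x \<in> M \<Longrightarrow> y \<in> M \<Longrightarrow> x \<oplus>\<^bsub>mat_module X1\<^esub> y \<in> M" by (rule MD(5))
    show "\<And>x. x \<in> M \<Longrightarrow> \<ominus>\<^bsub>mat_module X1\<^esub> x \<in> M" by (rule MD(7))
    show "M \<subseteq> carrier (mat_module X1)" using MV by blast
    show "finite M" by (rule fin)
    show "finite commuting" by (rule finite_commuting)
    have PM: "poly_mat P X *\<^sub>v v \<in> M" if "X \<in> commuting" "v \<in> Vk" for X v
      using Vk_iff[OF commutingD(2)[OF that(1)], of v] act_P_mem_N[OF that(1), of v] that(2) by (auto simp: M_def Vk_def)
    show "length (?E X) = r \<and> set (?E X) \<subseteq> M" if "X \<in> commuting" for X using PM[OF that] vs(3,4) by auto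
    show "\<And>b. b \<in> ?Z \<Longrightarrow> length b = r \<and> set b \<subseteq> M" by auto
    fix b :: "'a mod_ring vec list" assume b: "length b = r" "set b \<subseteq> M"
    have lb: "length b = length vs" using b(1) vs(3) by simp
    obtain W where W: "W \<in> carrier_mat n n" "\<And>v. v \<in> V \<Longrightarrow> W *\<^sub>v v \<in> M"
      "\<And>i c. i < length vs \<Longrightarrow> Suc c < d \<Longrightarrow> W *\<^sub>v (poly_mat (monom 1 c) X1 *\<^sub>v (vs ! i)) \<in> pN"
      "\<And>i. i < length vs \<Longrightarrow> W *\<^sub>v (poly_mat (monom 1 (d - 1)) X1 *\<^sub>v (vs ! i)) - b ! i \<in> pN"
      by (rule ex_matrix_with_values[OF vs(1,4) lb b(2)]) blast
    show "\<exists>\<tau>. bij_betw \<tau> commuting commuting \<and> (\<forall>X\<in>commuting. \<forall>i<r.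
        ?E (\<tau> X) ! i \<ominus>\<^bsub>mat_module X1\<^esub> (?E X ! i \<oplus>\<^bsub>mat_module X1\<^esub> b ! i) \<in> pN)"
    proof (intro exI[of _ "\<lambda>X. X + W"] conjI ballI allI impI)
      have "(\<lambda>X. X + W) ` commuting \<subseteq> commuting" using commuting_add[OF _ W(1,2)] by auto
      moreover have "inj_on (\<lambda>X. X + W) commuting"
      proof (rule inj_onI)
        fix X Y assume XY: "X \<in> commuting" "Y \<in> commuting" "X + W = Y + W"
        have "(Z + W) - W = Z" if "Z \<in> commuting" for Z using commutingD(1)[OF that] W(1) by (intro eq_matI) auto
        thus "X = Y" using XY by metis
      qed
      ultimately show "bij_betw (\<lambda>X. X + W) commuting commuting"
        using endo_inj_surj[OF finite_commuting] by (auto simp: bij_betw_def)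
      fix X i assume X: "X \<in> commuting" and i: "i < r"
      have vi: "vs ! i \<in> V" "vs ! i \<in> Vk" using i vs(3,4) vsV nth_mem[of i vs] by blast+
      have bi: "b ! i \<in> M" using b nth_mem[of i b] i by blast
      have iv: "i < length vs" using i vs(3) by simp
      have "poly_mat P (X + W) *\<^sub>v (vs ! i) - (poly_mat P X *\<^sub>v (vs ! i) + b ! i) \<in> pN"
        by (rule perturbation[OF X W(1,2) vi(1) bi W(3)[OF iv] W(4)[OF iv] commuting_add[OF X W(1,2)]])
      moreover have c: "poly_mat P (X + W) *\<^sub>v (vs ! i) \<in> V" "poly_mat P X *\<^sub>v (vs ! i) + b ! i \<in> V"
        using act_carrier[OF commutingD(1)[OF commuting_add[OF X W(1,2)]] vi(1)] act_carrier[OF commutingD(1)[OF X] vi(1)] bi M_subset(3)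
        by auto
      ultimately show "?E (X + W) ! i \<ominus>\<^bsub>mat_module X1\<^esub> (?E X ! i \<oplus>\<^bsub>mat_module X1\<^esub> b ! i) \<in> pN"
        using mat_module_minus(2)[OF X1c c(2,1)] iv by (simp add: simps)
    qed
  next
    fix b c :: "'a mod_ring vec list" assume bc: "length b = r" "length c = r" "set b \<subseteq> M" "set c \<subseteq> M"
      "\<And>i. i < r \<Longrightarrow> b ! i \<ominus>\<^bsub>mat_module X1\<^esub> c ! i \<in> pN"
    have "gen (mat_module X1) pN b = gen (mat_module X1) pN c"
      using bc MV by (intro gen_cong[OF spN]) auto
    thus "b \<in> ?Z \<longleftrightarrow> c \<in> ?Z" using bc by simp
  qed
  moreover have "{X \<in> commuting. ?E X \<in> ?Z} = {X \<in> commuting. (\<lambda>v. poly_mat P X *\<^sub>v v) ` V = N}"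
  proof (rule Collect_cong, rule conj_cong[OF refl])
    fix X assume X: "X \<in> commuting"
    have "set (?E X) \<subseteq> M"
      using Vk_iff[OF commutingD(2)[OF X]] act_P_mem_N[OF X] vs(4) by (auto simp: M_def Vk_def subset_iff)
    thus "?E X \<in> ?Z \<longleftrightarrow> (\<lambda>v. poly_mat P X *\<^sub>v v) ` V = N"
      using kernel_iff_gen[OF vs(1,2) X] vs(3) by simp
  qed
  ultimately show ?thesis by (simp add: card_commuting)
qed

lemma card_good_lifts:
  "real (card {X \<in> commuting. (\<lambda>v. poly_mat P X *\<^sub>v v) ` V = N}) * real q ^ ((r - u) * r)
    = real (card M) ^ n * (\<Prod>i<r - u. real q ^ r - real q ^ i)"
proof -
  note sM = submod_M[OF X1_commuting] and spN = submod_pN[OF X1_commuting]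
  have J: "j \<odot>\<^bsub>mat_module X1\<^esub> y \<in> pN" if y: "y \<in> M" and j: "j \<in> J" for y j
  proof -
    obtain a b where ab: "j = a * P + [:of_nat p:] * b" using j mem_J_iff by blast
    have yV: "y \<in> V" using y M_subset by blast
    obtain w where w: "w \<in> V" "y = of_nat p \<cdot>\<^sub>v w" using y M_subset(2) by (auto simp: pvec_def)
    have "poly_mat P X1 *\<^sub>v y = of_nat p \<cdot>\<^sub>v (poly_mat P X1 *\<^sub>v w)" unfolding w(2) by (rule act_smult_vec[OF X1c w(1)])
    hence 1: "poly_mat P X1 *\<^sub>v y \<in> pN" using pN_mem[OF act_P_mem_N[OF X1_commuting w(1)]] by simp
    have "poly_mat b X1 *\<^sub>v y \<in> N"
      using submod_matD(7)[OF X1c submod_N[OF X1_commuting]] y M_subset(1) by blast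
    hence 2: "of_nat p \<cdot>\<^sub>v (poly_mat b X1 *\<^sub>v y) \<in> pN" by (rule pN_mem)
    have "poly_mat j X1 *\<^sub>v y = poly_mat a X1 *\<^sub>v (poly_mat P X1 *\<^sub>v y) + of_nat p \<cdot>\<^sub>v (poly_mat b X1 *\<^sub>v y)"
      unfolding ab act_add_poly[OF X1c yV] act_mult[OF X1c yV] act_const[OF X1c act_carrier[OF X1c yV]] ..
    also have "\<dots> \<in> pN" using submod_matD(4,7)[OF X1c spN] 1 2 by blast
    finally show ?thesis by (simp add: simps)
  qed
  let ?Z = "{b. length b = r \<and> set b \<subseteq> M \<and> gen (mat_module X1) pN b = M}"
  let ?b = "\<Prod>i<r - u. real q ^ r - real q ^ i"
  define S where "S = real (card {X \<in> commuting. (\<lambda>v. poly_mat P X *\<^sub>v v) ` V = N})"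
  have Z: "real (card ?Z) = real (card pN) ^ r * ?b"
    using J finite_V[of n] by (intro card_generating_lists[OF spN sM pN_subset_M _ _ card_M]) (auto simp: simps)
  have "real (card M ^ r * card {X \<in> commuting. (\<lambda>v. poly_mat P X *\<^sub>v v) ` V = N}) = real (card M ^ n * card ?Z)"
    unfolding card_good_lifts_aux ..
  hence e: "real (card M) ^ r * S = real (card M) ^ n * (real (card pN) ^ r * ?b)"
    unfolding S_def of_nat_mult Z by simp
  have Mr: "real (card M) ^ r = real q ^ ((r - u) * r) * real (card pN) ^ r"
    unfolding card_M by (simp add: power_mult power_mult_distrib)
  have "real (card pN) ^ r * (S * real q ^ ((r - u) * r)) = real (card pN) ^ r * (real (card M) ^ n * ?b)"
    using e unfolding Mr by (simp add: mult_ac)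
  thus ?thesis using card_pos(3) unfolding S_def by simp
qed

end

section \<open>Quotient modules and change of scalars\<close>

context
  fixes N :: "'m set" and M :: "('c::comm_ring_1, 'm) module"
  assumes N: "submod N M"
begin

interpretation M: abelian_group M by (rule cring_moduleD[OF submodD(1)[OF N]])
private lemmas mD' = cring_moduleD[OF submodD(1)[OF N]]
private lemmas ND' = submodD[OF N]

lemma abelian_subgroup_submod: "abelian_subgroup N M"
proof (rule abelian_subgroupI3)
  show "abelian_group M" by (rule mD')
  show "additive_subgroup N M"
    using ND' by (intro additive_subgroup.intro subgroup.intro) (auto simp: a_inv_def[symmetric])
qed

interpretation NM: abelian_subgroup N M by (rule abelian_subgroup_submod)

lemma coset_eq_iff:
  assumes v: "v \<in> carrier M" and w: "w \<in> carrier M"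
  shows "N +>\<^bsub>M\<^esub> v = N +>\<^bsub>M\<^esub> w \<longleftrightarrow> v \<ominus>\<^bsub>M\<^esub> w \<in> N"
proof
  assume "N +>\<^bsub>M\<^esub> v = N +>\<^bsub>M\<^esub> w"
  hence "v \<in> N +>\<^bsub>M\<^esub> w" using NM.a_rcos_self[OF v] by simp
  then obtain x where x: "x \<in> N" "v = x \<oplus>\<^bsub>M\<^esub> w" by (auto simp: a_r_coset_def')
  hence "v \<ominus>\<^bsub>M\<^esub> w = x" using w ND'(4)[OF x(1)] by (simp add: a_minus_def M.a_assoc M.r_neg)
  thus "v \<ominus>\<^bsub>M\<^esub> w \<in> N" using x by simp
next
  assume d: "v \<ominus>\<^bsub>M\<^esub> w \<in> N"
  have "v = (v \<ominus>\<^bsub>M\<^esub> w) \<oplus>\<^bsub>M\<^esub> w" using v w by (simp add: a_minus_def M.a_assoc M.l_neg)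
  hence "v \<in> N +>\<^bsub>M\<^esub> w" using d by (auto simp: a_r_coset_def')
  from NM.a_repr_independence'[OF this w] show "N +>\<^bsub>M\<^esub> v = N +>\<^bsub>M\<^esub> w" ..
qed

lemma quot_module_simps:
  "carrier (quot_module M N) = (\<lambda>v. N +>\<^bsub>M\<^esub> v) ` carrier M" "\<zero>\<^bsub>quot_module M N\<^esub> = N"
  "v \<in> carrier M \<Longrightarrow> w \<in> carrier M \<Longrightarrow>
    (N +>\<^bsub>M\<^esub> v) \<oplus>\<^bsub>quot_module M N\<^esub> (N +>\<^bsub>M\<^esub> w) = N +>\<^bsub>M\<^esub> (v \<oplus>\<^bsub>M\<^esub> w)"
  "v \<in> carrier M \<Longrightarrow> a \<odot>\<^bsub>quot_module M N\<^esub> (N +>\<^bsub>M\<^esub> v) = N +>\<^bsub>M\<^esub> (a \<odot>\<^bsub>M\<^esub> v)"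
proof -
  show "carrier (quot_module M N) = (\<lambda>v. N +>\<^bsub>M\<^esub> v) ` carrier M"
    by (auto simp: quot_module_def A_RCOSETS_def')
  show "\<zero>\<^bsub>quot_module M N\<^esub> = N" by (simp add: quot_module_def)
  show "v \<in> carrier M \<Longrightarrow> w \<in> carrier M \<Longrightarrow>
    (N +>\<^bsub>M\<^esub> v) \<oplus>\<^bsub>quot_module M N\<^esub> (N +>\<^bsub>M\<^esub> w) = N +>\<^bsub>M\<^esub> (v \<oplus>\<^bsub>M\<^esub> w)"
    by (simp add: quot_module_def NM.a_rcos_sum)
  assume v: "v \<in> carrier M"
  have "N +>\<^bsub>M\<^esub> (a \<odot>\<^bsub>M\<^esub> x) = N +>\<^bsub>M\<^esub> (a \<odot>\<^bsub>M\<^esub> v)" if x: "x \<in> N +>\<^bsub>M\<^esub> v" for x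
  proof -
    obtain y where y: "y \<in> N" "x = y \<oplus>\<^bsub>M\<^esub> v" using x by (auto simp: a_r_coset_def')
    have c: "y \<in> carrier M" using ND'(4)[OF y(1)] .
    hence xc: "x \<in> carrier M" using y v by simp
    have "x \<ominus>\<^bsub>M\<^esub> v = y" using c v y by (simp add: a_minus_def M.a_assoc M.r_neg)
    hence "a \<odot>\<^bsub>M\<^esub> x \<ominus>\<^bsub>M\<^esub> a \<odot>\<^bsub>M\<^esub> v \<in> N" using diff_smult[OF N _ xc v, of a] y(1) by simp
    thus ?thesis using coset_eq_iff mD'(2) xc v by blast
  qed
  moreover have "N +>\<^bsub>M\<^esub> v \<noteq> {}" using NM.a_rcos_self[OF v] by blast
  ultimately have "(\<Union>x\<in>N +>\<^bsub>M\<^esub> v. N +>\<^bsub>M\<^esub> (a \<odot>\<^bsub>M\<^esub> x)) = N +>\<^bsub>M\<^esub> (a \<odot>\<^bsub>M\<^esub> v)"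
    by (intro SUP_eq_const) blast+
  thus "a \<odot>\<^bsub>quot_module M N\<^esub> (N +>\<^bsub>M\<^esub> v) = N +>\<^bsub>M\<^esub> (a \<odot>\<^bsub>M\<^esub> v)"
    by (simp add: quot_module_def)
qed

lemma quot_module: "cring_module (quot_module M N)"
proof (rule moduleI)
  show "cring (class_ring :: 'c ring)" by (rule class_cring.cring_axioms)
  have N0: "N = N +>\<^bsub>M\<^esub> \<zero>\<^bsub>M\<^esub>"
  proof (intro equalityI subsetI)
    fix x assume x: "x \<in> N"
    hence "x = x \<oplus>\<^bsub>M\<^esub> \<zero>\<^bsub>M\<^esub>" using ND'(4) by simp
    thus "x \<in> N +>\<^bsub>M\<^esub> \<zero>\<^bsub>M\<^esub>" using x unfolding a_r_coset_def' by blast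
  next
    fix x assume "x \<in> N +>\<^bsub>M\<^esub> \<zero>\<^bsub>M\<^esub>"
    then obtain y where "y \<in> N" "x = y \<oplus>\<^bsub>M\<^esub> \<zero>\<^bsub>M\<^esub>" by (auto simp: a_r_coset_def')
    thus "x \<in> N" using ND'(4) by simp
  qed
  show "abelian_group (quot_module M N)"
  proof (rule abelian_groupI)
    fix x assume "x \<in> carrier (quot_module M N)"
    then obtain v where v: "v \<in> carrier M" "x = N +>\<^bsub>M\<^esub> v" by (auto simp: quot_module_simps)
    show "\<zero>\<^bsub>quot_module M N\<^esub> \<oplus>\<^bsub>quot_module M N\<^esub> x = x"
      unfolding quot_module_simps(2) v(2) using quot_module_simps(3)[OF M.zero_closed v(1)] v(1) N0 by simp
    show "\<exists>y\<in>carrier (quot_module M N). y \<oplus>\<^bsub>quot_module M N\<^esub> x = \<zero>\<^bsub>quot_module M N\<^esub>"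
    proof
      show "(N +>\<^bsub>M\<^esub> (\<ominus>\<^bsub>M\<^esub> v)) \<oplus>\<^bsub>quot_module M N\<^esub> x = \<zero>\<^bsub>quot_module M N\<^esub>"
        unfolding v(2) quot_module_simps(2) using quot_module_simps(3)[OF M.a_inv_closed[OF v(1)] v(1)] v(1) N0
        by (simp add: M.l_neg)
    qed (use v in \<open>auto simp: quot_module_simps\<close>)
  next
    show "\<zero>\<^bsub>quot_module M N\<^esub> \<in> carrier (quot_module M N)"
      unfolding quot_module_simps(1,2) using N0 by blast
  qed (auto simp: quot_module_simps M.a_ac)
qed (auto simp: quot_module_simps mD')

lemma card_quot: "card (carrier (quot_module M N)) * card N = card (carrier M)"
proof -
  have "group (add_monoid M)" by (rule M.a_group)
  moreover have "subgroup N (add_monoid M)" by (rule NM.a_subgroup)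
  ultimately have "card (rcosets\<^bsub>add_monoid M\<^esub> N) * card N = order (add_monoid M)" by (rule group.lagrange)
  thus ?thesis by (simp add: quot_module_def A_RCOSETS_def order_def)
qed

end

text \<open>
  The module axioms over \<open>S\<close> are inherited along a surjection \<open>\<psi>\<close> through which the ring already
  acts.
\<close>

lemma module_of_surjection:
  fixes M :: "('c::comm_ring_1, 'm) module" and D :: "('s, 'm) module"
  assumes S: "cring S" and M: "cring_module M" and surj: "carrier S = range \<psi>"
    and hom: "\<And>a b. \<psi> (a + b) = \<psi> a \<oplus>\<^bsub>S\<^esub> \<psi> b" "\<And>a b. \<psi> (a * b) = \<psi> a \<otimes>\<^bsub>S\<^esub> \<psi> b" "\<psi> 1 = \<one>\<^bsub>S\<^esub>"
    and D: "carrier D = carrier M" "add D = add M" "\<zero>\<^bsub>D\<^esub> = \<zero>\<^bsub>M\<^esub>"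
    and sm: "\<And>a x. x \<in> carrier M \<Longrightarrow> \<psi> a \<odot>\<^bsub>D\<^esub> x = a \<odot>\<^bsub>M\<^esub> x"
  shows "Module.module S D"
proof (rule moduleI[OF S])
  note mD = cring_moduleD[OF M]
  interpret M: abelian_group M by (rule mD)
  show "abelian_group D"
    by (rule abelian_groupI) (auto simp: D M.a_ac intro: bexI[of _ "\<ominus>\<^bsub>M\<^esub> x" for x] M.l_neg)
  fix a b x y assume "a \<in> carrier S" "b \<in> carrier S" "x \<in> carrier D" "y \<in> carrier D"
  then obtain f g where fg: "a = \<psi> f" "b = \<psi> g" and xy: "x \<in> carrier M" "y \<in> carrier M" unfolding surj D by blast
  show "(a \<oplus>\<^bsub>S\<^esub> b) \<odot>\<^bsub>D\<^esub> x = a \<odot>\<^bsub>D\<^esub> x \<oplus>\<^bsub>D\<^esub> b \<odot>\<^bsub>D\<^esub> x"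
    unfolding fg hom[symmetric] by (simp add: sm xy D mD)
  show "(a \<otimes>\<^bsub>S\<^esub> b) \<odot>\<^bsub>D\<^esub> x = a \<odot>\<^bsub>D\<^esub> (b \<odot>\<^bsub>D\<^esub> x)"
    unfolding fg hom[symmetric] by (simp add: sm xy D mD)
next
  note mD = cring_moduleD[OF M]
  fix a x assume "a \<in> carrier S" "x \<in> carrier D"
  then obtain f where "a = \<psi> f" "x \<in> carrier M" unfolding surj D by blast
  thus "a \<odot>\<^bsub>D\<^esub> x \<in> carrier D" by (simp add: sm D mD)
next
  note mD = cring_moduleD[OF M]
  fix a x y assume "a \<in> carrier S" "x \<in> carrier D" "y \<in> carrier D"
  then obtain f where f: "a = \<psi> f" "x \<in> carrier M" "y \<in> carrier M" unfolding surj D by blast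
  have "x \<oplus>\<^bsub>M\<^esub> y \<in> carrier M" using f cring_moduleD(1)[OF M]
    by (simp add: abelian_monoid.a_closed abelian_group.axioms(1))
  thus "a \<odot>\<^bsub>D\<^esub> (x \<oplus>\<^bsub>D\<^esub> y) = a \<odot>\<^bsub>D\<^esub> x \<oplus>\<^bsub>D\<^esub> a \<odot>\<^bsub>D\<^esub> y" using f by (simp add: sm D mD)
next
  note mD = cring_moduleD[OF M]
  fix x assume "x \<in> carrier D"
  thus "\<one>\<^bsub>S\<^esub> \<odot>\<^bsub>D\<^esub> x = x" unfolding hom(3)[symmetric] by (simp add: sm D mD)
qed

lemma card_vectorspace:
  assumes "vectorspace K V" and finV: "finite (carrier V)"
  shows "card (carrier V) = card (carrier K) ^ vectorspace.dim K V"
proof -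
  interpret vectorspace K V by fact
  have "gen_set (carrier V)"
    using in_own_span[of "carrier V"] span_is_subset2[of "carrier V"] by auto
  hence "fin_dim" unfolding fin_dim_def using finV by (intro exI[of _ "carrier V"] conjI) simp_all
  then obtain B where B: "finite B" "basis B" using finite_basis_exists by blast
  have Bc: "B \<subseteq> carrier V" using B(2) by (simp add: basis_def)
  have ex1: "\<And>v. v \<in> carrier V \<Longrightarrow> \<exists>!a. a \<in> B \<rightarrow>\<^sub>E carrier K \<and> lincomb a B = v"
    using basis_criterion[OF B(1) Bc] B(2) by blast
  have cl: "lincomb a B \<in> carrier V" if "a \<in> B \<rightarrow>\<^sub>E carrier K" for a
    using that Bc B(1) by (intro lincomb_closed) auto
  have "bij_betw (\<lambda>a. lincomb a B) (B \<rightarrow>\<^sub>E carrier K) (carrier V)"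
  proof (rule bij_betw_imageI)
    show "inj_on (\<lambda>a. lincomb a B) (B \<rightarrow>\<^sub>E carrier K)"
      using ex1 cl by (intro inj_onI) blast
    show "(\<lambda>a. lincomb a B) ` (B \<rightarrow>\<^sub>E carrier K) = carrier V" using ex1 cl by blast
  qed
  from bij_betw_same_card[OF this] show ?thesis using B(1) dim_basis[OF B] by (simp add: card_PiE)
qed

section \<open>The quotient ring \<open>A[t]/(P)\<close>\<close>

abbreviation proj :: "'a::comm_ring_1 poly \<Rightarrow> 'a poly \<Rightarrow> 'a poly set" where
  "proj P f \<equiv> (PIdl\<^bsub>class_ring\<^esub> P) +>\<^bsub>class_ring\<^esub> f"

lemma ideal_PIdl: "ideal (PIdl\<^bsub>class_ring\<^esub> P) (class_ring :: 'a::comm_ring_1 poly ring)"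
  by (rule cring.cgenideal_ideal[OF class_cring.cring_axioms]) simp

lemma mem_PIdl: "f \<in> PIdl\<^bsub>(class_ring :: 'a::comm_ring_1 poly ring)\<^esub> P \<longleftrightarrow> P dvd f"
  by (auto simp: cgenideal_def dvd_def mult.commute)

lemma proj_eq: "proj P f = {g. P dvd g - f}"
proof -
  have "proj P f = {h + f | h. P dvd h}" by (auto simp: a_r_coset_def' mem_PIdl)
  also have "\<dots> = {g. P dvd g - f}" by (force intro: exI[of _ "g - f" for g])
  finally show ?thesis .
qed

lemma proj_eq_iff: "proj P f = proj P g \<longleftrightarrow> P dvd f - g"
proof
  assume "proj P f = proj P g"
  moreover have "f \<in> proj P f" by (simp add: proj_eq)
  ultimately show "P dvd f - g" by (simp add: proj_eq)
next
  assume d: "P dvd f - g"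
  have "P dvd h - f \<longleftrightarrow> P dvd h - g" for h
    using dvd_add_left_iff[OF d, of "h - f"] by (simp add: algebra_simps)
  thus "proj P f = proj P g" by (simp add: proj_eq)
qed

lemma proj_add: "proj P (f + g) = proj P f \<oplus>\<^bsub>poly_quot P\<^esub> proj P g"
  and proj_mult: "proj P (f * g) = proj P f \<otimes>\<^bsub>poly_quot P\<^esub> proj P g"
  and proj_one: "proj P 1 = \<one>\<^bsub>poly_quot P\<^esub>"
proof -
  have h: "proj P \<in> Ring.ring_hom class_ring (poly_quot P)"
    unfolding poly_quot_def by (rule ideal.rcos_ring_hom[OF ideal_PIdl])
  show "proj P (f + g) = proj P f \<oplus>\<^bsub>poly_quot P\<^esub> proj P g" using Ring.ring_hom_add[OF h, of f g] by simp
  show "proj P (f * g) = proj P f \<otimes>\<^bsub>poly_quot P\<^esub> proj P g" using Ring.ring_hom_mult[OF h, of f g] by simp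
  show "proj P 1 = \<one>\<^bsub>poly_quot P\<^esub>" using Ring.ring_hom_one[OF h] by simp
qed

lemma carrier_poly_quot: "carrier (poly_quot P) = range (proj P)"
  by (auto simp: poly_quot_def FactRing_def A_RCOSETS_def')

lemma zero_poly_quot: "\<zero>\<^bsub>poly_quot P\<^esub> = proj P 0"
proof -
  have "\<zero>\<^bsub>poly_quot P\<^esub> = {f. P dvd f}" by (auto simp: poly_quot_def FactRing_def mem_PIdl)
  thus ?thesis by (simp add: proj_eq)
qed

lemma cring_poly_quot: "cring (poly_quot (P :: 'a::comm_ring_1 poly))"
  unfolding poly_quot_def by (rule ideal.quotient_is_cring[OF ideal_PIdl class_cring.cring_axioms])

lemma restrict_scalars_simps [simp]:
  "carrier (restrict_scalars \<phi> M) = carrier M" "add (restrict_scalars \<phi> M) = add M"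
  "\<zero>\<^bsub>restrict_scalars \<phi> M\<^esub> = \<zero>\<^bsub>M\<^esub>" "a \<odot>\<^bsub>restrict_scalars \<phi> M\<^esub> x = \<phi> a \<odot>\<^bsub>M\<^esub> x"
  by (auto simp: restrict_scalars_def)

lemma restrict_proj:
  fixes P :: "'a::comm_ring_1 poly"
  assumes "Module.module (poly_quot P) M" shows "cring_module (restrict_scalars (proj P) M)"
proof (rule moduleI)
  interpret M: Module.module "poly_quot P" M by fact
  show "cring (class_ring :: 'a poly ring)" by (rule class_cring.cring_axioms)
  have c: "proj P f \<in> carrier (poly_quot P)" for f by (auto simp: carrier_poly_quot)
  show "abelian_group (restrict_scalars (proj P) M)"
    by (rule abelian_groupI) (auto simp: M.M.a_ac intro: bexI[of _ "\<ominus>\<^bsub>M\<^esub> x" for x] M.M.l_neg)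
  fix a b :: "'a poly" and x y
  assume xy: "x \<in> carrier (restrict_scalars (proj P) M)"
  show "a \<odot>\<^bsub>restrict_scalars (proj P) M\<^esub> x \<in> carrier (restrict_scalars (proj P) M)" using c xy by simp
  show "(a \<oplus>\<^bsub>class_ring\<^esub> b) \<odot>\<^bsub>restrict_scalars (proj P) M\<^esub> x
     = a \<odot>\<^bsub>restrict_scalars (proj P) M\<^esub> x \<oplus>\<^bsub>restrict_scalars (proj P) M\<^esub> b \<odot>\<^bsub>restrict_scalars (proj P) M\<^esub> x"
    using c xy by (simp add: proj_add M.smult_l_distr)
  show "(a \<otimes>\<^bsub>class_ring\<^esub> b) \<odot>\<^bsub>restrict_scalars (proj P) M\<^esub> x
     = a \<odot>\<^bsub>restrict_scalars (proj P) M\<^esub> (b \<odot>\<^bsub>restrict_scalars (proj P) M\<^esub> x)"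
    using c xy by (simp add: proj_mult M.smult_assoc1)
  show "\<one>\<^bsub>class_ring\<^esub> \<odot>\<^bsub>restrict_scalars (proj P) M\<^esub> x = x" using xy by (simp add: proj_one)
  assume "y \<in> carrier (restrict_scalars (proj P) M)"
  thus "a \<odot>\<^bsub>restrict_scalars (proj P) M\<^esub> (x \<oplus>\<^bsub>restrict_scalars (proj P) M\<^esub> y)
     = a \<odot>\<^bsub>restrict_scalars (proj P) M\<^esub> x \<oplus>\<^bsub>restrict_scalars (proj P) M\<^esub> a \<odot>\<^bsub>restrict_scalars (proj P) M\<^esub> y"
    using c xy by (simp add: M.smult_r_distr)
qed

lemma module_hom_restrict:
  fixes P :: "'a::comm_ring_1 poly"
  shows "module_hom (poly_quot P) M N
    = module_hom class_ring (restrict_scalars (proj P) M) (restrict_scalars (proj P) N)"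
  by (auto simp: module_hom_def carrier_poly_quot)

lemma quot_module_restrict:
  "restrict_scalars \<phi> (quot_module M N) = quot_module (restrict_scalars \<phi> M) N"
  by (simp add: restrict_scalars_def quot_module_def A_RCOSETS_def' a_r_coset_def' set_add_def' fun_eq_iff)

section \<open>Isomorphisms from a cokernel\<close>

lemma module_homI:
  fixes M :: "('c::comm_ring_1, 'm) module" and N :: "('c, 'n) module"
  assumes "\<And>x. x \<in> carrier M \<Longrightarrow> f x \<in> carrier N"
    "\<And>x y. x \<in> carrier M \<Longrightarrow> y \<in> carrier M \<Longrightarrow> f (x \<oplus>\<^bsub>M\<^esub> y) = f x \<oplus>\<^bsub>N\<^esub> f y"
    "\<And>a x. x \<in> carrier M \<Longrightarrow> f (a \<odot>\<^bsub>M\<^esub> x) = a \<odot>\<^bsub>N\<^esub> f x"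
  shows "f \<in> module_hom class_ring M N"
  using assms by (auto simp: module_hom_def)

lemma module_homD:
  fixes M :: "('c::comm_ring_1, 'm) module" and N :: "('c, 'n) module"
  assumes "f \<in> module_hom class_ring M N"
  shows "x \<in> carrier M \<Longrightarrow> f x \<in> carrier N"
    "x \<in> carrier M \<Longrightarrow> y \<in> carrier M \<Longrightarrow> f (x \<oplus>\<^bsub>M\<^esub> y) = f x \<oplus>\<^bsub>N\<^esub> f y"
    "x \<in> carrier M \<Longrightarrow> f (a \<odot>\<^bsub>M\<^esub> x) = a \<odot>\<^bsub>N\<^esub> f x"
  using assms by (auto simp: module_hom_def)

lemma module_hom_eq_iff:
  fixes M :: "('c::comm_ring_1, 'm) module" and N :: "('c, 'n) module"
  assumes M: "cring_module M" and N: "cring_module N" and f: "f \<in> module_hom class_ring M N"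
    and v: "v \<in> carrier M" and w: "w \<in> carrier M"
  shows "f v = f w \<longleftrightarrow> f (v \<ominus>\<^bsub>M\<^esub> w) = \<zero>\<^bsub>N\<^esub>"
proof -
  note mD = cring_moduleD[OF M] and nD = cring_moduleD[OF N] and fD = module_homD[OF f]
  interpret M: abelian_group M by (rule mD)
  interpret N: abelian_group N by (rule nD)
  have "f (\<ominus>\<^bsub>M\<^esub> w) = \<ominus>\<^bsub>N\<^esub> f w"
    using fD(3)[OF w, of "-1"] mD(6,9)[OF w] nD(6,9)[OF fD(1)[OF w]] by simp
  hence d: "f (v \<ominus>\<^bsub>M\<^esub> w) = f v \<ominus>\<^bsub>N\<^esub> f w" using v w fD(2) by (simp add: a_minus_def)
  show ?thesis unfolding d using diff_eq_zero[OF nD(1)] fD(1) v w by (auto simp: a_minus_def N.r_neg)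
qed

text \<open>
  The restriction to \<open>carrier A\<close> makes the isomorphism unique as a function; \<open>module_aut\<close> consists of
  such restricted functions.
\<close>

lemma ex_factor_iso:
  fixes M :: "('c::comm_ring_1, 'm) module" and A :: "('c, 'x) module" and B :: "('c, 'y) module"
  assumes M: "cring_module M" and A: "cring_module A" and B: "cring_module B"
    and f: "f \<in> module_hom class_ring M A" "f ` carrier M = carrier A"
    and h: "h \<in> module_hom class_ring M B" "h ` carrier M = carrier B"
    and ker: "\<And>v. v \<in> carrier M \<Longrightarrow> f v = \<zero>\<^bsub>A\<^esub> \<longleftrightarrow> h v = \<zero>\<^bsub>B\<^esub>"
  obtains \<phi> where "\<phi> \<in> module_hom class_ring A B" "bij_betw \<phi> (carrier A) (carrier B)"
    "\<phi> \<in> extensional (carrier A)" "\<And>v. v \<in> carrier M \<Longrightarrow> \<phi> (f v) = h v"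
proof -
  interpret M: abelian_group M by (rule cring_moduleD[OF M])
  note fD = module_homD[OF f(1)] and hD = module_homD[OF h(1)]
  have eq: "f v = f w \<longleftrightarrow> h v = h w" if "v \<in> carrier M" "w \<in> carrier M" for v w
    using module_hom_eq_iff[OF M A f(1) that] module_hom_eq_iff[OF M B h(1) that] ker[of "v \<ominus>\<^bsub>M\<^esub> w"] that by simp
  define \<phi> where "\<phi> = restrict (\<lambda>x. h (SOME v. v \<in> carrier M \<and> f v = x)) (carrier A)"
  have \<phi>: "\<phi> (f v) = h v" if v: "v \<in> carrier M" for v
  proof -
    have "\<exists>w. w \<in> carrier M \<and> f w = f v" using v by blast
    hence "(SOME w. w \<in> carrier M \<and> f w = f v) \<in> carrier M \<and> f (SOME w. w \<in> carrier M \<and> f w = f v) = f v"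
      by (rule someI_ex)
    hence "h (SOME w. w \<in> carrier M \<and> f w = f v) = h v" using eq v by blast
    thus ?thesis using fD(1)[OF v] by (simp add: \<phi>_def)
  qed
  show ?thesis
  proof
    show "\<phi> \<in> extensional (carrier A)" by (simp add: \<phi>_def)
    show "\<And>v. v \<in> carrier M \<Longrightarrow> \<phi> (f v) = h v" by (rule \<phi>)
    have \<phi>im: "\<phi> ` carrier A = carrier B" unfolding f(2)[symmetric] h(2)[symmetric] image_image using \<phi> by simp
    have "inj_on \<phi> (carrier A)"
    proof (rule inj_onI)
      fix x y assume xy: "x \<in> carrier A" "y \<in> carrier A" "\<phi> x = \<phi> y"
      then obtain v w where vw: "v \<in> carrier M" "w \<in> carrier M" "x = f v" "y = f w" using f(2) by blast
      thus "x = y" using xy(3) \<phi> eq by simp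
    qed
    thus "bij_betw \<phi> (carrier A) (carrier B)" using \<phi>im by (simp add: bij_betw_def)
    show "\<phi> \<in> module_hom class_ring A B"
    proof (rule module_homI)
      show "\<And>x. x \<in> carrier A \<Longrightarrow> \<phi> x \<in> carrier B" using \<phi>im by blast
      fix x y assume "x \<in> carrier A" "y \<in> carrier A"
      then obtain v w where vw: "v \<in> carrier M" "w \<in> carrier M" "x = f v" "y = f w" using f(2) by blast
      show "\<phi> (x \<oplus>\<^bsub>A\<^esub> y) = \<phi> x \<oplus>\<^bsub>B\<^esub> \<phi> y"
        unfolding vw(3,4) fD(2)[OF vw(1,2), symmetric]
        using \<phi>[OF M.a_closed[OF vw(1,2)]] hD(2)[OF vw(1,2)] \<phi>[OF vw(1)] \<phi>[OF vw(2)] by simp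
    next
      fix a x assume "x \<in> carrier A"
      then obtain v where v: "v \<in> carrier M" "x = f v" using f(2) by blast
      show "\<phi> (a \<odot>\<^bsub>A\<^esub> x) = a \<odot>\<^bsub>B\<^esub> \<phi> x"
        unfolding v(2) fD(3)[OF v(1), symmetric]
        using \<phi>[OF cring_moduleD(2)[OF M v(1)]] hD(3)[OF v(1)] \<phi>[OF v(1)] by simp
    qed
  qed
qed

lemma lin_hom_iff:
  fixes X :: "'a::comm_ring_1 mat"
  assumes G: "cring_module G" and g: "g \<in> {..<n} \<rightarrow> carrier G" and X: "X \<in> carrier_mat n n"
  shows "lin G n g \<in> module_hom class_ring (mat_module X) G
    \<longleftrightarrow> (\<forall>v\<in>carrier_vec n. lin G n g (X *\<^sub>v v) = [:0, 1:] \<odot>\<^bsub>G\<^esub> lin G n g v)"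
proof
  note gD = cring_moduleD[OF G] and simps = mat_module_simps[OF X]
  { assume h: "lin G n g \<in> module_hom class_ring (mat_module X) G"
    show "\<forall>v\<in>carrier_vec n. lin G n g (X *\<^sub>v v) = [:0, 1:] \<odot>\<^bsub>G\<^esub> lin G n g v"
      using module_homD(3)[OF h, of _ "[:0, 1:]"] act_X[OF X] by (simp add: simps) }
  assume c: "\<forall>v\<in>carrier_vec n. lin G n g (X *\<^sub>v v) = [:0, 1:] \<odot>\<^bsub>G\<^esub> lin G n g v"
  show "lin G n g \<in> module_hom class_ring (mat_module X) G"
  proof (rule module_homI, unfold simps)
    fix f and v :: "'a vec" assume v: "v \<in> carrier_vec n"
    have "lin G n g (poly_mat f X *\<^sub>v v) \<ominus>\<^bsub>G\<^esub> f \<odot>\<^bsub>G\<^esub> lin G n g v \<in> {\<zero>\<^bsub>G\<^esub>}"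
    proof (rule lin_act_cong[OF G submod_zero[OF G] g X _ v])
      fix v :: "'a vec" assume "v \<in> carrier_vec n"
      thus "lin G n g (X *\<^sub>v v) \<ominus>\<^bsub>G\<^esub> [:0, 1:] \<odot>\<^bsub>G\<^esub> lin G n g v \<in> {\<zero>\<^bsub>G\<^esub>}"
        using c diff_self[OF submod_zero[OF G] gD(2)[OF lin_closed[OF G g]]] by simp
    qed
    thus "lin G n g (poly_mat f X *\<^sub>v v) = f \<odot>\<^bsub>G\<^esub> lin G n g v"
      using diff_eq_zero[OF gD(1)] gD(2)[OF lin_closed[OF G g]] lin_closed[OF G g] by blast
  qed (auto simp: lin_closed[OF G g] lin_add[OF G g])
qed

lemma hom_eq_lin:
  fixes X :: "'a::comm_ring_1 mat"
  assumes G: "cring_module G" and X: "X \<in> carrier_mat n n"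
    and f: "f \<in> module_hom class_ring (mat_module X) G"
    and g: "\<And>j. j < n \<Longrightarrow> g j = f (unit_vec n j)" and v: "v \<in> carrier_vec n"
  shows "f v = lin G n g v"
proof (rule lin_eqI[where F = f and g = g and v = v and n = n and G = G, OF G _ _ _ g v])
  note fD = module_homD[OF f, unfolded mat_module_simps[OF X]]
  show "f v \<in> carrier G" if "v \<in> carrier_vec n" for v using fD(1)[OF that] .
  show "f (v + w) = f v \<oplus>\<^bsub>G\<^esub> f w" if "v \<in> carrier_vec n" "w \<in> carrier_vec n" for v w using fD(2)[OF that] .
  show "f (a \<cdot>\<^sub>v v) = [:a:] \<odot>\<^bsub>G\<^esub> f v" if "v \<in> carrier_vec n" for a v
    using fD(3)[OF that, of "[:a:]"] act_const[OF X that] by simp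
qed

context
  fixes X :: "'a::comm_ring_1 mat" and n :: nat and G :: "('a poly, 'g) module" and K :: "'a vec set"
  assumes X: "X \<in> carrier_mat n n" and G: "cring_module G" and K: "submod K (mat_module X)"
begin

text \<open>
  The surjective linear maps from \<open>A\<^sup>n\<close>, with \<open>t\<close> acting as \<open>X\<close>, to \<open>G\<close> with kernel \<open>K\<close>, each given by
  the images of the unit vectors.
\<close>

definition presentations :: "(nat \<Rightarrow> 'g) set" where
  "presentations = {g \<in> {..<n} \<rightarrow>\<^sub>E carrier G. lin G n g ` carrier_vec n = carrier G \<and>
    (\<forall>v\<in>carrier_vec n. lin G n g (X *\<^sub>v v) = [:0, 1:] \<odot>\<^bsub>G\<^esub> lin G n g v) \<and>
    {v \<in> carrier_vec n. lin G n g v = \<zero>\<^bsub>G\<^esub>} = K}"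

lemma presentationsD:
  assumes "g \<in> presentations"
  shows "g \<in> {..<n} \<rightarrow>\<^sub>E carrier G" "g \<in> {..<n} \<rightarrow> carrier G" "lin G n g ` carrier (mat_module X) = carrier G"
    "lin G n g \<in> module_hom class_ring (mat_module X) G"
    "v \<in> carrier (mat_module X) \<Longrightarrow> lin G n g v = \<zero>\<^bsub>G\<^esub> \<longleftrightarrow> v \<in> K"
  using assms lin_hom_iff[OF G _ X, of g] by (auto simp: presentations_def mat_module_simps[OF X])

lemma presentationsI:
  assumes f: "f \<in> module_hom class_ring (mat_module X) G" "f ` carrier (mat_module X) = carrier G"
    and ker: "\<And>v. v \<in> carrier (mat_module X) \<Longrightarrow> f v = \<zero>\<^bsub>G\<^esub> \<longleftrightarrow> v \<in> K"
  shows "restrict (\<lambda>j. f (unit_vec n j)) {..<n} \<in> presentations"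
proof -
  let ?g = "restrict (\<lambda>j. f (unit_vec n j)) {..<n}"
  note simps = mat_module_simps[OF X]
  have g: "?g \<in> {..<n} \<rightarrow>\<^sub>E carrier G" using module_homD(1)[OF f(1)] by (auto simp: simps)
  hence g': "?g \<in> {..<n} \<rightarrow> carrier G" by auto
  have eq: "lin G n ?g v = f v" if "v \<in> carrier_vec n" for v
    using hom_eq_lin[OF G X f(1) _ that, of ?g] by simp
  have Xv: "X *\<^sub>v v \<in> carrier_vec n" if "v \<in> carrier_vec n" for v using X that by auto
  have "f (X *\<^sub>v v) = [:0, 1:] \<odot>\<^bsub>G\<^esub> f v" if "v \<in> carrier_vec n" for v
    using module_homD(3)[OF f(1), of v "[:0, 1:]"] act_X[OF X that] that by (simp add: simps)
  moreover have "K \<subseteq> carrier_vec n" using submodD(2)[OF K] by (simp add: simps)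
  moreover have "lin G n ?g ` carrier_vec n = carrier G"
    using f(2) eq by (simp add: simps cong: image_cong)
  ultimately show ?thesis using g ker eq Xv by (auto simp: presentations_def simps)
qed

lemma iso_iff_presentations:
  "module_iso class_ring (quot_module (mat_module X) K) G \<longleftrightarrow> presentations \<noteq> {}"
proof
  note mm = mat_module[OF X] and qm = quot_module[OF K] and qs = quot_module_simps[OF K]
  let ?Q = "quot_module (mat_module X) K" and ?c = "\<lambda>v. K +>\<^bsub>mat_module X\<^esub> v"
  interpret M: abelian_group "mat_module X" by (rule cring_moduleD[OF mm])
  interpret QQ: abelian_group ?Q by (rule cring_moduleD[OF qm])
  have c_hom: "?c \<in> module_hom class_ring (mat_module X) ?Q" by (rule module_homI) (auto simp: qs)
  have c_surj: "?c ` carrier (mat_module X) = carrier ?Q" by (simp add: qs)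
  have c_ker: "?c v = \<zero>\<^bsub>?Q\<^esub> \<longleftrightarrow> v \<in> K" if v: "v \<in> carrier (mat_module X)" for v
  proof -
    have "?c (0 \<odot>\<^bsub>mat_module X\<^esub> v) = 0 \<odot>\<^bsub>?Q\<^esub> ?c v" using qs(4)[OF v] by simp
    hence z: "?c \<zero>\<^bsub>mat_module X\<^esub> = \<zero>\<^bsub>?Q\<^esub>"
      using cring_moduleD(7)[OF mm v] cring_moduleD(7)[OF qm, of "?c v"] v by (simp add: qs(1))
    have "v \<ominus>\<^bsub>mat_module X\<^esub> \<zero>\<^bsub>mat_module X\<^esub> = v"
      using v mat_module_minus(2)[OF X, of "0\<^sub>v n" v] by (auto simp: mat_module_simps[OF X])
    thus ?thesis using coset_eq_iff[OF K v M.zero_closed] unfolding z by simp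
  qed
  { assume "module_iso class_ring ?Q G"
    then obtain \<phi> where \<phi>: "\<phi> \<in> module_hom class_ring ?Q G" "bij_betw \<phi> (carrier ?Q) (carrier G)"
      by (auto simp: module_iso_def)
    note \<phi>D = module_homD[OF \<phi>(1)] and cD = module_homD[OF c_hom]
    have \<phi>0: "\<phi> \<zero>\<^bsub>?Q\<^esub> = \<zero>\<^bsub>G\<^esub>"
      using \<phi>D(3)[OF QQ.zero_closed, of 0] cring_moduleD(7)[OF qm QQ.zero_closed]
        cring_moduleD(7)[OF G \<phi>D(1)[OF QQ.zero_closed]] by simp
    have "restrict (\<lambda>j. (\<phi> \<circ> ?c) (unit_vec n j)) {..<n} \<in> presentations"
    proof (rule presentationsI)
      show "\<phi> \<circ> ?c \<in> module_hom class_ring (mat_module X) G"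
        using \<phi>D cD by (intro module_homI) auto
      show "(\<phi> \<circ> ?c) ` carrier (mat_module X) = carrier G"
        using \<phi>(2) c_surj by (simp only: image_comp[symmetric] bij_betw_def)
      show "(\<phi> \<circ> ?c) v = \<zero>\<^bsub>G\<^esub> \<longleftrightarrow> v \<in> K" if v: "v \<in> carrier (mat_module X)" for v
      proof -
        have "\<phi> (?c v) = \<phi> \<zero>\<^bsub>?Q\<^esub> \<longleftrightarrow> ?c v = \<zero>\<^bsub>?Q\<^esub>"
          using \<phi>(2) cD(1)[OF v] QQ.zero_closed by (auto simp: bij_betw_def inj_on_def)
        thus ?thesis using \<phi>0 c_ker[OF v] by simp
      qed
    qed
    thus "presentations \<noteq> {}" by blast }
  assume "presentations \<noteq> {}"
  then obtain g where g: "g \<in> presentations" by blast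
  note gp = presentationsD[OF g]
  have ker: "?c v = \<zero>\<^bsub>?Q\<^esub> \<longleftrightarrow> lin G n g v = \<zero>\<^bsub>G\<^esub>" if "v \<in> carrier (mat_module X)" for v
    using c_ker[OF that] gp(5)[OF that] by simp
  obtain \<phi> where "\<phi> \<in> module_hom class_ring ?Q G" "bij_betw \<phi> (carrier ?Q) (carrier G)"
    using ex_factor_iso[OF mm qm G c_hom c_surj gp(4,3) ker] by blast
  thus "module_iso class_ring ?Q G" by (auto simp: module_iso_def)
qed

text \<open>
  Composition with automorphisms of \<open>G\<close> is simply transitive on the presentations, because two
  surjections with the same kernel differ by a unique automorphism.
\<close>

lemma card_presentations:
  assumes ne: "presentations \<noteq> {}"
  shows "card presentations = card (module_aut class_ring G)"
proof -
  note mm = mat_module[OF X]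
  obtain g where g: "g \<in> presentations" using ne by blast
  note gp = presentationsD[OF g]
  let ?F = "\<lambda>\<alpha>. restrict (\<lambda>j. \<alpha> (g j)) {..<n}"
  have zero: "\<alpha> x = \<zero>\<^bsub>G\<^esub> \<longleftrightarrow> x = \<zero>\<^bsub>G\<^esub>" if \<alpha>: "\<alpha> \<in> module_aut class_ring G" and x: "x \<in> carrier G" for \<alpha> x
  proof -
    interpret G: abelian_group G by (rule cring_moduleD[OF G])
    have h: "\<alpha> \<in> module_hom class_ring G G" and b: "bij_betw \<alpha> (carrier G) (carrier G)"
      using \<alpha> by (auto simp: module_aut_def Bij_def)
    have "\<alpha> \<zero>\<^bsub>G\<^esub> = \<zero>\<^bsub>G\<^esub>"
      using module_homD(3)[OF h G.zero_closed, of 0] cring_moduleD(7)[OF G G.zero_closed]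
        cring_moduleD(7)[OF G module_homD(1)[OF h G.zero_closed]] by simp
    thus ?thesis using inj_on_eq_iff[OF bij_betw_imp_inj_on[OF b] x G.zero_closed] by simp
  qed
  have comp: "\<alpha> \<circ> lin G n g \<in> module_hom class_ring (mat_module X) G" if "\<alpha> \<in> module_hom class_ring G G" for \<alpha>
    by (rule module_homI) (simp_all add: module_homD[OF that] module_homD[OF gp(4)])
  have F_unit: "?F \<alpha> = restrict (\<lambda>j. (\<alpha> \<circ> lin G n g) (unit_vec n j)) {..<n}" for \<alpha>
    using lin_unit[OF G gp(2)] by (intro ext) auto
  have "bij_betw ?F (module_aut class_ring G) presentations"
  proof (rule bij_betw_imageI)
    show "inj_on ?F (module_aut class_ring G)"
    proof (rule inj_onI)
      fix \<alpha> \<beta> assume ab: "\<alpha> \<in> module_aut class_ring G" "\<beta> \<in> module_aut class_ring G" and eq: "?F \<alpha> = ?F \<beta>"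
      have h: "\<alpha> \<in> module_hom class_ring G G" "\<beta> \<in> module_hom class_ring G G"
        and e: "\<alpha> \<in> extensional (carrier G)" "\<beta> \<in> extensional (carrier G)"
        using ab by (auto simp: module_aut_def Bij_def)
      show "\<alpha> = \<beta>"
      proof (rule extensionalityI[OF e])
        fix x assume "x \<in> carrier G"
        then obtain v where v: "v \<in> carrier_vec n" "x = lin G n g v" using gp(3) by (auto simp: mat_module_simps[OF X])
        have gj: "\<alpha> (g j) = \<beta> (g j)" if "j < n" for j using fun_cong[OF eq, of j] that by simp
        have "(\<alpha> \<circ> lin G n g) v = lin G n (\<lambda>j. \<alpha> (g j)) v"
          by (rule hom_eq_lin[OF G X comp[OF h(1)] _ v(1)]) (simp add: lin_unit[OF G gp(2)])
        moreover have "(\<beta> \<circ> lin G n g) v = lin G n (\<lambda>j. \<alpha> (g j)) v"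
          by (rule hom_eq_lin[OF G X comp[OF h(2)] _ v(1)]) (simp add: lin_unit[OF G gp(2)] gj)
        ultimately show "\<alpha> x = \<beta> x" using v(2) by simp
      qed
    qed
    show "?F ` module_aut class_ring G = presentations"
    proof (intro equalityI subsetI)
      fix f assume "f \<in> ?F ` module_aut class_ring G"
      then obtain \<alpha> where \<alpha>: "\<alpha> \<in> module_aut class_ring G" "f = ?F \<alpha>" by blast
      have h: "\<alpha> \<in> module_hom class_ring G G" and b: "bij_betw \<alpha> (carrier G) (carrier G)"
        using \<alpha> by (auto simp: module_aut_def Bij_def)
      show "f \<in> presentations" unfolding \<alpha>(2) F_unit
      proof (rule presentationsI[OF comp[OF h]])
        show "(\<alpha> \<circ> lin G n g) ` carrier (mat_module X) = carrier G"
          using b gp(3) by (simp only: image_comp[symmetric] bij_betw_def)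
        show "(\<alpha> \<circ> lin G n g) v = \<zero>\<^bsub>G\<^esub> \<longleftrightarrow> v \<in> K" if "v \<in> carrier (mat_module X)" for v
          using zero[OF \<alpha>(1) module_homD(1)[OF gp(4) that]] gp(5)[OF that] by simp
      qed
    next
      fix f assume f: "f \<in> presentations"
      note fp = presentationsD[OF f]
      have ker: "lin G n g v = \<zero>\<^bsub>G\<^esub> \<longleftrightarrow> lin G n f v = \<zero>\<^bsub>G\<^esub>" if "v \<in> carrier (mat_module X)" for v
        using gp(5)[OF that] fp(5)[OF that] by simp
      obtain \<alpha> where \<alpha>: "\<alpha> \<in> module_hom class_ring G G" "bij_betw \<alpha> (carrier G) (carrier G)"
        "\<alpha> \<in> extensional (carrier G)" "\<And>v. v \<in> carrier (mat_module X) \<Longrightarrow> \<alpha> (lin G n g v) = lin G n f v"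
        using ex_factor_iso[OF mm G G gp(4,3) fp(4,3) ker] by blast
      have "f = ?F \<alpha>"
      proof (rule ext)
        fix j
        show "f j = ?F \<alpha> j"
        proof (cases "j < n")
          case True
          thus ?thesis using \<alpha>(4)[of "unit_vec n j"] lin_unit[OF G gp(2) True] lin_unit[OF G fp(2) True]
            by (simp add: mat_module_simps[OF X])
        next
          case False
          thus ?thesis using PiE_arb[OF fp(1), of j] by simp
        qed
      qed
      moreover have "\<alpha> \<in> module_aut class_ring G" using \<alpha>(1-3) by (simp add: module_aut_def Bij_def)
      ultimately show "f \<in> ?F ` module_aut class_ring G" by blast
    qed
  qed
  from bij_betw_same_card[OF this] show ?thesis ..
qed

end

lemma submod_image_poly_mat:
  fixes X :: "'a::comm_ring_1 mat"
  assumes X: "X \<in> carrier_mat n n"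
  shows "submod ((\<lambda>v. poly_mat P X *\<^sub>v v) ` carrier_vec n) (mat_module X)" (is "submod ?K _")
proof (rule submod_matI[OF X])
  have m: "v \<in> carrier_vec n \<Longrightarrow> poly_mat P X *\<^sub>v v \<in> ?K" for v by simp
  show "?K \<subseteq> carrier_vec n" using act_carrier[OF X] by auto
  show "0\<^sub>v n \<in> ?K" using m[of "0\<^sub>v n"] act_zero[OF X] by simp
  show "a \<cdot>\<^sub>v v \<in> ?K" if v: "v \<in> ?K" for a v
  proof -
    obtain w where "w \<in> carrier_vec n" "v = poly_mat P X *\<^sub>v w" using v by blast
    thus ?thesis using m[of "a \<cdot>\<^sub>v w"] act_smult_vec[OF X] by simp
  qed
  show "v + w \<in> ?K" if vw: "v \<in> ?K" "w \<in> ?K" for v w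
  proof -
    obtain x y where "x \<in> carrier_vec n" "v = poly_mat P X *\<^sub>v x" "y \<in> carrier_vec n" "w = poly_mat P X *\<^sub>v y"
      using vw by blast
    thus ?thesis using m[of "x + y"] act_add_vec[OF X, of x y P] by simp
  qed
  show "X *\<^sub>v v \<in> ?K" if v: "v \<in> ?K" for v
  proof -
    obtain w where w: "w \<in> carrier_vec n" "v = poly_mat P X *\<^sub>v w" using v by blast
    thus ?thesis using m[OF mult_mat_vec_carrier[OF X w(1)]] act_commute[OF X w(1), of P] by simp
  qed
qed

context cokernel_count
begin

definition image_P :: "'a mod_ring mat \<Rightarrow> 'a mod_ring vec set" where
  "image_P X = (\<lambda>v. poly_mat P X *\<^sub>v v) ` V"

lemma submod_image_P: "X \<in> carrier_mat n n \<Longrightarrow> submod (image_P X) (mat_module X)"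
  unfolding image_P_def by (rule submod_image_poly_mat)

text \<open>
  The defects \<open>t g\<^sub>j - F\<^sub>g(X\<^sub>0 e\<^sub>j)\<close> lie in \<open>pG\<close>, which is the image of \<open>p A\<^sup>n\<close> as \<open>F\<^sub>g\<close> is surjective.
  Adding preimages in \<open>p A\<^sup>n\<close> to the columns of \<open>X\<^sub>0\<close> removes them.
\<close>

lemma ex_commuting_lift:
  assumes X0: "X0 \<in> lifts" and g: "g \<in> homs_mod_p X0" and surj: "lin G n g ` V = carrier G"
  obtains X1 where "X1 \<in> lifts" "\<And>v. v \<in> V \<Longrightarrow> lin G n g (X1 *\<^sub>v v) = [:0, 1:] \<odot>\<^bsub>G\<^esub> lin G n g v"
proof -
  interpret G: abelian_group G by (rule gD(1))
  note gd = homs_mod_pD[OF g] and X0c = liftsD(1)[OF X0]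
  have pG: "\<exists>b\<in>pvec n. lin G n g b = x" if x: "x \<in> pG" for x
  proof -
    obtain y where y: "y \<in> carrier G" "x = [:of_nat p:] \<odot>\<^bsub>G\<^esub> y" using x by (auto simp: pG_def)
    then obtain w where w: "w \<in> V" "y = lin G n g w" using surj by blast
    have "lin G n g (of_nat p \<cdot>\<^sub>v w) = x" using lin_smult[OF G gd(1) w(1)] y w by simp
    thus ?thesis using pvec_mem[OF w(1)] by blast
  qed
  have "\<forall>j. \<exists>b. j < n \<longrightarrow> b \<in> pvec n \<and> lin G n g b
      = [:0, 1:] \<odot>\<^bsub>G\<^esub> lin G n g (unit_vec n j) \<ominus>\<^bsub>G\<^esub> lin G n g (X0 *\<^sub>v unit_vec n j)"
  proof (intro allI)
    fix j
    have "[:0, 1:] \<odot>\<^bsub>G\<^esub> lin G n g (unit_vec n j) \<ominus>\<^bsub>G\<^esub> lin G n g (X0 *\<^sub>v unit_vec n j) \<in> pG"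
      by (rule diff_sym[OF submod_pG gd(3) gd(2) gD(2)[OF gd(2)]]) simp
    from pG[OF this] show "\<exists>b. j < n \<longrightarrow> b \<in> pvec n \<and> lin G n g b
      = [:0, 1:] \<odot>\<^bsub>G\<^esub> lin G n g (unit_vec n j) \<ominus>\<^bsub>G\<^esub> lin G n g (X0 *\<^sub>v unit_vec n j)" by blast
  qed
  then obtain b where b: "\<And>j. j < n \<Longrightarrow> b j \<in> pvec n" "\<And>j. j < n \<Longrightarrow> lin G n g (b j)
      = [:0, 1:] \<odot>\<^bsub>G\<^esub> lin G n g (unit_vec n j) \<ominus>\<^bsub>G\<^esub> lin G n g (X0 *\<^sub>v unit_vec n j)" by metis
  have bV: "b j \<in> V" if "j < n" for j using b(1)[OF that] pvec_carrier by blast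
  define W where "W = mat_of_columns n b"
  have W: "W \<in> carrier_mat n n" by (simp add: W_def)
  have We: "W *\<^sub>v unit_vec n j = b j" if "j < n" for j
    unfolding W_def by (rule mat_of_columns_unit[of j n b, OF that bV[OF that]])
  have X1: "X0 + W \<in> lifts" using b(1) We by (intro lifts_add[OF X0 W]) simp
  have X1c: "X0 + W \<in> carrier_mat n n" by (rule liftsD(1)[OF X1])
  have "lin G n g ((X0 + W) *\<^sub>v v) = [:0, 1:] \<odot>\<^bsub>G\<^esub> lin G n g v" if v: "v \<in> V" for v
  proof -
    have t_comm: "[:0, 1:] \<odot>\<^bsub>G\<^esub> ([:a:] \<odot>\<^bsub>G\<^esub> x) = [:a:] \<odot>\<^bsub>G\<^esub> ([:0, 1:] \<odot>\<^bsub>G\<^esub> x)" if "x \<in> carrier G" for a x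
      using gD(5)[OF that, of "[:0, 1:]" "[:a:]"] gD(5)[OF that, of "[:a:]" "[:0, 1:]"]
      by (simp only: mult.commute[of "[:0, 1:]"])
    let ?L = "{v \<in> V. lin G n g ((X0 + W) *\<^sub>v v) = [:0, 1:] \<odot>\<^bsub>G\<^esub> lin G n g v}"
    have Xv: "(X0 + W) *\<^sub>v v \<in> V" if "v \<in> V" for v by (rule mult_mat_vec_carrier[OF X1c that])
    have sm: "a \<cdot>\<^sub>v v \<in> ?L" if vL: "v \<in> ?L" for a v
    proof -
      have vV: "v \<in> V" using vL by simp
      have "(X0 + W) *\<^sub>v (a \<cdot>\<^sub>v v) = a \<cdot>\<^sub>v ((X0 + W) *\<^sub>v v)" using X1c vV by (intro mat_mult_smult_vec) auto
      thus ?thesis using vL lin_smult[OF G gd(1) vV, of a] lin_smult[OF G gd(1) Xv[OF vV], of a] t_comm[OF gd(2)] by simp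
    qed
    have ue: "unit_vec n j \<in> ?L" if j: "j < n" for j
    proof -
      have e: "unit_vec n j \<in> V" by simp
      have X0e: "X0 *\<^sub>v unit_vec n j \<in> V" by (rule mult_mat_vec_carrier[OF X0c e])
      have "lin G n g ((X0 + W) *\<^sub>v unit_vec n j) = lin G n g (X0 *\<^sub>v unit_vec n j) \<oplus>\<^bsub>G\<^esub> lin G n g (b j)"
        unfolding add_mult_distrib_mat_vec[OF X0c W e] We[OF j] by (rule lin_add[OF G gd(1) X0e bV[OF j]])
      also have "\<dots> = [:0, 1:] \<odot>\<^bsub>G\<^esub> lin G n g (unit_vec n j)"
        unfolding b(2)[OF j] using gd(2) gD(2)[OF gd(2)]
        by (simp add: a_minus_def G.r_neg
            G.a_lcomm[of "lin G n g (X0 *\<^sub>v unit_vec n j)" "[:0, 1:] \<odot>\<^bsub>G\<^esub> lin G n g (unit_vec n j)"])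
      finally show ?thesis using e by simp
    qed
    have zz: "0\<^sub>v n \<in> ?L"
    proof -
      have "(X0 + W) *\<^sub>v (0 \<cdot>\<^sub>v 0\<^sub>v n) = 0 \<cdot>\<^sub>v ((X0 + W) *\<^sub>v 0\<^sub>v n)" using X1c by (intro mat_mult_smult_vec) auto
      hence "(X0 + W) *\<^sub>v 0\<^sub>v n = 0\<^sub>v n" using X1c carrier_matD[OF W] by simp
      moreover have "lin G n g (0\<^sub>v n) = \<zero>\<^bsub>G\<^esub>"
        using lin_smult[OF G gd(1), of "0\<^sub>v n" 0] gD(7)[OF gd(2)[of "0\<^sub>v n"]] by simp
      ultimately show ?thesis using gD(8) by simp
    qed
    have add: "v + w \<in> ?L" if "v \<in> ?L" "w \<in> ?L" for v w
      using that Xv lin_add[OF G gd(1)] mult_add_distrib_mat_vec[OF X1c, of v w] gD(4)[OF gd(2) gd(2)] by simp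
    have "v \<in> ?L" by (rule vec_span_induct[OF zz add sm ue v])
    thus ?thesis by simp
  qed
  thus ?thesis using that X1 by blast
qed

definition cok_lifts :: "'a mod_ring mat set" where
  "cok_lifts = {X \<in> lifts. module_iso class_ring (quot_module (mat_module X) (image_P X)) G}"

lemma finite_lifts: "finite lifts"
  by (rule finite_subset[of _ "carrier_mat n n"]) (auto simp: finite_card_carrier_mat liftsD(1))

text \<open>
  Both sides count the pairs of a lift \<open>X\<close> and a presentation \<open>g\<close> of \<open>G\<close> with kernel \<open>P(X) A\<^sup>n\<close>, up to
  the factor \<open>q\<^sup>(\<^sup>r\<^sup>-\<^sup>u\<^sup>)\<^sup>r\<close>.
\<close>

lemma card_cok_lifts:
  assumes card_u: "card ((\<lambda>x. [:of_nat p ^ (k - 1):] \<odot>\<^bsub>G\<^esub> x) ` carrier G) = q ^ u"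
  shows "u \<le> r" and "real (card cok_lifts) * real (card (module_aut class_ring G)) * real q ^ ((r - u) * r)
    = real p ^ ((k - 1) * n * n) * (\<Prod>i<r. real q ^ r - real q ^ i) * (\<Prod>i<r - u. real q ^ r - real q ^ i)"
proof -
  define X0 where "X0 = map_mat lft Xbar"
  have X0: "X0 \<in> lifts" using Xbar by (auto simp: X0_def lifts_def intro!: eq_matI)
  let ?FF = "{g \<in> homs_mod_p X0. lin G n g ` V = carrier G}"
  let ?pres = "\<lambda>X. presentations X n G (image_P X)"
  let ?XX = "\<lambda>g. {X \<in> lifts. g \<in> ?pres X}"
  let ?b1 = "\<Prod>i<r. real q ^ r - real q ^ i" and ?b2 = "\<Prod>i<r - u. real q ^ r - real q ^ i"
  have finpG: "finite pG" using finG pG_carrier finite_subset by blast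
  have pG0: "card pG > 0" using finpG submodD(3)[OF submod_pG] by (auto simp: card_gt_0_iff)
  have pdef: "g \<in> ?pres X \<longleftrightarrow> g \<in> {..<n} \<rightarrow>\<^sub>E carrier G \<and> lin G n g ` V = carrier G \<and>
    (\<forall>v\<in>V. lin G n g (X *\<^sub>v v) = [:0, 1:] \<odot>\<^bsub>G\<^esub> lin G n g v) \<and>
    {v \<in> V. lin G n g v = \<zero>\<^bsub>G\<^esub>} = image_P X" if X: "X \<in> lifts" for g X
    using presentations_def[OF liftsD(1)[OF X] G submod_image_P[OF liftsD(1)[OF X]]] by simp
  have main: "u \<le> r \<and> real (card (?XX g)) * real q ^ ((r - u) * r) * real (card pG) ^ n = real (card (pvec n)) ^ n * ?b2"
    if g: "g \<in> ?FF" for g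
  proof -
    note gd = homs_mod_pD[of g X0]
    have g': "g \<in> homs_mod_p X0" "lin G n g ` V = carrier G" using g by auto
    obtain X1 where X1: "X1 \<in> lifts" "\<And>v. v \<in> V \<Longrightarrow> lin G n g (X1 *\<^sub>v v) = [:0, 1:] \<odot>\<^bsub>G\<^esub> lin G n g v"
      using ex_commuting_lift[OF X0 g'] by blast
    interpret C: commuting_lift p k A F P Q n r G Xbar u g X1
      by unfold_locales (use card_u g' X1 gd(1) in auto)
    have gE: "g \<in> {..<n} \<rightarrow>\<^sub>E carrier G" using g' by (simp add: homs_mod_p_def)
    have "X \<in> lifts \<Longrightarrow> g \<in> ?pres X \<longleftrightarrow>
      (\<forall>v\<in>V. lin G n g (X *\<^sub>v v) = [:0, 1:] \<odot>\<^bsub>G\<^esub> lin G n g v) \<and> image_P X = C.N" for X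
      unfolding pdef C.N_def using gE g'(2) by (simp add: eq_commute[of "image_P X"])
    hence "?XX g = {X \<in> C.commuting. (\<lambda>v. poly_mat P X *\<^sub>v v) ` V = C.N}"
      unfolding C.commuting_def image_P_def[symmetric] by blast
    hence "real (card (?XX g)) * real q ^ ((r - u) * r) = real (card C.M) ^ n * ?b2"
      using C.card_good_lifts by simp
    hence "real (card (?XX g)) * real q ^ ((r - u) * r) * real (card pG) ^ n = (real (card pG) * real (card C.M)) ^ n * ?b2"
      by (simp add: power_mult_distrib)
    thus ?thesis using C.u_le_r C.card_pvec_M by simp
  qed
  have cFF: "real (card ?FF) = real (card pG) ^ n * ?b1" by (rule card_surjective_homs[OF X0])
  have b1: "?b1 \<noteq> 0"
    using q_gt_1 by (auto simp: power_inject_exp)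
  have "real (card ?FF) \<noteq> 0" unfolding cFF using b1 pG0 by simp
  hence "card ?FF \<noteq> 0" by simp
  hence "?FF \<noteq> {}" using card.empty by metis
  then obtain g where "g \<in> ?FF" by blast
  thus "u \<le> r" using main by blast
  have finFF: "finite ?FF" using finite_homs_mod_p[of X0] by simp
  have pres_FF: "g \<in> ?FF" if X: "X \<in> lifts" and g: "g \<in> ?pres X" for X g
  proof -
    have gE: "g \<in> {..<n} \<rightarrow>\<^sub>E carrier G" and sj: "lin G n g ` V = carrier G"
      and c: "\<And>v. v \<in> V \<Longrightarrow> lin G n g (X *\<^sub>v v) = [:0, 1:] \<odot>\<^bsub>G\<^esub> lin G n g v" using pdef[OF X] g by auto
    have g': "g \<in> {..<n} \<rightarrow> carrier G" using gE by auto
    have "lin G n g (X0 *\<^sub>v v) \<ominus>\<^bsub>G\<^esub> [:0, 1:] \<odot>\<^bsub>G\<^esub> lin G n g v \<in> pG" if v: "v \<in> V" for v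
    proof -
      have cc: "X0 *\<^sub>v v \<in> V" "X *\<^sub>v v \<in> V"
        using mult_mat_vec_carrier[OF liftsD(1) v] X X0 by auto
      have "X0 *\<^sub>v v - X *\<^sub>v v \<in> pvec n" using redv_eq_iff[OF cc] redv_mult[OF X v] redv_mult[OF X0 v] by simp
      from lin_pvec[OF g' this] show ?thesis unfolding lin_minus[OF G g' cc] c[OF v] .
    qed
    thus ?thesis using gE sj by (simp add: homs_mod_p_def)
  qed
  have pres_card: "card (?pres X) = (if X \<in> cok_lifts then card (module_aut class_ring G) else 0)" if X: "X \<in> lifts" for X
    using card_presentations[OF liftsD(1)[OF X] G submod_image_P[OF liftsD(1)[OF X]]]
      iso_iff_presentations[OF liftsD(1)[OF X] G submod_image_P[OF liftsD(1)[OF X]]] X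
    by (auto simp: cok_lifts_def)
  have "card cok_lifts * card (module_aut class_ring G) = (\<Sum>X\<in>cok_lifts. card (module_aut class_ring G))" by simp
  also have "\<dots> = (\<Sum>X\<in>lifts. card (?pres X))"
    using finite_lifts pres_card by (intro sum.mono_neutral_cong_left) (auto simp: cok_lifts_def)
  also have "\<dots> = (\<Sum>X\<in>lifts. card {g \<in> ?FF. g \<in> ?pres X})"
    using pres_FF by (intro sum.cong refl arg_cong[of _ _ card]) auto
  also have "\<dots> = (\<Sum>g\<in>?FF. card (?XX g))"
    using sum.swap_restrict[OF finite_lifts finFF, of "\<lambda>_ _. 1::nat" "\<lambda>X g. g \<in> ?pres X"] by simp
  finally have "card cok_lifts * card (module_aut class_ring G) = (\<Sum>g\<in>?FF. card (?XX g))" .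
  from arg_cong[OF this, of real]
  have cnt: "real (card cok_lifts) * real (card (module_aut class_ring G)) = (\<Sum>g\<in>?FF. real (card (?XX g)))"
    by (simp only: of_nat_mult of_nat_sum)
  let ?L = "real (card cok_lifts) * real (card (module_aut class_ring G)) * real q ^ ((r - u) * r)"
  have "?L * real (card pG) ^ n = (\<Sum>g\<in>?FF. real (card (?XX g)) * real q ^ ((r - u) * r) * real (card pG) ^ n)"
    unfolding cnt sum_distrib_right ..
  also have "\<dots> = (\<Sum>g\<in>?FF. real (card (pvec n)) ^ n * ?b2)" using main by (intro sum.cong refl) blast
  also have "\<dots> = real (card ?FF) * (real (card (pvec n)) ^ n * ?b2)" by simp
  also have "\<dots> = (real (card (pvec n)) ^ n * ?b1 * ?b2) * real (card pG) ^ n" unfolding cFF by simp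
  finally have "?L = real (card (pvec n)) ^ n * ?b1 * ?b2" using pG0 by simp
  also have "real (card (pvec n)) ^ n = real p ^ ((k - 1) * n * n)"
    unfolding card_pvec by (simp add: power_mult[symmetric])
  finally show "?L = real p ^ ((k - 1) * n * n) * ?b1 * ?b2" .
qed

end

section \<open>Dimensions and the probability\<close>

lemma module_aut_restrict:
  fixes P :: "'a::comm_ring_1 poly"
  shows "module_aut (poly_quot P) G = module_aut class_ring (restrict_scalars (proj P) G)"
  unfolding module_aut_def module_hom_restrict by simp

lemma module_iso_restrict:
  fixes P :: "'a::comm_ring_1 poly"
  shows "module_iso (poly_quot P) M N
    \<longleftrightarrow> module_iso class_ring (restrict_scalars (proj P) M) (restrict_scalars (proj P) N)"
  unfolding module_iso_def module_hom_restrict by simp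

lemma module_iso_cong:
  assumes c: "carrier M = carrier M'" and a: "add M = add M'"
    and s: "\<And>a x. a \<in> carrier R \<Longrightarrow> x \<in> carrier M' \<Longrightarrow> a \<odot>\<^bsub>M\<^esub> x = a \<odot>\<^bsub>M'\<^esub> x"
  shows "module_iso R M N \<longleftrightarrow> module_iso R M' N"
proof -
  have "module_hom R M N = module_hom R M' N"
    unfolding module_hom_def c a by (rule Collect_cong) (simp add: s cong: conj_cong)
  thus ?thesis unfolding module_iso_def c by simp
qed

text \<open>
  A scalar of \<open>A[t]/(P)\<close> acts on \<open>cok_poly P X\<close> through some preimage in \<open>A[t]\<close>; two preimages differ by
  a multiple of \<open>P\<close>, which maps \<open>A\<^sup>n\<close> into the image of \<open>P(X)\<close>.
\<close>

lemma cok_poly_iso_iff: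
  fixes X :: "'a::comm_ring_1 mat" and P :: "'a poly" and G :: "('a poly set, 'g) module"
  assumes X: "X \<in> carrier_mat n n"
  shows "module_iso (poly_quot P) (cok_poly P X) G
    \<longleftrightarrow> module_iso class_ring (quot_module (mat_module X) ((\<lambda>v. poly_mat P X *\<^sub>v v) ` carrier_vec n))
      (restrict_scalars (proj P) G)" (is "_ \<longleftrightarrow> module_iso _ (quot_module _ ?K) _")
  unfolding module_iso_restrict
proof (rule module_iso_cong)
  note K = submod_image_poly_mat[OF X, of P] and mm = mat_module[OF X]
  have cok: "cok_poly P X = descend_scalars class_ring (proj P) (quot_module (mat_module X) ?K)"
    using X by (simp add: cok_poly_def)
  show "carrier (restrict_scalars (proj P) (cok_poly P X)) = carrier (quot_module (mat_module X) ?K)"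
    "add (restrict_scalars (proj P) (cok_poly P X)) = add (quot_module (mat_module X) ?K)"
    unfolding cok by (simp_all add: descend_scalars_def)
  fix f x assume "x \<in> carrier (quot_module (mat_module X) ?K)"
  then obtain v where v: "v \<in> carrier (mat_module X)" "x = ?K +>\<^bsub>mat_module X\<^esub> v"
    using quot_module_simps(1)[OF K] by blast
  define f' where "f' = inv_into UNIV (proj P) (proj P f)"
  have "proj P f' = proj P f" unfolding f'_def by (rule f_inv_into_f) simp
  then obtain h where h: "f' - f = P * h" by (auto simp only: proj_eq_iff elim: dvdE)
  have vc: "v \<in> carrier_vec n" using v(1) mat_module_simps[OF X] by simp
  have "poly_mat (f' - f) X *\<^sub>v v \<in> ?K" unfolding h act_mult[OF X vc] using act_carrier[OF X vc] by blast
  hence "(f' - f) \<odot>\<^bsub>mat_module X\<^esub> v \<in> ?K" by (simp add: mat_module_simps[OF X])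
  hence "f' \<odot>\<^bsub>mat_module X\<^esub> v \<ominus>\<^bsub>mat_module X\<^esub> f \<odot>\<^bsub>mat_module X\<^esub> v \<in> ?K"
    unfolding cring_moduleD(10)[OF mm v(1)] .
  hence "f' \<odot>\<^bsub>quot_module (mat_module X) ?K\<^esub> x = f \<odot>\<^bsub>quot_module (mat_module X) ?K\<^esub> x"
    unfolding v(2) quot_module_simps(4)[OF K v(1)]
    using coset_eq_iff[OF K] cring_moduleD(2)[OF mm v(1)] by blast
  thus "f \<odot>\<^bsub>restrict_scalars (proj P) (cok_poly P X)\<^esub> x = f \<odot>\<^bsub>quot_module (mat_module X) ?K\<^esub> x"
    unfolding cok by (simp add: descend_scalars_def f'_def)
qed

lemma multiples_restrict: "multiples m (restrict_scalars \<phi> M) = multiples m M"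
  by (simp add: multiples_def add_pow_def nat_pow_def restrict_scalars_def)

lemma multiples_eq_smult_image:
  fixes M :: "('a::comm_ring_1 poly, 'm) module"
  assumes M: "cring_module M"
  shows "multiples m M = (\<lambda>x. [:of_nat m:] \<odot>\<^bsub>M\<^esub> x) ` carrier M"
proof -
  note mD = cring_moduleD[OF M]
  have "[m] \<cdot>\<^bsub>M\<^esub> x = [:of_nat m:] \<odot>\<^bsub>M\<^esub> x" if x: "x \<in> carrier M" for x
  proof (induction m)
    case 0
    show ?case using mD(7)[OF x] by (simp add: add_pow_def nat_pow_def)
  next
    case (Suc m)
    have "[:of_nat (Suc m):] = [:of_nat m:] + (1 :: 'a poly)" by (simp add: one_pCons add.commute)
    moreover have "[Suc m] \<cdot>\<^bsub>M\<^esub> x = [m] \<cdot>\<^bsub>M\<^esub> x \<oplus>\<^bsub>M\<^esub> x" by (simp add: add_pow_def nat_pow_def)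
    ultimately show ?case using mD(3,6)[OF x] Suc.IH by simp
  qed
  thus ?thesis unfolding multiples_def by (intro image_cong refl)
qed

lemma cring_module_submod:
  fixes M :: "('a::comm_ring_1, 'm) module"
  assumes K: "submod K M" shows "cring_module (M\<lparr>carrier := K\<rparr>)"
proof (rule moduleI)
  note KD = submodD[OF K] and mD = cring_moduleD[OF submodD(1)[OF K]]
  interpret M: abelian_group M by (rule mD)
  show "cring (class_ring :: 'a ring)" by (rule class_cring.cring_axioms)
  show "abelian_group (M\<lparr>carrier := K\<rparr>)"
  proof (rule abelian_groupI)
    fix x assume "x \<in> carrier (M\<lparr>carrier := K\<rparr>)"
    hence x: "x \<in> K" by simp
    show "\<exists>y\<in>carrier (M\<lparr>carrier := K\<rparr>). y \<oplus>\<^bsub>M\<lparr>carrier := K\<rparr>\<^esub> x = \<zero>\<^bsub>M\<lparr>carrier := K\<rparr>\<^esub>"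
      using KD(7)[OF x] M.l_neg[OF KD(4)[OF x]] by auto
  qed (auto simp: KD M.a_ac)
  fix a :: 'a and x y assume xy: "x \<in> carrier (M\<lparr>carrier := K\<rparr>)" "y \<in> carrier (M\<lparr>carrier := K\<rparr>)"
  show "a \<odot>\<^bsub>M\<lparr>carrier := K\<rparr>\<^esub> (x \<oplus>\<^bsub>M\<lparr>carrier := K\<rparr>\<^esub> y)
      = a \<odot>\<^bsub>M\<lparr>carrier := K\<rparr>\<^esub> x \<oplus>\<^bsub>M\<lparr>carrier := K\<rparr>\<^esub> a \<odot>\<^bsub>M\<lparr>carrier := K\<rparr>\<^esub> y"
    using mD(4)[of x y a] KD(4) xy by simp
qed (use submodD[OF K] cring_moduleD[OF submodD(1)[OF K]] in \<open>simp_all\<close>)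

lemma coset_zero:
  assumes N: "submod N M" and w: "w \<in> N" shows "N +>\<^bsub>M\<^esub> w = N"
proof -
  interpret M: abelian_group M by (rule cring_moduleD(1)[OF submodD(1)[OF N]])
  note ND = submodD[OF N]
  have "N +>\<^bsub>M\<^esub> w = N +>\<^bsub>M\<^esub> \<zero>\<^bsub>M\<^esub>"
    unfolding coset_eq_iff[OF N ND(4)[OF w] M.zero_closed] by (rule ND(8)[OF w ND(3)])
  also have "\<dots> = N" using ND(2) M.a_coset_add_zero by simp
  finally show ?thesis .
qed

context monic_lift
begin

lemma reduce_quot_proj: "reduce_quot (proj P f) = proj Q (map_poly red f)"
proof (intro equalityI subsetI)
  fix g :: "'p mod_ring poly" assume "g \<in> reduce_quot (proj P f)"
  then obtain g' where g: "g = map_poly red g'" "P dvd g' - f" by (auto simp: reduce_quot_def proj_eq)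
  then obtain h where "g' - f = P * h" by (elim dvdE)
  hence "map_poly red (g' - f) = Q * map_poly red h" by (simp only: redp.hom_mult Q_def)
  hence "Q dvd g - map_poly red f" by (simp add: g redp.hom_minus)
  thus "g \<in> proj Q (map_poly red f)" by (simp add: proj_eq)
next
  fix g assume "g \<in> proj Q (map_poly red f)"
  hence "Q dvd g - map_poly red f" by (simp add: proj_eq)
  then obtain h where h: "g - map_poly red f = Q * h" by (elim dvdE)
  have "map_poly red (f + P * map_poly lft h) = map_poly red f + Q * h"
    by (simp add: redp.hom_add redp.hom_mult Q_def)
  also have "\<dots> = g" using h by (simp add: algebra_simps)
  finally have "map_poly red (f + P * map_poly lft h) = g" .
  moreover have "f + P * map_poly lft h \<in> proj P f" by (simp add: proj_eq)
  ultimately show "g \<in> reduce_quot (proj P f)" unfolding reduce_quot_def by blast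
qed

lemma field_poly_quot: "field (poly_quot Q)"
proof (rule cring.cring_fieldI2[OF cring_poly_quot])
  have "\<not> Q dvd 0 - 1"
    using irreducible_not_unit[OF irred] by simp
  thus "\<zero>\<^bsub>poly_quot Q\<^esub> \<noteq> \<one>\<^bsub>poly_quot Q\<^esub>"
    unfolding zero_poly_quot proj_one[symmetric] proj_eq_iff .
  fix a assume a: "a \<in> carrier (poly_quot Q)" "a \<noteq> \<zero>\<^bsub>poly_quot Q\<^esub>"
  then obtain f where f: "a = proj Q f" by (auto simp: carrier_poly_quot)
  have "\<not> Q dvd f" using a(2) unfolding f zero_poly_quot proj_eq_iff by simp
  hence "coprime Q f" by (intro prime_elem_imp_coprime irreducible_imp_prime_elem_gcd irred)
  then obtain u v where uv: "u * Q + v * f = 1"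
    using bezout_coefficients_fst_snd[of Q f] by (metis coprime_iff_gcd_eq_1)
  have "f * v - 1 = Q * (- u)" using uv by (simp add: algebra_simps)
  hence "proj Q (f * v) = proj Q 1" unfolding proj_eq_iff by (rule dvdI)
  hence "a \<otimes>\<^bsub>poly_quot Q\<^esub> proj Q v = \<one>\<^bsub>poly_quot Q\<^esub>" unfolding f proj_mult proj_one .
  thus "\<exists>b\<in>carrier (poly_quot Q). a \<otimes>\<^bsub>poly_quot Q\<^esub> b = \<one>\<^bsub>poly_quot Q\<^esub>"
    unfolding carrier_poly_quot by blast
qed

lemma card_poly_quot: "card (carrier (poly_quot Q)) = card T"
proof -
  have Q0: "Q \<noteq> 0" using irred by auto
  have "carrier (poly_quot Q) = proj Q ` {f. degree f < d}"
  proof (intro equalityI subsetI)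
    fix a assume "a \<in> carrier (poly_quot Q)"
    then obtain f where f: "a = proj Q f" by (auto simp: carrier_poly_quot)
    have "degree (f mod Q) < d"
      using degree_mod_less[OF Q0, of f] degree_Q d_pos by auto
    moreover have "a = proj Q (f mod Q)" unfolding f proj_eq_iff by (rule dvd_minus_mod)
    ultimately show "a \<in> proj Q ` {f. degree f < d}" by blast
  qed (auto simp: carrier_poly_quot)
  moreover have "inj_on (proj Q) {f. degree f < d}"
  proof (rule inj_onI)
    fix f g assume fg: "f \<in> {f. degree f < d}" "g \<in> {f. degree f < d}" "proj Q f = proj Q g"
    have "Q dvd f - g" using fg(3) unfolding proj_eq_iff .
    moreover have "degree (f - g) < degree Q" using fg(1,2) degree_Q by (simp add: degree_diff_less)
    ultimately have "f - g = 0" using dvd_imp_degree_le[of Q "f - g"] by linarith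
    thus "f = g" by simp
  qed
  ultimately have "card (carrier (poly_quot Q)) = card {f :: 'p mod_ring poly. degree f < d}"
    by (simp add: card_image)
  thus ?thesis unfolding card_T using card_polys_degree_less(2)[OF d_pos, where 'a = "'p mod_ring"] by (simp add: card_p)
qed

text \<open>
  The field \<open>A[t]/J\<close> acts on \<open>M\<close>, since \<open>J\<close> kills it, and this is the action of \<open>\<F>\<^sub>p[t]/(Q)\<close> by
  descent: two preimages of a scalar in \<open>A[t]\<close> differ by an element of \<open>J\<close>.
\<close>

lemma card_eq_power_dim:
  fixes M :: "('a mod_ring poly set, 'm) module"
  assumes M: "cring_module (restrict_scalars (proj P) M)" and fin: "finite (carrier M)"
    and J: "\<And>j x. j \<in> J \<Longrightarrow> x \<in> carrier M \<Longrightarrow> proj P j \<odot>\<^bsub>M\<^esub> x = \<zero>\<^bsub>M\<^esub>"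
  shows "card (carrier M)
    = q ^ vectorspace.dim (poly_quot Q) (descend_scalars (poly_quot P) reduce_quot M)"
proof -
  let ?D = "descend_scalars (poly_quot P) reduce_quot M"
  let ?M = "restrict_scalars (proj P) M"
  note mD = cring_moduleD[OF M]
  have sm: "proj Q (map_poly red f) \<odot>\<^bsub>?D\<^esub> x = f \<odot>\<^bsub>?M\<^esub> x" if x: "x \<in> carrier ?M" for f x
  proof -
    define s where "s = inv_into (carrier (poly_quot P)) reduce_quot (proj Q (map_poly red f))"
    have im: "proj Q (map_poly red f) \<in> reduce_quot ` carrier (poly_quot P)"
      unfolding reduce_quot_proj[symmetric] carrier_poly_quot by blast
    have "s \<in> carrier (poly_quot P)" unfolding s_def by (rule inv_into_into[OF im])
    then obtain g where g: "s = proj P g" by (auto simp: carrier_poly_quot)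
    have "reduce_quot s = proj Q (map_poly red f)" unfolding s_def by (rule f_inv_into_f[OF im])
    hence "Q dvd map_poly red (g - f)"
      unfolding g reduce_quot_proj proj_eq_iff by (simp only: redp.hom_minus)
    hence "(g - f) \<odot>\<^bsub>?M\<^esub> x = \<zero>\<^bsub>?M\<^esub>" using J[of "g - f" x] x by (simp add: J_def)
    hence "g \<odot>\<^bsub>?M\<^esub> x \<ominus>\<^bsub>?M\<^esub> f \<odot>\<^bsub>?M\<^esub> x = \<zero>\<^bsub>?M\<^esub>" unfolding mD(10)[OF x] .
    hence "g \<odot>\<^bsub>?M\<^esub> x = f \<odot>\<^bsub>?M\<^esub> x" by (rule diff_eq_zero[OF mD(1) _ mD(2)[OF x] mD(2)[OF x]])
    thus ?thesis by (simp add: descend_scalars_def s_def[symmetric] g)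
  qed
  have "Module.module (poly_quot Q) ?D"
  proof (rule module_of_surjection[OF cring_poly_quot M, where \<psi> = "\<lambda>f. proj Q (map_poly red f)"])
    have "proj Q f \<in> range (\<lambda>f. proj Q (map_poly red f))" for f
      using rangeI[of "\<lambda>f. proj Q (map_poly red f)" "map_poly lft f"] by simp
    thus "carrier (poly_quot Q) = range (\<lambda>f. proj Q (map_poly red f))"
      unfolding carrier_poly_quot by auto
  qed (simp_all only: redp.hom_add redp.hom_mult redp.hom_one proj_add proj_mult proj_one sm,
      simp_all add: descend_scalars_def)
  hence "vectorspace (poly_quot Q) ?D" using field_poly_quot by (rule vectorspace.intro)
  from card_vectorspace[OF this] show ?thesis
    using fin by (simp add: descend_scalars_def card_poly_quot)
qed

lemma card_quot_multiples_p:
  fixes G :: "('a mod_ring poly set, 'g) module"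
  assumes G: "Module.module (poly_quot P) G" and fin: "finite (carrier G)"
    and PG: "\<And>x. x \<in> carrier G \<Longrightarrow> P \<odot>\<^bsub>restrict_scalars (proj P) G\<^esub> x = \<zero>\<^bsub>G\<^esub>"
  shows "card (carrier (quot_module G (multiples p G))) = q ^ r_q p P Q G"
  unfolding r_q_def
proof (rule card_eq_power_dim)
  let ?G = "restrict_scalars (proj P) G" and ?pG = "multiples p G"
  note cG = restrict_proj[OF G]
  have pG: "?pG = (\<lambda>x. [:of_nat p:] \<odot>\<^bsub>?G\<^esub> x) ` carrier ?G"
    using multiples_eq_smult_image[OF cG] by (simp only: multiples_restrict)
  have S: "submod ?pG ?G" unfolding pG by (rule submod_smult_image[OF submod_carrier[OF cG]])
  show "cring_module (restrict_scalars (proj P) (quot_module G ?pG))"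
    unfolding quot_module_restrict by (rule quot_module[OF S])
  have car: "carrier (quot_module G ?pG) = carrier (quot_module ?G ?pG)"
    unfolding quot_module_restrict[symmetric] by simp
  thus "finite (carrier (quot_module G ?pG))"
    using quot_module_simps(1)[OF S] fin by simp
  fix j x assume j: "j \<in> J" and x: "x \<in> carrier (quot_module G ?pG)"
  then obtain v where v: "v \<in> carrier ?G" "x = ?pG +>\<^bsub>?G\<^esub> v"
    unfolding car quot_module_simps(1)[OF S] by blast
  obtain y where y: "y \<in> carrier ?G" "j \<odot>\<^bsub>?G\<^esub> v = [:of_nat p:] \<odot>\<^bsub>?G\<^esub> y"
    using J_smult[OF cG _ j v(1)] PG by auto
  have "proj P j \<odot>\<^bsub>quot_module G ?pG\<^esub> x = j \<odot>\<^bsub>quot_module ?G ?pG\<^esub> x"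
    unfolding quot_module_restrict[symmetric] by simp
  also have "\<dots> = ?pG +>\<^bsub>?G\<^esub> (j \<odot>\<^bsub>?G\<^esub> v)" unfolding v(2) by (rule quot_module_simps(4)[OF S v(1)])
  also have "\<dots> = ?pG"
  proof (rule coset_zero[OF S])
    show "j \<odot>\<^bsub>?G\<^esub> v \<in> ?pG" unfolding y(2) pG using y(1) by (rule imageI)
  qed
  also have "\<dots> = \<zero>\<^bsub>quot_module G ?pG\<^esub>" by (simp add: quot_module_def)
  finally show "proj P j \<odot>\<^bsub>quot_module G ?pG\<^esub> x = \<zero>\<^bsub>quot_module G ?pG\<^esub>" .
qed

text \<open>
  \<open>J G \<subseteq> pG\<close> and \<open>p\<^sup>k = 0\<close>, so \<open>J\<close> kills \<open>p\<^sup>k\<^sup>-\<^sup>1 G\<close>.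
\<close>

lemma card_multiples_top:
  fixes G :: "('a mod_ring poly set, 'g) module"
  assumes G: "Module.module (poly_quot P) G" and fin: "finite (carrier G)"
    and PG: "\<And>x. x \<in> carrier G \<Longrightarrow> P \<odot>\<^bsub>restrict_scalars (proj P) G\<^esub> x = \<zero>\<^bsub>G\<^esub>"
  shows "card (multiples (p ^ (k - 1)) G) = q ^ u_q p k P Q G"
proof -
  let ?G = "restrict_scalars (proj P) G" and ?K = "multiples (p ^ (k - 1)) G"
  note cG = restrict_proj[OF G]
  note mD = cring_moduleD[OF cG]
  let ?c = "[:of_nat (p ^ (k - 1)):] :: 'a mod_ring poly"
  have K: "?K = (\<lambda>x. ?c \<odot>\<^bsub>?G\<^esub> x) ` carrier ?G"
    using multiples_eq_smult_image[OF cG] by (simp only: multiples_restrict)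
  have S: "submod ?K ?G" unfolding K by (rule submod_smult_image[OF submod_carrier[OF cG]])
  have "card (carrier (G\<lparr>carrier := ?K\<rparr>)) = q ^ u_q p k P Q G"
    unfolding u_q_def
  proof (rule card_eq_power_dim)
    have "restrict_scalars (proj P) (G\<lparr>carrier := ?K\<rparr>) = ?G\<lparr>carrier := ?K\<rparr>"
      by (simp add: restrict_scalars_def)
    thus "cring_module (restrict_scalars (proj P) (G\<lparr>carrier := ?K\<rparr>))"
      using cring_module_submod[OF S] by simp
    show "finite (carrier (G\<lparr>carrier := ?K\<rparr>))" using fin by (simp add: multiples_def)
    fix j x assume j: "j \<in> J" and "x \<in> carrier (G\<lparr>carrier := ?K\<rparr>)"
    then obtain y where y: "y \<in> carrier ?G" "x = ?c \<odot>\<^bsub>?G\<^esub> y" using K by auto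
    obtain z where z: "z \<in> carrier ?G" "j \<odot>\<^bsub>?G\<^esub> y = [:of_nat p:] \<odot>\<^bsub>?G\<^esub> z"
      using J_smult[OF cG _ j y(1)] PG by auto
    have "p ^ (k - 1) * p = p ^ k" using k_pos by (cases k) auto
    moreover have "(of_nat (p ^ k) :: 'a mod_ring) = 0" by (metis card_a of_nat_card_eq_0)
    ultimately have "(of_nat (p ^ (k - 1) * p) :: 'a mod_ring) = 0" by (simp only:)
    moreover have "?c * [:of_nat p:] = [:of_nat (p ^ (k - 1) * p):]" by simp
    ultimately have cp: "?c * [:of_nat p:] = 0" by (simp only: pCons_0_0)
    have "j \<odot>\<^bsub>?G\<^esub> x = ?c \<odot>\<^bsub>?G\<^esub> (j \<odot>\<^bsub>?G\<^esub> y)"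
      unfolding y(2) mD(5)[OF y(1), symmetric] by (simp only: mult.commute)
    also have "\<dots> = \<zero>\<^bsub>?G\<^esub>"
      unfolding z(2) mD(5)[OF z(1), symmetric] cp by (rule mD(7)[OF z(1)])
    finally show "proj P j \<odot>\<^bsub>G\<lparr>carrier := ?K\<rparr>\<^esub> x = \<zero>\<^bsub>G\<lparr>carrier := ?K\<rparr>\<^esub>" by simp
  qed
  thus ?thesis by simp
qed

end

text \<open>
  \<open>q\<^sup>r - q\<^sup>i = q\<^sup>r (1 - q\<^sup>i\<^sup>-\<^sup>r)\<close>, and the exponents \<open>r - i\<close> run through the last \<open>s\<close> numbers up to \<open>r\<close>.
\<close>

lemma prod_power_diff:
  fixes q :: real
  assumes q: "q \<noteq> 0" and s: "s \<le> r"
  shows "(\<Prod>i<s. q ^ r - q ^ i) * (\<Prod>i = 1..r - s. 1 - 1 / q ^ i) = q ^ (r * s) * (\<Prod>i = 1..r. 1 - 1 / q ^ i)"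
  using s
proof (induction s)
  case (Suc s)
  let ?W = "\<lambda>m. \<Prod>i = 1..m. 1 - 1 / q ^ i"
  have rs: "r - s = Suc (r - Suc s)" using Suc.prems by simp
  have W: "?W (r - s) = ?W (r - Suc s) * (1 - 1 / q ^ (r - s))" unfolding rs by simp
  have "q ^ r = q ^ s * q ^ (r - s)" using Suc.prems by (simp add: power_add[symmetric])
  hence d: "q ^ r - q ^ s = q ^ r * (1 - 1 / q ^ (r - s))" using q by (simp add: field_simps)
  have "(\<Prod>i<Suc s. q ^ r - q ^ i) * ?W (r - Suc s)
      = q ^ r * ((\<Prod>i<s. q ^ r - q ^ i) * (?W (r - Suc s) * (1 - 1 / q ^ (r - s))))"
    unfolding prod.lessThan_Suc d by (simp only: mult_ac)
  also have "\<dots> = q ^ r * (q ^ (r * s) * ?W r)" unfolding W[symmetric] using Suc by simp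
  also have "\<dots> = q ^ (r * Suc s) * ?W r" by (simp add: power_add)
  finally show ?case .
qed simp

text \<open>
  With \<open>W\<^sub>m = \<Prod>\<^sub>i\<^sub>\<le>\<^sub>m (1 - q\<^sup>-\<^sup>i)\<close> the two products in \<open>count\<close> are \<open>q\<^sup>r\<^sup>r W\<^sub>r\<close> and \<open>q\<^sup>r\<^sup>(\<^sup>r\<^sup>-\<^sup>u\<^sup>) W\<^sub>r / W\<^sub>u\<close>.  As
  the right-hand side is positive, \<open>A\<close> is not zero.
\<close>

lemma probability_from_count:
  fixes x C A :: real
  assumes x: "x > 1" and d: "d > 0" and k: "k \<ge> 1" and ur: "u \<le> r"
    and count: "C * A * (x ^ d) ^ ((r - u) * r) = x ^ ((k - 1) * n * n)
      * (\<Prod>i<r. (x ^ d) ^ r - (x ^ d) ^ i) * (\<Prod>i<r - u. (x ^ d) ^ r - (x ^ d) ^ i)"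
  shows "C / x ^ (k * (n * n)) = x powi (int (d * r\<^sup>2) - int (n\<^sup>2))
    / (A * (\<Prod>i = 1..u. (1 - x powi (- int (i * d))))) * (\<Prod>i = 1..r. (1 - x powi (- int (i * d)))\<^sup>2)"
proof -
  define y where "y = x ^ d"
  have y: "y > 1" unfolding y_def using x d by (simp add: one_less_power)
  define W where "W m = (\<Prod>i = 1..m. 1 - 1 / y ^ i)" for m
  have w: "1 - x powi (- int (i * d)) = 1 - 1 / y ^ i" for i
    unfolding y_def power_int_minus power_int_of_nat
    by (simp add: power_mult[symmetric] mult.commute divide_inverse)
  have W_pos: "W m > 0" for m
    unfolding W_def
  proof (rule prod_pos)
    fix i assume "i \<in> {1..m}"
    hence "y ^ i > 1" using y by (intro one_less_power) auto
    thus "1 - 1 / y ^ i > 0" by simp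
  qed
  have P1: "(\<Prod>i<r. y ^ r - y ^ i) = y ^ (r * r) * W r"
    using prod_power_diff[of y r r] y by (simp add: W_def)
  have P2: "(\<Prod>i<r - u. y ^ r - y ^ i) * W u = y ^ (r * (r - u)) * W r"
    using prod_power_diff[of y "r - u" r] y ur by (simp add: W_def)
  let ?e = "x ^ ((k - 1) * n * n)"
  have "y ^ (r * (r - u)) * (C * A * W u) = C * A * y ^ ((r - u) * r) * W u"
    by (simp add: mult_ac)
  also have "\<dots> = ?e * (\<Prod>i<r. y ^ r - y ^ i) * ((\<Prod>i<r - u. y ^ r - y ^ i) * W u)"
    using count unfolding y_def[symmetric] by simp
  also have "\<dots> = y ^ (r * (r - u)) * (?e * y ^ (r * r) * (W r)\<^sup>2)"
    unfolding P1 P2 by (simp add: power2_eq_square mult_ac)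
  finally have eq: "C * A * W u = ?e * y ^ (r * r) * (W r)\<^sup>2" using y by simp
  have "?e * y ^ (r * r) * (W r)\<^sup>2 > 0" using x y W_pos[of r] by simp
  hence A: "A \<noteq> 0" using eq by auto
  have pw: "x powi (int (d * r\<^sup>2) - int (n\<^sup>2)) = y ^ (r * r) / x ^ (n * n)"
  proof -
    have "x powi (int a - int b) = x ^ a / x ^ b" for a b using x by (simp add: power_int_diff)
    thus ?thesis unfolding y_def power2_eq_square power_mult[symmetric] .
  qed
  have kn: "x ^ (k * (n * n)) = ?e * x ^ (n * n)"
    using k by (cases k) (simp_all add: power_add[symmetric] algebra_simps)
  have e0: "?e \<noteq> 0" using x by simp
  have "C = ?e * y ^ (r * r) * (W r)\<^sup>2 / (A * W u)" using eq A W_pos[of u] by (simp add: field_simps)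
  moreover have "c / (e * z) = a / z / f * b" if "c = e * a * b / f" "e \<noteq> 0" for a b c e f z :: real
    using that by simp
  ultimately have "C / x ^ (k * (n * n)) = y ^ (r * r) / x ^ (n * n) / (A * W u) * (W r)\<^sup>2"
    unfolding kn using e0 by blast
  thus ?thesis unfolding pw w W_def prod_power_distrib .
qed

theorem theorem1p3:
  fixes p k n :: nat
    and P :: "'a::nontriv mod_ring poly"
    and Pbar :: "'p::prime_card mod_ring poly"
    and G :: "('a mod_ring poly set, 'g) module"
    and Xbar :: "'p mod_ring mat"
  assumes "prime p" and "k \<ge> 1"
    and "CARD('p) = p" and "CARD('a) = p ^ k"
    and "lead_coeff P = 1"
    and "Pbar = map_poly reduce_mod P" and "irreducible Pbar"
    and "module (poly_quot P) G" and "finite (carrier G)"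
    and "n \<ge> 1"
    and "Xbar \<in> carrier_mat n n"
    and "module_iso (poly_quot P)
           (restrict_scalars reduce_quot (cok_poly Pbar Xbar))
           (quot_module G (multiples p G))"
  shows "measure_pmf.prob (pmf_of_set (carrier_mat n n :: 'a mod_ring mat set))
           {X. module_iso (poly_quot P) (cok_poly P X) G \<and> map_mat reduce_mod X = Xbar}
         = real p powi (int (degree P * (r_q p P Pbar G)\<^sup>2) - int (n\<^sup>2))
           / (real (card (module_aut (poly_quot P) G))
              * (\<Prod>i = 1..u_q p k P Pbar G. (1 - real p powi (- int (i * degree P)))))
           * (\<Prod>i = 1..r_q p P Pbar G. (1 - real p powi (- int (i * degree P)))\<^sup>2)"
proof -
  interpret monic_lift p k "TYPE('a)" "TYPE('p)" P Pbar
    by unfold_locales (fact assms)+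
  define Gt where "Gt = restrict_scalars (proj P) G"
  have Gt: "cring_module Gt" unfolding Gt_def by (rule restrict_proj[OF assms(8)])
  have Gt_simps: "carrier Gt = carrier G" "\<zero>\<^bsub>Gt\<^esub> = \<zero>\<^bsub>G\<^esub>" unfolding Gt_def by simp_all
  note gD = cring_moduleD[OF Gt]
  define r where "r = r_q p P Pbar G"
  define u where "u = u_q p k P Pbar G"
  have PG: "P \<odot>\<^bsub>Gt\<^esub> x = \<zero>\<^bsub>Gt\<^esub>" if x: "x \<in> carrier Gt" for x
  proof -
    have "proj P P = proj P 0" unfolding proj_eq_iff by simp
    hence "P \<odot>\<^bsub>Gt\<^esub> x = 0 \<odot>\<^bsub>Gt\<^esub> x" unfolding Gt_def restrict_scalars_simps by simp
    thus ?thesis using gD(7)[OF x] by simp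
  qed
  have PG': "P \<odot>\<^bsub>restrict_scalars (proj P) G\<^esub> x = \<zero>\<^bsub>G\<^esub>" if "x \<in> carrier G" for x
    using PG[of x] that Gt_simps unfolding Gt_def by simp
  have mult: "multiples m G = (\<lambda>x. [:of_nat m:] \<odot>\<^bsub>Gt\<^esub> x) ` carrier Gt" for m
    using multiples_eq_smult_image[OF Gt, of m] unfolding Gt_def multiples_restrict .
  have pG: "submod (multiples p G) Gt" unfolding mult by (rule submod_smult_image[OF submod_carrier[OF Gt]])
  have quot_carrier: "carrier (quot_module Gt (multiples p G)) = carrier (quot_module G (multiples p G))"
    unfolding Gt_def quot_module_restrict[symmetric] by simp
  have card_r: "card (carrier (quot_module G (multiples p G))) = q ^ r"
    unfolding r_def by (rule card_quot_multiples_p[OF assms(8,9) PG'])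
  have card_G: "card (carrier Gt) = q ^ r * card ((\<lambda>x. [:of_nat p:] \<odot>\<^bsub>Gt\<^esub> x) ` carrier Gt)"
    using card_quot[OF pG] unfolding quot_carrier card_r mult[symmetric] by (rule sym)
  let ?C = "restrict_scalars reduce_quot (cok_poly Pbar Xbar) :: ('a mod_ring poly set, 'p mod_ring vec set) module"
  let ?Kbar = "(\<lambda>v. poly_mat Pbar Xbar *\<^sub>v v) ` carrier_vec n"
  have "cok_poly Pbar Xbar = descend_scalars class_ring (proj Pbar) (quot_module (mat_module Xbar) ?Kbar)"
    using assms(11) by (simp add: cok_poly_def)
  hence car: "carrier ?C = carrier (quot_module (mat_module Xbar) ?Kbar)" by (simp add: descend_scalars_def)
  obtain f where f: "bij_betw f (carrier ?C) (carrier (quot_module G (multiples p G)))"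
    using assms(12) unfolding module_iso_def by blast
  have "card (carrier (quot_module (mat_module Xbar) ?Kbar)) = q ^ r"
    using bij_betw_same_card[OF f] unfolding car card_r .
  moreover have "card (carrier (mat_module Xbar)) = p ^ n"
    using card_Vbar by (simp add: mat_module_simps[OF assms(11)])
  ultimately have card_cok: "p ^ n = q ^ r * card ?Kbar"
    using card_quot[OF submod_image_poly_mat[OF assms(11), of Pbar]] by simp
  interpret cokernel_count p k "TYPE('a)" "TYPE('p)" P Pbar n r Gt Xbar
    by (intro cokernel_count.intro cokernel_count_axioms.intro monic_lift_axioms Gt PG card_G card_cok assms(11))
      (simp_all add: Gt_simps assms(9))
  have card_u: "card ((\<lambda>x. [:of_nat p ^ (k - 1):] \<odot>\<^bsub>Gt\<^esub> x) ` carrier Gt) = q ^ u"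
    using card_multiples_top[OF assms(8,9) PG'] unfolding u_def mult of_nat_power .
  have aut: "module_aut (poly_quot P) G = module_aut class_ring Gt"
    unfolding Gt_def by (rule module_aut_restrict)
  let ?S = "{X. module_iso (poly_quot P) (cok_poly P X) G \<and> map_mat reduce_mod X = Xbar}"
  have "X \<in> carrier_mat n n \<Longrightarrow> module_iso (poly_quot P) (cok_poly P X) G
      \<longleftrightarrow> module_iso class_ring (quot_module (mat_module X) (image_P X)) Gt" for X
    unfolding Gt_def image_P_def by (rule cok_poly_iso_iff)
  hence S: "carrier_mat n n \<inter> ?S = cok_lifts" by (auto simp: cok_lifts_def lifts_def)
  have fin: "finite (carrier_mat n n :: 'a mod_ring mat set)"
    and card: "card (carrier_mat n n :: 'a mod_ring mat set) = p ^ (k * (n * n))"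
    using finite_card_carrier_mat[of n n, where 'a = "'a mod_ring"] by (simp_all add: card_a power_mult)
  have ne: "(carrier_mat n n :: 'a mod_ring mat set) \<noteq> {}" using zero_carrier_mat by blast
  have "measure_pmf.prob (pmf_of_set (carrier_mat n n :: 'a mod_ring mat set)) ?S
      = real (card cok_lifts) / real p ^ (k * (n * n))"
    unfolding measure_pmf_of_set[OF ne fin] S card by simp
  also have "\<dots> = real p powi (int (degree P * r\<^sup>2) - int (n\<^sup>2))
      / (real (card (module_aut class_ring Gt)) * (\<Prod>i = 1..u. (1 - real p powi (- int (i * degree P)))))
      * (\<Prod>i = 1..r. (1 - real p powi (- int (i * degree P)))\<^sup>2)"
  proof (rule probability_from_count)
    show "real p > 1" using prime_gt_1_nat[OF assms(1)] by simp
    show "real (card cok_lifts) * real (card (module_aut class_ring Gt)) * (real p ^ degree P) ^ ((r - u) * r)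
      = real p ^ ((k - 1) * n * n) * (\<Prod>i<r. (real p ^ degree P) ^ r - (real p ^ degree P) ^ i)
        * (\<Prod>i<r - u. (real p ^ degree P) ^ r - (real p ^ degree P) ^ i)"
      using card_cok_lifts(2)[OF card_u] unfolding card_T of_nat_power .
  qed (rule d_pos, rule assms(2), rule card_cok_lifts(1)[OF card_u])
  finally show ?thesis unfolding aut r_def u_def .
qed

end
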